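(* Let $p\ge 1$, $q\ge 0$, $n=p+q$. The limits of the constant curvature semi-Riemannian geometry $(\mathsf X(p,q),\mathrm{PO}(p,q))$ inside $(\mathbb{RP}^{n-1},\mathrm{PGL}_n\mathbb R)$ are all of the form $(\mathsf X(\boldsymbol\beta),\mathrm P\,\mathrm{Isom}(\boldsymbol\beta,\mathcal F))$, for a partial flag $\mathcal F$ of $\mathbb R^n$ and a partial flag of quadratic forms $\boldsymbol\beta$ on $\mathcal F$. Further, $\mathsf X(\boldsymbol\beta)$ is a limit of $\mathsf X(p,q)$ if and only if $p_0\neq 0$ and the signatures $((p_0,q_0),\ldots,(p_k,q_k))$ of $\boldsymbol\beta$ partition the signature $(p,q)$ in the sense that $$p_0+\cdots+p_k=p\quad\text{and}\quad q_0+\cdots+q_k=q,$$ after exchanging $(p_i,q_i)$ with $(q_i,p_i)$ for some collection of indices $i$ in $\{1,\ldots,k\}$ (the first signature $(p_0,q_0)$ must not be reversed).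
   Context: The signature of a non-degenerate quadratic form is $(n_-,n_+)$, where $n_-$ (resp. $n_+$) is the dimension of a largest subspace on which the form is negative (resp. positive) definite. For $\beta$ a quadratic form of signature $(p,q)$ on $\mathbb R^n$, $\mathsf X(p,q)=\{[x]\in\mathbb{RP}^{n-1}:\beta(x)<0\}$, and $\mathrm{PO}(p,q)$ is the image in $\mathrm{PGL}_n\mathbb R$ of the isometry group of $\beta$; it acts transitively on $\mathsf X(p,q)$. A partial flag $\mathcal F=\{V_0,\ldots,V_{k+1}\}$ of $\mathbb R^n$ is a descending chain of subspaces $\mathbb R^n=V_0\supset V_1\supset\cdots\supset V_k\supset V_{k+1}=\{0\}$. A partial flag of quadratic forms $\boldsymbol\beta=(\beta_0,\ldots,\beta_k)$ on $\mathcal F$ is a collection of non-degenerate quadratic forms $\beta_i$ on the quotients $V_i/V_{i+1}$; its signature is $((p_0,q_0),\ldots,(p_k,q_k))$ with $(p_i,q_i)$ the signature of $\beta_i$. $\mathrm{Isom}(\boldsymbol\beta,\mathcal F)$ is the group of linear transformations of $\mathbb R^n$ which preserve $\mathcal F$ and induce an isometry of each $\beta_i$; $\mathrm P\,\mathrm{Isom}(\boldsymbol\beta,\mathcal F)$ is its image in $\mathrm{PGL}_n\mathbb R$. Put $\mathsf X(\boldsymbol\beta)=\{[x]\in\mathbb{RP}^{n-1}:\beta_0(x)<0\}$, where $\beta_0(x)$ means $\beta_0(x+V_1)$; "$\mathsf X(\boldsymbol\beta)$ is a limit of $\mathsf X(p,q)$" refers to these spaces with structure groups $\mathrm P\,\mathrm{Isom}(\boldsymbol\beta,\mathcal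 F)$ and $\mathrm{PO}(p,q)$. A geometry is a pair $(X,G)$ with $G$ a Lie group acting transitively by analytic maps on a connected smooth manifold $X$. A geometry $(Y,H)$ is a subgeometry of $(X,G)$ if $H$ is a closed subgroup of $G$ and $Y$ is an open subset of $X$ on which $H$ acts transitively. Closed subgroups $H_n\subset G$ converge geometrically to a closed subgroup $L$ if every $g\in L$ is the limit of some sequence $h_n\in H_n$ and every accumulation point of every sequence $h_n\in H_n$ lies in $L$. Subgeometries $(Y_n,H_n)\subset(X,G)$ converge to a subgeometry $(Z,L)\subset(X,G)$ if $H_n$ converges geometrically to $L$ and there is $z\in Z\subset X$ with $z\in Y_n$ for all $n$ sufficiently large. A subgeometry $(Z,L)$ is a limit of $(Y,H)$ if there is a sequence $g_n\in G$ such that $(g_nY,g_nHg_n^{-1})$ converges to $(Z,L)$. *)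

theory Defs
  imports "HOL-Analysis.Analysis" "HOL-Algebra.Group"
begin

section \<open>Real projective space and the projective linear group\<close>

text \<open>Real projective space of dimension CARD('n) - 1 and the projective linear group are the
  quotients of the nonzero vectors and of the invertible matrices by nonzero scalars, with the
  quotient topologies. The class maps \<^term>\<open>rp_class\<close>, \<^term>\<open>pgl_class\<close> below are meaningful only on
  nonzero vectors and invertible matrices respectively.\<close>

definition rp_rel :: "real^'n \<Rightarrow> real^'n \<Rightarrow> bool" where
  "rp_rel x y \<longleftrightarrow> x \<noteq> 0 \<and> (\<exists>c::real. c \<noteq> 0 \<and> y = c *\<^sub>R x)"

definition pgl_rel :: "real^'n^'n \<Rightarrow> real^'n^'n \<Rightarrow> bool" where
  "pgl_rel A B \<longleftrightarrow> invertible A \<and> (\<exists>c::real. c \<noteq> 0 \<and> B = c *\<^sub>R A)"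

lemma part_equivp_rp_rel: "part_equivp (rp_rel :: real^'n \<Rightarrow> _)"
proof (rule part_equivpI)
  show "\<exists>x. rp_rel x (x :: real^'n)"
    by (rule exI[of _ "axis undefined 1"]) (auto simp: rp_rel_def axis_eq_0_iff intro!: exI[of _ 1])
  show "symp (rp_rel :: real^'n \<Rightarrow> _)"
  proof (rule sympI)
    fix x y :: "real^'n" assume "rp_rel x y"
    then obtain c where c: "x \<noteq> 0" "c \<noteq> 0" "y = c *\<^sub>R x" by (auto simp: rp_rel_def)
    then have "x = inverse c *\<^sub>R y" "inverse c \<noteq> 0" "y \<noteq> 0" by auto
    then show "rp_rel y x" unfolding rp_rel_def by blast
  qed
  show "transp (rp_rel :: real^'n \<Rightarrow> _)"
  proof (rule transpI)
    fix x y z :: "real^'n" assume "rp_rel x y" "rp_rel y z"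
    then obtain c d where "x \<noteq> 0" "c \<noteq> 0" "y = c *\<^sub>R x" "d \<noteq> 0" "z = d *\<^sub>R y"
      by (auto simp: rp_rel_def)
    then have "x \<noteq> 0 \<and> d * c \<noteq> 0 \<and> z = (d * c) *\<^sub>R x" by auto
    then show "rp_rel x z" unfolding rp_rel_def by blast
  qed
qed

lemma part_equivp_pgl_rel: "part_equivp (pgl_rel :: real^'n^'n \<Rightarrow> _)"
proof (rule part_equivpI)
  show "\<exists>A. pgl_rel A (A :: real^'n^'n)"
    by (rule exI[of _ "mat 1"]) (auto simp: pgl_rel_def invertible_def intro!: exI[of _ 1])
  show "symp (pgl_rel :: real^'n^'n \<Rightarrow> _)"
  proof (rule sympI)
    fix A B :: "real^'n^'n" assume "pgl_rel A B"
    then obtain c where c: "invertible A" "c \<noteq> 0" "B = c *\<^sub>R A" by (auto simp: pgl_rel_def)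
    then have "A = inverse c *\<^sub>R B" "inverse c \<noteq> 0" "invertible B"
      by (auto simp: scalar_invertible)
    then show "pgl_rel B A" unfolding pgl_rel_def by blast
  qed
  show "transp (pgl_rel :: real^'n^'n \<Rightarrow> _)"
  proof (rule transpI)
    fix A B C :: "real^'n^'n" assume "pgl_rel A B" "pgl_rel B C"
    then obtain c d where "invertible A" "c \<noteq> 0" "B = c *\<^sub>R A" "d \<noteq> 0" "C = d *\<^sub>R B"
      by (auto simp: pgl_rel_def)
    then have "invertible A \<and> d * c \<noteq> 0 \<and> C = (d * c) *\<^sub>R A" by auto
    then show "pgl_rel A C" unfolding pgl_rel_def by blast
  qed
qed

quotient_type (overloaded) 'n rp = "real^'n" / partial: "rp_rel :: real^'n \<Rightarrow> _"
  morphisms rp_rep rp_class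
  by (rule part_equivp_rp_rel)

quotient_type (overloaded) 'n pgl = "real^'n^'n" / partial: "pgl_rel :: real^'n^'n \<Rightarrow> _"
  morphisms pgl_rep pgl_class
  by (rule part_equivp_pgl_rel)

instantiation rp :: (finite) topological_space
begin

definition open_rp :: "'a rp set \<Rightarrow> bool" where
  "open_rp U \<longleftrightarrow> open {x. x \<noteq> 0 \<and> rp_class x \<in> U}"

instance
proof
  have "{x::real^'a. x \<noteq> 0} = - {0}" by auto
  then show "open (UNIV :: 'a rp set)" by (auto simp: open_rp_def)
next
  fix S T :: "'a rp set" assume "open S" "open T"
  moreover have "{x. x \<noteq> 0 \<and> rp_class x \<in> S \<inter> T} =
    {x. x \<noteq> 0 \<and> rp_class x \<in> S} \<inter> {x. x \<noteq> 0 \<and> rp_class x \<in> T}" by auto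
  ultimately show "open (S \<inter> T)" by (simp add: open_rp_def open_Int)
next
  fix K :: "'a rp set set" assume "\<forall>S\<in>K. open S"
  moreover have "{x. x \<noteq> 0 \<and> rp_class x \<in> \<Union>K} = (\<Union>S\<in>K. {x. x \<noteq> 0 \<and> rp_class x \<in> S})" by auto
  ultimately show "open (\<Union>K)" unfolding open_rp_def by (metis (no_types, lifting) open_UN)
qed

end

lemma open_invertible: "open {A::real^'n^'n. invertible A}"
proof -
  have "continuous_on UNIV (det :: real^'n^'n \<Rightarrow> real)"
    unfolding det_def by (intro continuous_intros)
  then have "open (det -` (- {0::real}) :: (real^'n^'n) set)"
    by (intro open_vimage) auto
  moreover have "{A::real^'n^'n. invertible A} = det -` (- {0})"
    by (auto simp: invertible_det_nz)
  ultimately show ?thesis by simp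
qed

instantiation pgl :: (finite) topological_space
begin

definition open_pgl :: "'a pgl set \<Rightarrow> bool" where
  "open_pgl U \<longleftrightarrow> open {A. invertible A \<and> pgl_class A \<in> U}"

instance
proof
  show "open (UNIV :: 'a pgl set)" by (simp add: open_pgl_def open_invertible)
next
  fix S T :: "'a pgl set" assume "open S" "open T"
  moreover have "{A. invertible A \<and> pgl_class A \<in> S \<inter> T} =
    {A. invertible A \<and> pgl_class A \<in> S} \<inter> {A. invertible A \<and> pgl_class A \<in> T}" by auto
  ultimately show "open (S \<inter> T)" by (simp add: open_pgl_def open_Int)
next
  fix K :: "'a pgl set set" assume "\<forall>S\<in>K. open S"
  moreover have "{A. invertible A \<and> pgl_class A \<in> \<Union>K} = (\<Union>S\<in>K. {A. invertible A \<and> pgl_class A \<in> S})"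
    by auto
  ultimately show "open (\<Union>K)" unfolding open_pgl_def by (metis (no_types, lifting) open_UN)
qed

end

lift_definition pgl_mult :: "'n::finite pgl \<Rightarrow> 'n pgl \<Rightarrow> 'n pgl" is "\<lambda>A B. A ** B"
proof -
  fix A A' B B' :: "real^'n^'n" assume "pgl_rel A A'" "pgl_rel B B'"
  then obtain c d where "invertible A" "c \<noteq> 0" "A' = c *\<^sub>R A" "invertible B" "d \<noteq> 0" "B' = d *\<^sub>R B"
    by (auto simp: pgl_rel_def)
  then have "invertible (A ** B) \<and> c * d \<noteq> 0 \<and> A' ** B' = (c * d) *\<^sub>R (A ** B)"
    by (simp add: invertible_mult)
      (simp add: matrix_matrix_mult_def vec_eq_iff sum_distrib_left algebra_simps)
  then show "pgl_rel (A ** B) (A' ** B')" unfolding pgl_rel_def by blast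
qed

lift_definition pgl_one :: "'n::finite pgl" is "mat 1"
  by (auto simp: pgl_rel_def invertible_def intro!: exI[of _ 1])

lift_definition pgl_act :: "'n::finite pgl \<Rightarrow> 'n rp \<Rightarrow> 'n rp" is "\<lambda>A x. A *v x"
proof -
  fix A A' :: "real^'n^'n" and x x' :: "real^'n" assume "pgl_rel A A'" "rp_rel x x'"
  then obtain c d where *: "invertible A" "c \<noteq> 0" "A' = c *\<^sub>R A" "x \<noteq> 0" "d \<noteq> 0" "x' = d *\<^sub>R x"
    by (auto simp: pgl_rel_def rp_rel_def)
  then have "A *v x \<noteq> 0"
    by (metis invertible_def matrix_left_invertible_ker)
  moreover from * have "A' *v x' = (c * d) *\<^sub>R (A *v x)"
    by (simp add: scaleR_matrix_vector_assoc[symmetric] matrix_vector_mult_scaleR)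
  ultimately have "A *v x \<noteq> 0 \<and> c * d \<noteq> 0 \<and> A' *v x' = (c * d) *\<^sub>R (A *v x)"
    using * by auto
  then show "rp_rel (A *v x) (A' *v x')" unfolding rp_rel_def by blast
qed

definition PGL :: "'n::finite pgl monoid" where
  "PGL = \<lparr>carrier = UNIV, mult = pgl_mult, one = pgl_one\<rparr>"

lemma group_PGL: "Group.group (PGL :: 'n::finite pgl monoid)"
proof (rule groupI)
  fix x y z :: "'n pgl"
  show "x \<otimes>\<^bsub>PGL\<^esub> y \<otimes>\<^bsub>PGL\<^esub> z = x \<otimes>\<^bsub>PGL\<^esub> (y \<otimes>\<^bsub>PGL\<^esub> z)"
    unfolding PGL_def by (simp, transfer)
      (auto simp: pgl_rel_def matrix_mul_assoc invertible_mult intro!: exI[of _ 1])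
  show "\<one>\<^bsub>PGL\<^esub> \<otimes>\<^bsub>PGL\<^esub> x = x"
    unfolding PGL_def by (simp, transfer) (auto simp: pgl_rel_def)
  obtain A where A: "x = pgl_class A" "pgl_rel A A"
    using Quotient3_abs_rep[OF Quotient3_pgl] Quotient3_rep_reflp[OF Quotient3_pgl] by metis
  then obtain B where B: "A ** B = mat 1" "B ** A = mat 1"
    by (auto simp: pgl_rel_def invertible_def)
  then have "invertible B"
    unfolding invertible_def by blast
  then have "pgl_rel B B"
    by (auto simp: pgl_rel_def intro!: exI[of _ 1])
  then have "pgl_mult (pgl_class B) x = pgl_one"
    using A B by (simp add: pgl_mult.abs_eq pgl_one.abs_eq)
  then have "\<exists>y. pgl_mult y x = pgl_one" by blast
  then show "\<exists>y\<in>carrier PGL. y \<otimes>\<^bsub>PGL\<^esub> x = \<one>\<^bsub>PGL\<^esub>"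
    by (simp add: PGL_def)
qed (auto simp: PGL_def)

section \<open>Subgeometries of real projective space and their limits\<close>

text \<open>A closed subgroup of a Lie group is a Lie group and an open subset of a manifold is a
  manifold, on which the restricted action stays analytic; so of the requirements on a geometry
  only connectedness of the space and transitivity have to be imposed.\<close>

definition subgeometry :: "'n::finite rp set \<Rightarrow> 'n pgl set \<Rightarrow> bool" where
  "subgeometry Y H \<longleftrightarrow>
     subgroup H PGL \<and> closed H \<and> open Y \<and> connected Y \<and>
     (\<forall>h\<in>H. \<forall>y\<in>Y. pgl_act h y \<in> Y) \<and>
     (\<forall>x\<in>Y. \<forall>y\<in>Y. \<exists>h\<in>H. pgl_act h x = y)"

definition accumulation_point :: "(nat \<Rightarrow> 'a::topological_space) \<Rightarrow> 'a \<Rightarrow> bool" where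
  "accumulation_point h x \<longleftrightarrow> (\<forall>U. open U \<and> x \<in> U \<longrightarrow> (\<exists>\<^sub>F m in sequentially. h m \<in> U))"

definition converges_geometrically :: "(nat \<Rightarrow> 'n::finite pgl set) \<Rightarrow> 'n pgl set \<Rightarrow> bool" where
  "converges_geometrically H L \<longleftrightarrow>
     (\<forall>g\<in>L. \<exists>h. (\<forall>m. h m \<in> H m) \<and> h \<longlonglongrightarrow> g) \<and>
     (\<forall>h g. (\<forall>m. h m \<in> H m) \<and> accumulation_point h g \<longrightarrow> g \<in> L)"

definition subgeometries_converge ::
    "(nat \<Rightarrow> 'n::finite rp set) \<Rightarrow> (nat \<Rightarrow> 'n pgl set) \<Rightarrow> 'n rp set \<Rightarrow> 'n pgl set \<Rightarrow> bool" where
  "subgeometries_converge Y H Z L \<longleftrightarrow>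
     (\<forall>m. subgeometry (Y m) (H m)) \<and> subgeometry Z L \<and>
     converges_geometrically H L \<and>
     (\<exists>z\<in>Z. \<forall>\<^sub>F m in sequentially. z \<in> Y m)"

definition is_limit_of :: "'n::finite rp set \<times> 'n pgl set \<Rightarrow> 'n rp set \<times> 'n pgl set \<Rightarrow> bool"
    (infix "is'_limit'_of" 50) where
  "ZL is_limit_of YH \<longleftrightarrow>
     (case ZL of (Z, L) \<Rightarrow> case YH of (Y, H) \<Rightarrow>
       subgeometry Y H \<and>
       (\<exists>g :: nat \<Rightarrow> 'n pgl.
          subgeometries_converge
            (\<lambda>m. pgl_act (g m) ` Y)
            (\<lambda>m. (\<lambda>h. g m \<otimes>\<^bsub>PGL\<^esub> h \<otimes>\<^bsub>PGL\<^esub> inv\<^bsub>PGL\<^esub> (g m)) ` H)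
            Z L))"

section \<open>Quadratic forms on quotients of subspaces\<close>

text \<open>For subspaces W of V, a function on the quotient V/W is handled through its pullback Q to V,
  which is only evaluated on V; subspaces of V/W are the U/W with U a subspace between W and V.
  The case V = UNIV and W = {0} is that of a form on the whole space.\<close>

definition quadratic_form_on :: "(real^'n) set \<Rightarrow> (real^'n \<Rightarrow> real) \<Rightarrow> bool" where
  "quadratic_form_on V Q \<longleftrightarrow> (\<exists>B. bilinear B \<and> (\<forall>x\<in>V. Q x = B x x))"

text \<open>The radical of the polar form Q (x + y) - Q x - Q y is zero in V/W.\<close>

definition nondegenerate_mod ::
    "(real^'n) set \<Rightarrow> (real^'n) set \<Rightarrow> (real^'n \<Rightarrow> real) \<Rightarrow> bool" where
  "nondegenerate_mod V W Q \<longleftrightarrow>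
     (\<forall>x\<in>V. (\<forall>y\<in>V. Q (x + y) - Q x - Q y = 0) \<longrightarrow> x \<in> W)"

text \<open>The negative index comes first.\<close>

definition signature_mod ::
    "(real^'n) set \<Rightarrow> (real^'n) set \<Rightarrow> (real^'n \<Rightarrow> real) \<Rightarrow> nat \<times> nat" where
  "signature_mod V W Q =
     (Max {dim U - dim W | U. subspace U \<and> W \<subseteq> U \<and> U \<subseteq> V \<and> (\<forall>x\<in>U - W. Q x < 0)},
      Max {dim U - dim W | U. subspace U \<and> W \<subseteq> U \<and> U \<subseteq> V \<and> (\<forall>x\<in>U - W. Q x > 0)})"

definition X_space :: "(real^'n \<Rightarrow> real) \<Rightarrow> 'n rp set" where
  "X_space Q = {rp_class x | x. x \<noteq> 0 \<and> Q x < 0}"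

definition PO :: "(real^'n \<Rightarrow> real) \<Rightarrow> 'n pgl set" where
  "PO Q = pgl_class ` {A. invertible A \<and> (\<forall>x. Q (A *v x) = Q x)}"

section \<open>Partial flags of quadratic forms\<close>

definition partial_flag :: "nat \<Rightarrow> (nat \<Rightarrow> (real^'n) set) \<Rightarrow> bool" where
  "partial_flag k V \<longleftrightarrow>
     (\<forall>i\<le>Suc k. subspace (V i)) \<and> V 0 = UNIV \<and> V (Suc k) = {0} \<and>
     (\<forall>i\<le>k. V (Suc i) \<subset> V i)"

text \<open>The i-th form \<beta> i is a function of the cosets x + V (Suc i) with x in V i; this is its
  pullback to V i.\<close>

definition pullback_form ::
    "(nat \<Rightarrow> (real^'n) set) \<Rightarrow> (nat \<Rightarrow> (real^'n) set \<Rightarrow> real) \<Rightarrow> nat \<Rightarrow> real^'n \<Rightarrow> real" where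
  "pullback_form V \<beta> i x = \<beta> i ((+) x ` V (Suc i))"

definition flag_of_forms ::
    "nat \<Rightarrow> (nat \<Rightarrow> (real^'n) set) \<Rightarrow> (nat \<Rightarrow> (real^'n) set \<Rightarrow> real) \<Rightarrow> bool" where
  "flag_of_forms k V \<beta> \<longleftrightarrow>
     (\<forall>i\<le>k. quadratic_form_on (V i) (pullback_form V \<beta> i) \<and>
            nondegenerate_mod (V i) (V (Suc i)) (pullback_form V \<beta> i))"

definition flag_signature ::
    "(nat \<Rightarrow> (real^'n) set) \<Rightarrow> (nat \<Rightarrow> (real^'n) set \<Rightarrow> real) \<Rightarrow> nat \<Rightarrow> nat \<times> nat" where
  "flag_signature V \<beta> i = signature_mod (V i) (V (Suc i)) (pullback_form V \<beta> i)"

definition Isom_flag ::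
    "nat \<Rightarrow> (nat \<Rightarrow> (real^'n) set) \<Rightarrow> (nat \<Rightarrow> (real^'n) set \<Rightarrow> real) \<Rightarrow> (real^'n^'n) set" where
  "Isom_flag k V \<beta> =
     {A. invertible A \<and> (\<forall>i\<le>Suc k. (*v) A ` V i = V i) \<and>
         (\<forall>i\<le>k. \<forall>x\<in>V i. pullback_form V \<beta> i (A *v x) = pullback_form V \<beta> i x)}"

definition P_Isom ::
    "nat \<Rightarrow> (nat \<Rightarrow> (real^'n) set) \<Rightarrow> (nat \<Rightarrow> (real^'n) set \<Rightarrow> real) \<Rightarrow> 'n pgl set" where
  "P_Isom k V \<beta> = pgl_class ` Isom_flag k V \<beta>"

definition X_flag :: "(nat \<Rightarrow> (real^'n) set) \<Rightarrow> (nat \<Rightarrow> (real^'n) set \<Rightarrow> real) \<Rightarrow> 'n rp set" where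
  "X_flag V \<beta> = X_space (pullback_form V \<beta> 0)"

text \<open>I is the set of indices at which the signature is reversed.\<close>

definition partitions_signature :: "nat \<Rightarrow> (nat \<Rightarrow> nat \<times> nat) \<Rightarrow> nat \<times> nat \<Rightarrow> bool" where
  "partitions_signature k s pq \<longleftrightarrow>
     (\<exists>I \<subseteq> {1..k}.
        (\<Sum>i\<le>k. if i \<in> I then snd (s i) else fst (s i)) = fst pq \<and>
        (\<Sum>i\<le>k. if i \<in> I then fst (s i) else snd (s i)) = snd pq)"

end

theory Submission
  imports Defs
begin

text \<open>
Conjugating \<open>PO \<beta>\<close> by \<open>g\<close> gives \<open>PO\<close> of the translated form \<open>\<beta> \<circ> g\<^sup>-\<^sup>1\<close>, and isometry groups
do not change when a form is rescaled. So a limit is governed by a sequence of forms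
\<open>\<beta>\<^sub>m = \<beta> \<circ> g\<^sub>m\<^sup>-\<^sup>1\<close> of signature \<open>(p, q)\<close>, seen up to scale. Diagonalizing each of them orthogonally, passing
to a subsequence by compactness, and making comparable eigenvalues proportional leads to matrices
\<open>T\<^sub>m \<rightarrow> S\<close> for which \<open>\<beta>\<^sub>m (T\<^sub>m x)\<close> is a sum of terms \<open>\<plusminus>c x\<^sub>j\<^sup>2\<close> where \<open>c\<close> runs through sizes
\<open>c\<^sub>0 \<gg> c\<^sub>1 \<gg> \<dots>\<close> (\<open>forms_normal_form\<close>). The level of a coordinate is the index of its size. The vectors
supported on levels at least \<open>i\<close> form the \<open>i\<close>-th space of a flag, and the signs on level \<open>i\<close> form a
quadratic form on the \<open>i\<close>-th quotient; every flag of forms arises from such a frame \<open>S\<close>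
(\<open>adapted_frame_exists\<close>).

The groups of the diagonal forms converge to the isometry group of this flag (\<open>PO_converges\<close>). In
one direction, an isometry \<open>A\<close> of the form with matrix \<open>D\<close> satisfies \<open>A\<^sup>T D = D A\<^sup>-\<^sup>1\<close>, so
its entries are those of the transposed inverse multiplied by ratios of sizes; in the limit the entries that lower the
level vanish and the diagonal blocks become isometries (\<open>limit_of_similarities\<close>). In the other direction,
a flag isometry is its block diagonal part, already an isometry of all diagonal forms, followed by
the Cayley transform of a matrix that raises the level; such a matrix is made skew for the diagonal
forms by entries that tend to zero (\<open>isometry_is_limit\<close>). A geometric limit is determined by any
subsequence, so the group of every limit is a flag isometry group. Its space is an open orbit on
which the top form is negative, and the flag group is already transitive on all such points
(\<open>open_orbit_eq_X_flag\<close>).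

For the signatures, the counts of negative and positive signs in the normal form are \<open>p\<close> and
\<open>q\<close> by Sylvester's law. A flag isometry group determines its flag, whose members are the invariant subspaces, and each
form up to a nonzero factor (\<open>P_Isom_determines_flag\<close>); a negative factor swaps the two indices, and the
factor of the top form is positive because the space of the geometry is where the top form is negative.
Conversely, given a frame for a flag whose signatures partition \<open>(p, q)\<close>, the translates of \<open>\<beta>\<close> that are diagonal in this frame with size
\<open>(m + 1)\<^sup>-\<^sup>i\<close> on level \<open>i\<close> produce the flag as a limit (\<open>flag_geometry_is_limit\<close>).
\<close>

section \<open>Matrices and the topology of the projective linear group\<close>

lemma matrix_inv_both:
  fixes A :: "'a::semiring_1^'n^'m"
  assumes "invertible A"
  shows matrix_inv_right: "A ** matrix_inv A = mat 1" and matrix_inv_left: "matrix_inv A ** A = mat 1"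
  using someI_ex[OF assms[unfolded invertible_def]] unfolding matrix_inv_def by auto

lemma invertible_matrix_inv:
  fixes A :: "'a::semiring_1^'n^'m"
  assumes "invertible A" shows "invertible (matrix_inv A)"
  using matrix_inv_both[OF assms] unfolding invertible_def by blast

lemma matrix_inv_unique:
  fixes A B :: "real^'n^'n"
  assumes "A ** B = mat 1" shows "matrix_inv A = B"
proof -
  have "invertible A" using assms by (auto simp: invertible_right_inverse)
  then have "matrix_inv A = matrix_inv A ** (A ** B)" using assms by simp
  also have "\<dots> = B" using matrix_inv_left[OF \<open>invertible A\<close>] by (simp add: matrix_mul_assoc)
  finally show ?thesis .
qed

lemma matrix_inv_vector:
  fixes A :: "real^'n^'n"
  assumes "invertible A"
  shows "A *v (matrix_inv A *v x) = x" "matrix_inv A *v (A *v x) = x"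
  using matrix_inv_both[OF assms] by (simp_all add: matrix_vector_mul_assoc)

lemma matrix_inv_matrix_inv:
  fixes A :: "real^'n^'n"
  assumes "invertible A" shows "matrix_inv (matrix_inv A) = A"
  by (rule matrix_inv_unique) (simp add: matrix_inv_left assms)

lemma matrix_inv_cancel:
  fixes A B :: "real^'n^'n"
  assumes "invertible A"
  shows "A ** (matrix_inv A ** B) = B" "matrix_inv A ** (A ** B) = B"
    "B ** A ** matrix_inv A = B" "B ** matrix_inv A ** A = B"
  using matrix_inv_both[OF assms]
  by (simp_all add: matrix_mul_assoc) (simp_all flip: matrix_mul_assoc)

lemma tendsto_matrix_mult [tendsto_intros]:
  fixes A B :: "'x \<Rightarrow> real^'n^'n"
  assumes "(A \<longlongrightarrow> a) F" "(B \<longlongrightarrow> b) F"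
  shows "((\<lambda>x. A x ** B x) \<longlongrightarrow> a ** b) F"
  unfolding matrix_matrix_mult_def
  by (intro tendsto_intros assms)

lemma tendsto_matrix_vector_mult [tendsto_intros]:
  fixes A :: "'x \<Rightarrow> real^'n^'n" and v :: "'x \<Rightarrow> real^'n"
  assumes "(A \<longlongrightarrow> a) F" "(v \<longlongrightarrow> b) F"
  shows "((\<lambda>x. A x *v v x) \<longlongrightarrow> a *v b) F"
  unfolding matrix_vector_mult_def
  by (intro tendsto_intros assms)

lemma tendsto_det [tendsto_intros]:
  fixes A :: "'x \<Rightarrow> real^'n^'n"
  assumes "(A \<longlongrightarrow> a) F"
  shows "((\<lambda>x. det (A x)) \<longlongrightarrow> det a) F"
  unfolding det_def by (intro tendsto_intros assms)

lemma tendsto_eventually_invertible: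
  fixes A :: "'x \<Rightarrow> real^'n^'n"
  assumes "(A \<longlongrightarrow> a) F" "invertible a"
  shows "\<forall>\<^sub>F x in F. invertible (A x)"
  using topological_tendstoD[OF assms(1) open_invertible] assms(2) by simp

text \<open>Cramer's rule expresses the entries of the inverse as quotients of determinants.\<close>
lemma tendsto_matrix_inv:
  fixes A :: "'x \<Rightarrow> real^'n^'n"
  assumes lim: "(A \<longlongrightarrow> a) F" and inv: "invertible a"
  shows "((\<lambda>x. matrix_inv (A x)) \<longlongrightarrow> matrix_inv a) F"
proof -
  define C :: "real^'n^'n \<Rightarrow> real^'n^'n" where
    "C M = (\<chi> k l. det (\<chi> i j. if j = k then (axis l 1 :: real^'n) $ i else M $ i $ j) / det M)" for M
  have C: "matrix_inv M = C M" if "invertible M" for M :: "real^'n^'n"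
  proof -
    have "matrix_inv M $ k $ l = C M $ k $ l" for k l
    proof -
      have "M *v (matrix_inv M *v axis l 1) = axis l 1"
        by (simp add: matrix_inv_vector that)
      then have *: "matrix_inv M *v axis l 1 =
          (\<chi> k. det (\<chi> i j. if j = k then (axis l 1 :: real^'n) $ i else M $ i $ j) / det M)"
        using cramer[of M] that by (simp add: invertible_det_nz)
      have "matrix_inv M $ k $ l = (matrix_inv M *v axis l 1) $ k"
        by (simp add: matrix_vector_mult_basis column_def)
      then show ?thesis unfolding * C_def by simp
    qed
    then show ?thesis by (simp add: vec_eq_iff)
  qed
  have "((\<lambda>x. C (A x)) \<longlongrightarrow> C a) F"
    unfolding C_def
  proof (intro tendsto_vec_lambda tendsto_divide tendsto_det)
    fix k l i j
    show "((\<lambda>x. if j = k then (axis l 1 :: real^'n) $ i else A x $ i $ j) \<longlongrightarrow>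
        (if j = k then (axis l 1 :: real^'n) $ i else a $ i $ j)) F"
      by (cases "j = k") (auto intro!: tendsto_intros lim)
  qed (use lim inv in \<open>auto simp: invertible_det_nz\<close>)
  moreover have "\<forall>\<^sub>F x in F. C (A x) = matrix_inv (A x)"
    using tendsto_eventually_invertible[OF lim inv] by eventually_elim (simp add: C)
  ultimately show ?thesis using C[OF inv] by (simp add: tendsto_cong)
qed

lemma invertible_if_trivial_kernel:
  fixes A :: "real^'n^'n"
  assumes "\<And>x. A *v x = 0 \<Longrightarrow> x = 0" shows "invertible A"
  using assms by (simp add: invertible_left_inverse matrix_left_invertible_ker)

lemma pgl_class_eq_iff:
  assumes "invertible A" "invertible B"
  shows "pgl_class A = pgl_class B \<longleftrightarrow> (\<exists>c. c \<noteq> 0 \<and> B = c *\<^sub>R A)"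
proof -
  have refl: "pgl_rel A A" "pgl_rel B B"
    using assms by (auto simp: pgl_rel_def intro!: exI[of _ 1])
  have "pgl_rel A B \<longleftrightarrow> pgl_class A = pgl_class B"
    using Quotient3_rel[OF Quotient3_pgl, of A B] refl by blast
  then show ?thesis using assms by (auto simp: pgl_rel_def)
qed

lemma rp_class_eq_iff:
  assumes "x \<noteq> 0" "y \<noteq> 0"
  shows "rp_class x = rp_class y \<longleftrightarrow> (\<exists>c. c \<noteq> 0 \<and> y = c *\<^sub>R x)"
proof -
  have refl: "rp_rel x x" "rp_rel y y"
    using assms by (auto simp: rp_rel_def intro!: exI[of _ 1])
  have "rp_rel x y \<longleftrightarrow> rp_class x = rp_class y"
    using Quotient3_rel[OF Quotient3_rp, of x y] refl by blast
  then show ?thesis using assms by (auto simp: rp_rel_def)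
qed

lemma pgl_class_cases:
  obtains A where "invertible A" "h = pgl_class A"
  using Quotient3_abs_rep[OF Quotient3_pgl] Quotient3_rep_reflp[OF Quotient3_pgl]
  by (metis pgl_rel_def)

lemma rp_class_cases:
  obtains x where "x \<noteq> 0" "z = rp_class x"
  using Quotient3_abs_rep[OF Quotient3_rp] Quotient3_rep_reflp[OF Quotient3_rp]
  by (metis rp_rel_def)

lemma pgl_rel_refl: "invertible A \<Longrightarrow> pgl_rel A A"
  by (auto simp: pgl_rel_def intro!: exI[of _ 1])

lemma rp_rel_refl: "x \<noteq> 0 \<Longrightarrow> rp_rel x x"
  by (auto simp: rp_rel_def intro!: exI[of _ 1])

lemma pgl_class_mult:
  "invertible A \<Longrightarrow> invertible B \<Longrightarrow> pgl_class A \<otimes>\<^bsub>PGL\<^esub> pgl_class B = pgl_class (A ** B)"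
  by (simp add: PGL_def pgl_mult.abs_eq pgl_rel_refl)

lemma pgl_class_act:
  "invertible A \<Longrightarrow> x \<noteq> 0 \<Longrightarrow> pgl_act (pgl_class A) (rp_class x) = rp_class (A *v x)"
  by (simp add: pgl_act.abs_eq pgl_rel_refl rp_rel_refl)

lemma pgl_class_one: "\<one>\<^bsub>PGL\<^esub> = pgl_class (mat 1)"
  by (simp add: PGL_def pgl_one.abs_eq)

lemma carrier_PGL: "carrier PGL = UNIV" by (simp add: PGL_def)

lemma invertible_mat_1: "invertible (mat 1 :: 'a::semiring_1^'n^'n)"
  unfolding invertible_def by (metis matrix_mul_lid)

lemma pgl_class_inv:
  assumes "invertible A"
  shows "inv\<^bsub>PGL\<^esub> (pgl_class A) = pgl_class (matrix_inv A)"
proof -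
  interpret Group.group PGL by (rule group_PGL)
  show ?thesis
    by (rule inv_equality)
      (simp_all add: pgl_class_mult assms invertible_matrix_inv matrix_inv_left pgl_class_one carrier_PGL)
qed

lemma invertible_vector_nonzero:
  fixes A :: "real^'n^'n"
  assumes "invertible A" shows "A *v x = 0 \<longleftrightarrow> x = 0"
  using matrix_inv_vector(2)[OF assms, of x] by (metis matrix_vector_mult_0_right)

lemma pgl_class_scale:
  assumes "invertible A" "c \<noteq> 0" shows "pgl_class (c *\<^sub>R A) = pgl_class A"
  using pgl_class_eq_iff[OF assms(1) scalar_invertible[OF assms(2,1)]] assms by auto

lemma tendsto_pgl_class:
  fixes A :: "'x \<Rightarrow> real^'n^'n"
  assumes lim: "(A \<longlongrightarrow> a) F" and inv: "invertible a"
  shows "((\<lambda>x. pgl_class (A x)) \<longlongrightarrow> pgl_class a) F"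
proof (rule topological_tendstoI)
  fix U :: "'n pgl set" assume U: "open U" "pgl_class a \<in> U"
  then have "open {A. invertible A \<and> pgl_class A \<in> U}" by (simp add: open_pgl_def)
  from topological_tendstoD[OF lim this] show "\<forall>\<^sub>F x in F. pgl_class (A x) \<in> U"
    using U inv by (auto elim: eventually_mono)
qed

lemma continuous_on_rp_class: "continuous_on (- {0}) (rp_class :: real^'n \<Rightarrow> 'n rp)"
proof -
  have "\<exists>A. open A \<and> A \<inter> - {0::real^'n} = rp_class -` B \<inter> - {0}" if "open B" for B :: "'n rp set"
    using that unfolding open_rp_def
    by (intro exI[of _ "{x. x \<noteq> 0 \<and> rp_class x \<in> B}"]) auto
  then show ?thesis unfolding continuous_on_open_invariant by blast
qed

text \<open>The matrices over the image of \<open>W\<close> are the union of the nonzero multiples of \<open>W\<close>.\<close>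
lemma open_pgl_class_image:
  fixes W :: "(real^'n^'n) set"
  assumes "open W" and inv: "\<And>A. A \<in> W \<Longrightarrow> invertible A"
  shows "open (pgl_class ` W)"
proof -
  have "{A. invertible A \<and> pgl_class A \<in> pgl_class ` W} = (\<Union>c\<in>-{0}. (\<lambda>A. c *\<^sub>R A) ` W)"
  proof (rule subset_antisym; rule subsetI)
    fix A assume "A \<in> {A. invertible A \<and> pgl_class A \<in> pgl_class ` W}"
    then obtain B where "B \<in> W" "invertible A" "pgl_class B = pgl_class A" by auto
    then show "A \<in> (\<Union>c\<in>-{0}. (\<lambda>A. c *\<^sub>R A) ` W)"
      using pgl_class_eq_iff[of B A] inv by auto
  next
    fix A assume "A \<in> (\<Union>c\<in>-{0::real}. (\<lambda>A. c *\<^sub>R A) ` W)"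
    then obtain c B where "c \<noteq> 0" "B \<in> W" "A = c *\<^sub>R B" by auto
    then show "A \<in> {A. invertible A \<and> pgl_class A \<in> pgl_class ` W}"
      using inv pgl_class_scale scalar_invertible by blast
  qed
  moreover have "open (\<Union>c\<in>-{0::real}. (\<lambda>A. c *\<^sub>R A) ` W)"
    by (intro open_UN ballI open_scaling assms) auto
  ultimately show ?thesis unfolding open_pgl_def by simp
qed

text \<open>Since the class map is open, the classes of the matrices in a small ball around \<open>A\<close> form a
  neighbourhood, which the sequence visits infinitely often; lifts are taken in shrinking balls.\<close>
lemma accumulation_point_lift:
  fixes h :: "nat \<Rightarrow> 'n::finite pgl"
  assumes acc: "accumulation_point h (pgl_class A)" and inv: "invertible A"
  obtains r B where "strict_mono r" "B \<longlonglongrightarrow> A" "\<And>m. invertible (B m)" "\<And>m. h (r m) = pgl_class (B m)"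
proof -
  define W where "W k = {B. invertible B} \<inter> ball A (1 / Suc k)" for k :: nat
  have "open (pgl_class ` W k)" for k
    by (rule open_pgl_class_image) (auto simp: W_def intro!: open_Int open_invertible)
  moreover have "pgl_class A \<in> pgl_class ` W k" for k
    using inv by (auto simp: W_def)
  ultimately have freq: "\<exists>\<^sub>F m in sequentially. h m \<in> pgl_class ` W k" for k
    using acc unfolding accumulation_point_def by blast
  have next_idx: "\<exists>m > N. h m \<in> pgl_class ` W k" for N k
    using freq[of k] unfolding frequently_sequentially by (metis Suc_le_eq)
  have "\<exists>r. (\<forall>k. h (r k) \<in> pgl_class ` W k) \<and> (\<forall>k. r k < r (Suc k))"
  proof (rule dependent_nat_choice[where P = "\<lambda>k x. h x \<in> pgl_class ` W k" and Q = "\<lambda>_ x y. x < y", THEN exE])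
    show "\<exists>m. h m \<in> pgl_class ` W 0" using next_idx by blast
    show "\<exists>y. h y \<in> pgl_class ` W (Suc n) \<and> x < y" for x n using next_idx by blast
  qed blast
  then obtain r where r: "\<And>k. h (r k) \<in> pgl_class ` W k" "strict_mono r"
    by (auto simp: strict_mono_Suc_iff)
  then have "\<forall>k. \<exists>B. B \<in> W k \<and> h (r k) = pgl_class B" by blast
  then obtain B where B: "\<And>k. B k \<in> W k" "\<And>k. h (r k) = pgl_class (B k)" by metis
  have "dist (B k) A \<le> 1 / Suc k" for k
    using B(1)[of k] by (simp add: W_def dist_commute)
  moreover have "(\<lambda>k. 1 / real (Suc k)) \<longlonglongrightarrow> 0" by (rule lim_1_over_n[THEN LIMSEQ_Suc])
  ultimately have "(\<lambda>k. dist (B k) A) \<longlonglongrightarrow> 0"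
    by (intro Lim_null_comparison[of "\<lambda>k. dist (B k) A" "\<lambda>k. 1 / real (Suc k)"]) simp_all
  then have "B \<longlonglongrightarrow> A" by (simp add: tendsto_dist_iff[of B])
  with r B show thesis by (intro that[of r B]) (auto simp: W_def)
qed

lemma tendsto_imp_accumulation_point:
  assumes "h \<longlonglongrightarrow> g" shows "accumulation_point h g"
  unfolding accumulation_point_def
  using assms by (auto simp: tendsto_def intro!: eventually_frequently)

text \<open>A sequence from the subfamily extends by constants to one from the whole family, keeping its
  accumulation points.\<close>
lemma converges_geometrically_subseq:
  assumes conv: "converges_geometrically H L" and r: "strict_mono r" and ne: "\<And>m. H m \<noteq> {}"
  shows "converges_geometrically (\<lambda>m. H (r m)) L"
  unfolding converges_geometrically_def
proof (intro conjI ballI allI impI)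
  fix g assume "g \<in> L"
  then obtain h where "\<And>m. h m \<in> H m" "h \<longlonglongrightarrow> g"
    using conv unfolding converges_geometrically_def by blast
  then show "\<exists>h. (\<forall>m. h m \<in> H (r m)) \<and> h \<longlonglongrightarrow> g"
    using LIMSEQ_subseq_LIMSEQ[OF _ r] by (intro exI[of _ "h \<circ> r"]) auto
next
  fix h g assume h: "(\<forall>m. h m \<in> H (r m)) \<and> accumulation_point h g"
  define h' where "h' n = (if n \<in> range r then h (inv_into UNIV r n) else (SOME x. x \<in> H n))" for n
  have inj: "inj r" using r by (rule strict_mono_imp_inj_on)
  have "h' n \<in> H n" for n
    using h ne some_in_eq[of "H n"] inj by (auto simp: h'_def)
  moreover have "accumulation_point h' g"
    unfolding accumulation_point_def
  proof (intro allI impI)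
    fix U assume "open U \<and> g \<in> U"
    then have "\<exists>\<^sub>F m in sequentially. h m \<in> U" using h unfolding accumulation_point_def by blast
    then show "\<exists>\<^sub>F m in sequentially. h' m \<in> U"
      unfolding frequently_sequentially h'_def
      by (metis inj inv_f_f le_trans r rangeI seq_suble)
  qed
  ultimately show "g \<in> L" using conv unfolding converges_geometrically_def by blast
qed

lemma converges_geometrically_unique:
  assumes "converges_geometrically H L" "converges_geometrically H L'"
  shows "L = L'"
  using assms tendsto_imp_accumulation_point unfolding converges_geometrically_def
  by (metis subsetI subset_antisym)

section \<open>Limits of similarities of diagonal forms with separating scales\<close>

definition diag_form :: "('n \<Rightarrow> real) \<Rightarrow> real^'n \<Rightarrow> real" where
  "diag_form d x = (\<Sum>j\<in>UNIV. d j * (x $ j)\<^sup>2)"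

definition diag_bilinear :: "('n \<Rightarrow> real) \<Rightarrow> real^'n \<Rightarrow> real^'n \<Rightarrow> real" where
  "diag_bilinear d x y = (\<Sum>j\<in>UNIV. d j * (x $ j * y $ j))"

text \<open>The model of a flag of forms in coordinates: \<open>l\<close> assigns to each coordinate the step of the flag at
  which it is divided out, and \<open>e\<close> its sign.\<close>
definition level_space :: "('n \<Rightarrow> nat) \<Rightarrow> nat \<Rightarrow> (real^'n) set" where
  "level_space l i = {x. \<forall>j. l j < i \<longrightarrow> x $ j = 0}"

definition level_form :: "('n \<Rightarrow> nat) \<Rightarrow> ('n \<Rightarrow> real) \<Rightarrow> nat \<Rightarrow> real^'n \<Rightarrow> real" where
  "level_form l e i = diag_form (\<lambda>j. if l j = i then e j else 0)"

text \<open>In coordinates, the matrices over the projective isometry group: a class determines an isometry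
  up to a scalar, and \<open>s\<close> is the square of that scalar, common to all levels.\<close>
definition flag_similarity :: "('n \<Rightarrow> nat) \<Rightarrow> ('n \<Rightarrow> real) \<Rightarrow> real \<Rightarrow> real^'n^'n \<Rightarrow> bool" where
  "flag_similarity l e s A \<longleftrightarrow> (\<forall>i. \<forall>x\<in>level_space l i.
     A *v x \<in> level_space l i \<and> level_form l e i (A *v x) = s * level_form l e i x)"

lemma diag_form_add: "diag_form d (x + y) = diag_form d x + 2 * diag_bilinear d x y + diag_form d y"
  by (simp add: diag_form_def diag_bilinear_def algebra_simps power2_eq_square sum.distrib sum_distrib_left)

lemma diag_form_scale: "diag_form d (c *\<^sub>R x) = c\<^sup>2 * diag_form d x"
  by (simp add: diag_form_def sum_distrib_left power_mult_distrib algebra_simps)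

lemma diag_bilinear_linear:
  "diag_bilinear d (x + y) z = diag_bilinear d x z + diag_bilinear d y z"
  "diag_bilinear d (x - y) z = diag_bilinear d x z - diag_bilinear d y z"
  "diag_bilinear d z (x + y) = diag_bilinear d z x + diag_bilinear d z y"
  "diag_bilinear d z (x - y) = diag_bilinear d z x - diag_bilinear d z y"
  by (simp_all add: diag_bilinear_def sum.distrib sum_subtractf algebra_simps)

lemma diag_bilinear_commute: "diag_bilinear d x y = diag_bilinear d y x"
  by (simp add: diag_bilinear_def mult.commute)

lemma diag_form_bilinear: "diag_form d x = diag_bilinear d x x"
  by (simp add: diag_bilinear_def diag_form_def power2_eq_square)

lemma bilinear_diag_bilinear:
  fixes A :: "real^'n^'n"
  shows "bilinear (\<lambda>x y. diag_bilinear d (A *v x) (A *v y))"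
  unfolding bilinear_def
  by (auto intro!: linearI simp: matrix_vector_right_distrib diag_bilinear_linear matrix_vector_mult_scaleR)
    (auto simp: diag_bilinear_def sum_distrib_left mult_ac)

lemma diag_bilinear_axis:
  "diag_bilinear d x (axis k 1) = d k * x $ k" "diag_bilinear d (axis k 1) x = d k * x $ k"
proof -
  show "diag_bilinear d x (axis k 1) = d k * x $ k"
    unfolding diag_bilinear_def by (simp add: axis_def if_distrib sum.delta cong: if_cong)
  then show "diag_bilinear d (axis k 1) x = d k * x $ k"
    by (simp add: diag_bilinear_commute)
qed

lemma matrix_axis_nth: "(A *v axis j 1) $ k = (A :: real^'n^'m) $ k $ j"
  by (simp add: matrix_vector_mult_basis column_def)

lemma matrix_entry_expand: "(A *v x) $ k = (\<Sum>j\<in>UNIV. (A :: real^'n^'m) $ k $ j * x $ j)"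
  by (simp add: matrix_vector_mult_def)

lemma diag_form_polarize:
  assumes "\<And>x. diag_form d (A *v x) = s * diag_form d x"
  shows "diag_bilinear d (A *v x) (A *v y) = s * diag_bilinear d x y"
  using assms[of "x + y"] assms[of x] assms[of y]
  by (simp add: matrix_vector_right_distrib diag_form_add algebra_simps)

text \<open>The matrix identity \<open>A\<^sup>T D A = s D\<close> read as \<open>A\<^sup>T D = s D A\<^sup>-\<^sup>1\<close>.\<close>
lemma similarity_entries:
  fixes A :: "real^'n^'n"
  assumes sim: "\<And>x. diag_form d (A *v x) = s * diag_form d x" and inv: "invertible A"
  shows "d k * A $ k $ j = s * (d j * matrix_inv A $ j $ k)"
proof -
  have "diag_bilinear d (A *v axis j 1) (A *v (matrix_inv A *v axis k 1)) =
      s * diag_bilinear d (axis j 1) (matrix_inv A *v axis k 1)"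
    by (rule diag_form_polarize[OF sim])
  then show ?thesis by (simp add: matrix_inv_vector inv diag_bilinear_axis matrix_axis_nth)
qed

text \<open>This expresses the factor of a similarity through its matrix, so that factors converge along with
  matrices.\<close>
lemma similarity_det:
  fixes A :: "real^'n^'n"
  assumes sim: "\<And>x. diag_form d (A *v x) = s * diag_form d x" and nz: "\<And>j. d j \<noteq> 0"
  shows "(det A)\<^sup>2 = s ^ CARD('n)"
proof -
  define D where "D t = (\<chi> i j. if i = j then t * d j else 0 :: real^'n^'n)" for t
  have detD: "det (D t) = t ^ CARD('n) * (\<Prod>j\<in>UNIV. d j)" for t
    unfolding D_def by (subst det_diagonal) (simp_all add: prod.distrib)
  have "(transpose A ** D 1 ** A) $ i $ j = D s $ i $ j" for i j
  proof -
    have "(transpose A ** D 1 ** A) $ i $ j = diag_bilinear d (A *v axis i 1) (A *v axis j 1)"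
      by (simp add: matrix_matrix_mult_def transpose_def D_def diag_bilinear_def matrix_axis_nth
          if_distrib sum.delta' algebra_simps cong: if_cong)
    moreover have "diag_bilinear d (axis i 1) (axis j 1) = (if i = j then d j else 0)"
      by (simp only: diag_bilinear_axis) (simp add: axis_def)
    ultimately show ?thesis
      by (simp add: diag_form_polarize[OF sim] D_def)
  qed
  then have "transpose A ** D 1 ** A = D s" by (simp add: vec_eq_iff)
  then have "det A * det (D 1) * det A = det (D s)"
    by (metis det_mul det_transpose)
  then show ?thesis using nz by (simp add: detD power2_eq_square)
qed

lemma level_space_mono: "i \<le> i' \<Longrightarrow> level_space l i' \<subseteq> level_space l i"
  by (auto simp: level_space_def)

lemma subspace_level_space: "subspace (level_space l i)"
  by (auto simp: subspace_def level_space_def)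

lemma axis_in_level_space: "axis j (1::real) \<in> level_space l i \<longleftrightarrow> i \<le> l j"
  by (auto simp: level_space_def axis_def linorder_not_less)

lemma level_form_eq: "level_form l e i x = (\<Sum>j | l j = i. e j * (x $ j)\<^sup>2)"
proof -
  have "(\<Sum>j\<in>UNIV. (if l j = i then e j else 0) * (x $ j)\<^sup>2) =
      (\<Sum>j\<in>UNIV. if l j = i then e j * (x $ j)\<^sup>2 else 0)"
    by (rule sum.cong) auto
  then show ?thesis
    unfolding level_form_def diag_form_def by (simp add: sum.If_cases)
qed

text \<open>Forms whose coefficients have widely separated sizes \<open>c\<^sub>0 \<gg> c\<^sub>1 \<gg> \<dots>\<close>: the coordinates
  with the same \<open>l\<close> carry the same size.\<close>
locale separating_scales =
  fixes l :: "'n::finite \<Rightarrow> nat" and e :: "'n \<Rightarrow> real" and c :: "nat \<Rightarrow> nat \<Rightarrow> real"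
  assumes e_nz: "\<And>j. e j \<noteq> 0"
    and c_pos: "\<And>i m. c i m > 0"
    and c_sep: "\<And>j k. l j < l k \<Longrightarrow> (\<lambda>m. c (l k) m / c (l j) m) \<longlonglongrightarrow> 0"
begin

definition coeff :: "nat \<Rightarrow> 'n \<Rightarrow> real" where
  "coeff m j = e j * c (l j) m"

lemma coeff_nz: "coeff m j \<noteq> 0"
  using e_nz[of j] c_pos[of "l j" m] by (simp add: coeff_def)

lemma coeff_ratio:
  assumes "l j < l k" shows "(\<lambda>m. coeff m k / coeff m j) \<longlonglongrightarrow> 0"
proof -
  have "coeff m k / coeff m j = e k / e j * (c (l k) m / c (l j) m)" for m
    by (simp add: coeff_def)
  then show ?thesis
    by (simp only:) (rule tendsto_mult_right_zero[OF c_sep[OF assms]])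
qed

lemma coeff_ratio_same: "l j = l k \<Longrightarrow> coeff m k / coeff m j = e k / e j"
  using c_pos[of "l k" m] by (simp add: coeff_def)

lemma subseq_scales:
  assumes "strict_mono r" shows "separating_scales l e (\<lambda>i m. c i (r m))"
proof
  show "\<And>j k. l j < l k \<Longrightarrow> (\<lambda>m. c (l k) (r m) / c (l j) (r m)) \<longlonglongrightarrow> 0"
    using LIMSEQ_subseq_LIMSEQ[OF c_sep assms] by (simp add: comp_def)
qed (use e_nz c_pos in auto)

text \<open>Letting the matrices converge in the entry identity of a similarity kills the entries above
  the diagonal blocks and turns it into the similarity identity of each diagonal block.\<close>
lemma limit_of_similarities:
  assumes lim: "A \<longlonglongrightarrow> a" and inv: "invertible a" "\<And>m. invertible (A m)"
    and s_pos: "\<And>m. s m > 0"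
    and sim: "\<And>m x. diag_form (coeff m) (A m *v x) = s m * diag_form (coeff m) x"
  shows "\<exists>t>0. flag_similarity l e t a"
proof -
  define N where "N = CARD('n)"
  have N: "N > 0" by (simp add: N_def)
  \<comment> \<open>The factors converge because a similarity with factor s has squared determinant s^n.\<close>
  define t where "t = root N ((det a)\<^sup>2)"
  have t_pos: "t > 0" using inv(1) N by (simp add: t_def real_root_gt_zero invertible_det_nz)
  have s_eq: "s m = root N ((det (A m))\<^sup>2)" for m
    using similarity_det[OF sim coeff_nz, of m] N s_pos[of m]
    by (simp add: N_def real_root_power_cancel)
  have s_lim: "s \<longlonglongrightarrow> t"
    unfolding s_eq t_def by (intro tendsto_intros lim)
  define a' where "a' = matrix_inv a"
  have inv_lim: "(\<lambda>m. matrix_inv (A m)) \<longlonglongrightarrow> a'"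
    unfolding a'_def by (rule tendsto_matrix_inv[OF lim inv(1)])
  have entry: "A m $ k $ j = s m * ((coeff m j / coeff m k) * matrix_inv (A m) $ j $ k)" for m j k
    using similarity_entries[OF sim inv(2), of m k j] coeff_nz[of m k]
    by (simp add: field_simps)
  have entry': "matrix_inv (A m) $ j $ k = (coeff m k / coeff m j) * A m $ k $ j / s m" for m j k
    using similarity_entries[OF sim inv(2), of m k j] coeff_nz[of m j] s_pos[of m]
    by (simp add: field_simps)
  have upper: "a $ k $ j = 0" if "l k < l j" for k j
  proof -
    have "(\<lambda>m. A m $ k $ j) \<longlonglongrightarrow> t * (0 * a' $ j $ k)"
      unfolding entry by (intro tendsto_intros s_lim inv_lim coeff_ratio that)
    moreover have "(\<lambda>m. A m $ k $ j) \<longlonglongrightarrow> a $ k $ j" by (intro tendsto_intros lim)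
    ultimately show ?thesis using LIMSEQ_unique by fastforce
  qed
  have upper': "a' $ j $ k = 0" if "l j < l k" for k j
  proof -
    have "(\<lambda>m. matrix_inv (A m) $ j $ k) \<longlonglongrightarrow> 0 * a $ k $ j / t"
      unfolding entry' using t_pos by (intro tendsto_intros s_lim lim coeff_ratio that) auto
    moreover have "(\<lambda>m. matrix_inv (A m) $ j $ k) \<longlonglongrightarrow> a' $ j $ k" by (intro tendsto_intros inv_lim)
    ultimately show ?thesis using LIMSEQ_unique by fastforce
  qed
  have diag: "e k * a $ k $ j = t * (e j * a' $ j $ k)" if "l j = l k" for k j
  proof -
    have "coeff m j / coeff m k = e j / e k" for m
      using coeff_ratio_same[OF that[symmetric]] .
    then have "(\<lambda>m. A m $ k $ j) \<longlonglongrightarrow> t * (e j / e k * a' $ j $ k)"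
      unfolding entry by (simp only:) (intro tendsto_intros s_lim inv_lim)
    moreover have "(\<lambda>m. A m $ k $ j) \<longlonglongrightarrow> a $ k $ j" by (intro tendsto_intros lim)
    ultimately have "a $ k $ j = t * (e j / e k * a' $ j $ k)" using LIMSEQ_unique by blast
    then show ?thesis using e_nz[of k] by simp
  qed
  have "flag_similarity l e t a"
    unfolding flag_similarity_def
  proof (intro allI ballI conjI)
    fix i and x :: "real^'n" assume x: "x \<in> level_space l i"
    show ax: "a *v x \<in> level_space l i"
      unfolding level_space_def
    proof (intro CollectI allI impI)
      fix k assume k: "l k < i"
      show "(a *v x) $ k = 0"
        unfolding matrix_entry_expand
        using x upper k by (intro sum.neutral) (auto simp: level_space_def, metis leI order_less_le_trans)
    qed
    have row: "e k * (a *v x) $ k = (\<Sum>j | l j = i. t * (e j * a' $ j $ k) * x $ j)" if lk: "l k = i" for k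
    proof -
      have "(a *v x) $ k = (\<Sum>j | l j = i. a $ k $ j * x $ j)"
        unfolding matrix_entry_expand
      proof (rule sum.mono_neutral_right)
        show "\<forall>j\<in>UNIV - {j. l j = i}. a $ k $ j * x $ j = 0"
        proof
          fix j assume "j \<in> UNIV - {j. l j = i}"
          then consider "l j < i" | "l k < l j" using lk by fastforce
          then show "a $ k $ j * x $ j = 0"
            using x upper by cases (auto simp: level_space_def)
        qed
      qed auto
      then have "e k * (a *v x) $ k = (\<Sum>j | l j = i. (e k * a $ k $ j) * x $ j)"
        by (simp add: sum_distrib_left mult.assoc)
      also have "\<dots> = (\<Sum>j | l j = i. t * (e j * a' $ j $ k) * x $ j)"
        using diag lk by (intro sum.cong) auto
      finally show ?thesis .
    qed
    have col: "(\<Sum>k | l k = i. a' $ j $ k * (a *v x) $ k) = x $ j" if lj: "l j = i" for j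
    proof -
      have "x $ j = (a' *v (a *v x)) $ j" by (simp add: a'_def matrix_inv_vector inv)
      also have "\<dots> = (\<Sum>k | l k = i. a' $ j $ k * (a *v x) $ k)"
        unfolding matrix_entry_expand[of a']
      proof (rule sum.mono_neutral_right)
        show "\<forall>k\<in>UNIV - {k. l k = i}. a' $ j $ k * (a *v x) $ k = 0"
        proof
          fix k assume "k \<in> UNIV - {k. l k = i}"
          then consider "l k < i" | "l j < l k" using lj by fastforce
          then show "a' $ j $ k * (a *v x) $ k = 0"
            using ax upper' by cases (auto simp: level_space_def)
        qed
      qed auto
      finally show ?thesis by simp
    qed
    have "level_form l e i (a *v x) = (\<Sum>k | l k = i. (e k * (a *v x) $ k) * (a *v x) $ k)"
      by (simp add: level_form_eq power2_eq_square mult.assoc)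
    also have "\<dots> = (\<Sum>k | l k = i. \<Sum>j | l j = i. t * (e j * a' $ j $ k) * x $ j * (a *v x) $ k)"
      by (intro sum.cong) (auto simp: row sum_distrib_right)
    also have "\<dots> = (\<Sum>j | l j = i. \<Sum>k | l k = i. t * (e j * a' $ j $ k) * x $ j * (a *v x) $ k)"
      by (rule sum.swap)
    also have "\<dots> = (\<Sum>j | l j = i. t * e j * x $ j * (\<Sum>k | l k = i. a' $ j $ k * (a *v x) $ k))"
      by (simp add: sum_distrib_left mult_ac)
    also have "\<dots> = (\<Sum>j | l j = i. t * e j * x $ j * x $ j)"
      by (intro sum.cong) (auto simp: col)
    also have "\<dots> = t * level_form l e i x"
      by (simp add: level_form_eq sum_distrib_left power2_eq_square mult_ac)
    finally show "level_form l e i (a *v x) = t * level_form l e i x" .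
  qed
  with t_pos show ?thesis by blast
qed

end

section \<open>Approximating flag isometries\<close>

lemma matrix_add_rdistrib:
  fixes A B :: "'a::semiring_1^'n^'m"
  shows "(A + B) ** C = A ** C + B ** C"
  by (simp add: matrix_matrix_mult_def vec_eq_iff distrib_right sum.distrib)

lemma matrix_diff_rdistrib:
  fixes A B :: "'a::ring_1^'n^'m"
  shows "(A - B) ** C = A ** C - B ** C"
  by (simp add: matrix_matrix_mult_def vec_eq_iff left_diff_distrib sum_subtractf)

lemma diag_form_preserving_invertible:
  fixes A :: "real^'n^'n"
  assumes pres: "\<And>x. diag_form d (A *v x) = diag_form d x" and nz: "\<And>j. d j \<noteq> 0"
  shows "invertible A"
proof -
  have "x = 0" if "A *v x = 0" for x
  proof -
    have "d j * x $ j = 0" for j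
      using diag_form_polarize[of d A 1 x "axis j 1"] pres that
      by (simp add: diag_bilinear_axis) (simp add: diag_bilinear_def)
    then show ?thesis using nz by (simp add: vec_eq_iff)
  qed
  then show ?thesis
    by (rule invertible_if_trivial_kernel)
qed

lemma flag_similarity_entry:
  fixes A :: "real^'n^'n"
  assumes "flag_similarity l e s A" "l k < l j" shows "A $ k $ j = 0"
proof -
  have "A *v axis j 1 \<in> level_space l (l j)"
    using assms(1) by (auto simp: flag_similarity_def axis_in_level_space)
  then show ?thesis using assms(2) by (simp add: level_space_def matrix_axis_nth[symmetric])
qed

lemma level_space_eventually_zero:
  obtains K where "level_space (l :: 'n::finite \<Rightarrow> nat) K = {0}"
proof
  show "level_space l (Suc (Max (range l))) = {0}"
    by (auto simp: level_space_def vec_eq_iff le_imp_less_Suc)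
qed

lemma level_space_0: "level_space l 0 = UNIV"
  by (simp add: level_space_def)

text \<open>Induction along the levels, which terminates because there are finitely many coordinates.\<close>
lemma zero_if_levels_increase:
  fixes x :: "real^'n"
  assumes "\<And>i. x \<in> level_space l i \<Longrightarrow> x \<in> level_space l (Suc i)"
  shows "x = 0"
proof -
  have "x \<in> level_space l i" for i
    by (induction i) (use assms in \<open>auto simp: level_space_0\<close>)
  then show ?thesis by (metis level_space_eventually_zero singletonD)
qed

lemma invertible_image_subspace:
  fixes A :: "real^'n^'n"
  assumes "invertible A" "subspace V" "\<And>x. x \<in> V \<Longrightarrow> A *v x \<in> V"
  shows "(*v) A ` V = V"
proof (rule subspace_dim_equal)
  show "dim V \<le> dim ((*v) A ` V)"
    by (metis assms(1) dim_image_eq inj_matrix_vector_mult inj_on_subset matrix_vector_mul_linear subset_UNIV order_refl)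
qed (use assms in \<open>auto intro: linear_subspace_image\<close>)

lemma invertible_preimage_subspace:
  fixes A :: "real^'n^'n"
  assumes "invertible A" "subspace V" "\<And>x. x \<in> V \<Longrightarrow> A *v x \<in> V" "A *v y \<in> V"
  shows "y \<in> V"
  using invertible_image_subspace[OF assms(1-3)] assms(4) inj_matrix_vector_mult[OF assms(1)]
  by (metis imageE injD)

context separating_scales
begin

text \<open>The isometry is corrected by a Cayley transform. Let \<open>B\<close> be the block diagonal part of \<open>A\<close>,
  an isometry of every form with coefficients constant on levels. Then \<open>A = (I - N)\<^sup>-\<^sup>1 (I + N) B\<close>
  where \<open>N\<close> raises the level strictly, and \<open>N\<close> is the limit of matrices \<open>X m\<close> which are skew for
  \<open>coeff m\<close>, because the entries needed to make \<open>N\<close> skew are scaled by vanishing ratios.\<close>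
lemma isometry_is_limit:
  assumes iso: "flag_similarity l e 1 A" and inv: "invertible A"
  shows "\<exists>A'. A' \<longlonglongrightarrow> A \<and>
    (\<forall>m. invertible (A' m) \<and> (\<forall>x. diag_form (coeff m) (A' m *v x) = diag_form (coeff m) x))"
proof -
  define B where "B = (\<chi> k j. if l k = l j then A $ k $ j else 0)"
  have level: "(B *v x) $ k = (A *v (\<chi> j. if l j = l k then x $ j else 0)) $ k" for x k
    unfolding matrix_entry_expand B_def
    by (intro sum.cong) auto
  have AB: "(A - B) *v x \<in> level_space l (Suc i)" if x: "x \<in> level_space l i" for x i
    unfolding level_space_def
  proof (intro CollectI allI impI)
    fix k assume k: "l k < Suc i"
    show "((A - B) *v x) $ k = 0"
      unfolding matrix_entry_expand
    proof (intro sum.neutral ballI)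
      fix j
      consider "l j < i" | "l k = l j" | "l k < l j" using k by linarith
      then show "(A - B) $ k $ j * x $ j = 0"
        using x flag_similarity_entry[OF iso, of k j]
        by cases (auto simp: level_space_def B_def)
    qed
  qed
  have B_level: "B *v x \<in> level_space l i" if "x \<in> level_space l i" for x i
    using that unfolding level_space_def by (auto simp: matrix_entry_expand B_def intro!: sum.neutral)
  have B_iso: "diag_form d (B *v x) = diag_form d x" if "\<And>j. d j = e j * g (l j)" for d g x
  proof -
    have "(\<Sum>k | l k = i. e k * ((B *v x) $ k)\<^sup>2) = (\<Sum>k | l k = i. e k * (x $ k)\<^sup>2)" for i
    proof -
      define y where "y = (\<chi> j. if l j = i then x $ j else 0)"
      have "y \<in> level_space l i" by (auto simp: y_def level_space_def)
      then have "level_form l e i (A *v y) = level_form l e i y"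
        using iso by (simp add: flag_similarity_def)
      moreover have "(\<Sum>k | l k = i. e k * ((B *v x) $ k)\<^sup>2) = level_form l e i (A *v y)"
        unfolding level_form_eq y_def by (intro sum.cong) (auto simp: level)
      moreover have "(\<Sum>k | l k = i. e k * (x $ k)\<^sup>2) = level_form l e i y"
        unfolding level_form_eq y_def by (intro sum.cong) auto
      ultimately show ?thesis by simp
    qed
    then have "(\<Sum>k | l k = i. d k * ((B *v x) $ k)\<^sup>2) = (\<Sum>k | l k = i. d k * (x $ k)\<^sup>2)" for i
      using that by (simp add: mult.commute[of "e _"] mult.assoc flip: sum_distrib_left)
    then have "(\<Sum>i\<in>range l. \<Sum>k | k \<in> UNIV \<and> l k = i. d k * ((B *v x) $ k)\<^sup>2) =
        (\<Sum>i\<in>range l. \<Sum>k | k \<in> UNIV \<and> l k = i. d k * (x $ k)\<^sup>2)" by simp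
    then show ?thesis
      unfolding diag_form_def by (subst (asm) (1 2) sum.group) auto
  qed
  have inv_B: "invertible B"
    by (rule diag_form_preserving_invertible[of e]) (use B_iso[of e "\<lambda>_. 1"] e_nz in auto)
  \<comment> \<open>The equation (I - N) A = (I + N) B for N reads N (A + B) = A - B.\<close>
  define P where "P = A + B"
  have P_eq: "P *v x = 2 *\<^sub>R (B *v x) + (A - B) *v x" for x
    by (simp add: P_def matrix_vector_mult_add_rdistrib matrix_vector_mult_diff_rdistrib scaleR_2)
  have P_level: "P *v x \<in> level_space l i" if "x \<in> level_space l i" for x i
    unfolding P_eq using AB[OF that] B_level[OF that] level_space_mono[of i "Suc i" l]
    by (intro subspace_add subspace_scale subspace_level_space) auto
  have inv_P: "invertible P"
  proof -
    have "x = 0" if "P *v x = 0" for x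
    proof (rule zero_if_levels_increase)
      fix i assume x: "x \<in> level_space l i"
      have "B *v x = (- 1/2) *\<^sub>R ((A - B) *v x)"
        using that unfolding P_eq by (simp add: add_eq_0_iff)
      then have "B *v x \<in> level_space l (Suc i)"
        using subspace_scale[OF subspace_level_space AB[OF x], of "- 1 / 2"] by simp
      then show "x \<in> level_space l (Suc i)"
        using invertible_preimage_subspace[OF inv_B subspace_level_space, of l "Suc i" x] B_level
        by blast
    qed
    then show ?thesis by (rule invertible_if_trivial_kernel)
  qed
  define N where "N = (A - B) ** matrix_inv P"
  have NP: "N ** P = A - B" by (simp add: N_def matrix_inv_cancel inv_P)
  have N_entry: "N $ k $ j = 0" if "l k \<le> l j" for k j
  proof -
    define y where "y = matrix_inv P *v axis j 1"
    have "P *v y = axis j 1" by (simp add: y_def matrix_inv_vector inv_P)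
    then have "y \<in> level_space l (l j)"
      using invertible_preimage_subspace[OF inv_P subspace_level_space, of l "l j" y] P_level
      by (simp add: axis_in_level_space)
    then have "N *v axis j 1 \<in> level_space l (Suc (l j))"
      using AB[of y "l j"] unfolding N_def y_def by (simp only: matrix_vector_mul_assoc)
    then show ?thesis using that by (simp add: level_space_def matrix_axis_nth[symmetric])
  qed
  \<comment> \<open>X m is N minus its adjoint with respect to the form with coefficients coeff m.\<close>
  define X where "X m = (\<chi> k j. N $ k $ j - coeff m j / coeff m k * N $ j $ k)" for m
  have X_lim: "X \<longlonglongrightarrow> N"
  proof (rule vec_tendstoI, rule vec_tendstoI)
    fix k j
    have "(\<lambda>m. coeff m j / coeff m k * N $ j $ k) \<longlonglongrightarrow> 0"
    proof (cases "l k < l j")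
      case True
      then show ?thesis by (intro tendsto_mult_left_zero coeff_ratio)
    qed (simp add: N_entry)
    from tendsto_diff[OF tendsto_const[of "N $ k $ j"] this]
    show "(\<lambda>m. X m $ k $ j) \<longlonglongrightarrow> N $ k $ j"
      unfolding X_def by simp
  qed
  have skew: "diag_bilinear (coeff m) (X m *v u) u = 0" for m u
  proof -
    have "diag_bilinear (coeff m) (X m *v u) u =
        (\<Sum>k\<in>UNIV. \<Sum>j\<in>UNIV. coeff m k * X m $ k $ j * u $ j * u $ k)"
      by (simp add: diag_bilinear_def matrix_entry_expand sum_distrib_left sum_distrib_right mult_ac)
    also have "\<dots> = (\<Sum>k\<in>UNIV. \<Sum>j\<in>UNIV. coeff m k * N $ k $ j * u $ j * u $ k) -
        (\<Sum>k\<in>UNIV. \<Sum>j\<in>UNIV. coeff m j * N $ j $ k * u $ k * u $ j)"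
    proof -
      have "coeff m k * X m $ k $ j = coeff m k * N $ k $ j - coeff m j * N $ j $ k" for k j
        using coeff_nz by (simp add: X_def right_diff_distrib)
      then show ?thesis by (simp add: left_diff_distrib sum_subtractf) (simp add: mult_ac)
    qed
    also have "\<dots> = 0"
      by (subst sum.swap) simp
    finally show ?thesis .
  qed
  have inv_N: "invertible (mat 1 - N)"
  proof -
    have "(mat 1 - N) ** P = 2 *\<^sub>R B"
      by (simp add: matrix_diff_rdistrib NP) (simp add: P_def scaleR_2)
    moreover have "invertible (2 *\<^sub>R B)" using inv_B by (intro scalar_invertible) auto
    ultimately have "(mat 1 - N) ** (P ** matrix_inv (2 *\<^sub>R B)) = mat 1"
      by (simp add: matrix_mul_assoc matrix_inv_right)
    then show ?thesis unfolding invertible_right_inverse by blast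
  qed
  \<comment> \<open>The value mat 1 only fills in the finitely many m where the Cayley transform is undefined.\<close>
  define A' where "A' m = (if invertible (mat 1 - X m)
    then matrix_inv (mat 1 - X m) ** ((mat 1 + X m) ** B) else mat 1)" for m
  have "(\<lambda>m. matrix_inv (mat 1 - X m) ** ((mat 1 + X m) ** B)) \<longlonglongrightarrow>
      matrix_inv (mat 1 - N) ** ((mat 1 + N) ** B)"
    by (intro tendsto_intros tendsto_matrix_inv X_lim inv_N)
  moreover have "matrix_inv (mat 1 - N) ** ((mat 1 + N) ** B) = A"
  proof -
    have "N ** A + N ** B = A - B" using NP by (simp add: P_def matrix_add_ldistrib)
    then have "(mat 1 - N) ** A = (mat 1 + N) ** B"
      by (simp add: matrix_diff_rdistrib matrix_add_rdistrib algebra_simps)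
    then show ?thesis by (metis inv_N matrix_inv_cancel(2))
  qed
  moreover have "\<forall>\<^sub>F m in sequentially. matrix_inv (mat 1 - X m) ** ((mat 1 + X m) ** B) = A' m"
    using tendsto_eventually_invertible[OF tendsto_diff[OF tendsto_const X_lim] inv_N]
    by eventually_elim (simp add: A'_def)
  ultimately have "A' \<longlonglongrightarrow> A" using Lim_transform_eventually by fastforce
  moreover have pres: "diag_form (coeff m) (A' m *v x) = diag_form (coeff m) x" for m x
  proof (cases "invertible (mat 1 - X m)")
    case True
    define z where "z = B *v x"
    define y where "y = A' m *v x"
    have "(mat 1 - X m) *v y = (mat 1 + X m) *v z"
      using True by (simp add: y_def z_def A'_def matrix_vector_mul_assoc matrix_inv_cancel)
    then have "y - z = X m *v (y + z)"
      by (simp add: matrix_vector_mult_add_rdistrib matrix_vector_mult_diff_rdistrib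
          matrix_vector_right_distrib algebra_simps)
    \<comment> \<open>The left-hand side below is the difference of the values of the form at y and z.\<close>
    then have "diag_bilinear (coeff m) (y - z) (y + z) = 0" by (simp add: skew)
    then have "diag_form (coeff m) y = diag_form (coeff m) z"
      by (simp add: diag_bilinear_linear diag_form_bilinear diag_bilinear_commute)
    also have "\<dots> = diag_form (coeff m) x"
      unfolding z_def by (rule B_iso[of _ "\<lambda>i. c i m"]) (simp add: coeff_def)
    finally show ?thesis by (simp add: y_def)
  qed (simp add: A'_def)
  moreover have "invertible (A' m)" for m
    by (rule diag_form_preserving_invertible[OF pres coeff_nz])
  ultimately show ?thesis by blast
qed

end

section \<open>Frames adapted to a flag of forms\<close>

lemma bilinear_simps:
  fixes B :: "'a::real_vector \<Rightarrow> 'b::real_vector \<Rightarrow> 'c::real_vector"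
  assumes "bilinear B"
  shows "B (x + y) z = B x z + B y z" "B u (v + w) = B u v + B u w"
    "B (x - y) z = B x z - B y z" "B u (v - w) = B u v - B u w"
    "B (c *\<^sub>R x) z = c *\<^sub>R B x z" "B u (c *\<^sub>R v) = c *\<^sub>R B u v"
    "B 0 z = 0" "B u 0 = 0" "B (- x) z = - B x z" "B u (- v) = - B u v"
  using assms by (simp_all add: bilinear_ladd bilinear_radd bilinear_lsub bilinear_rsub
      bilinear_lmul bilinear_rmul bilinear_lzero bilinear_rzero bilinear_lneg bilinear_rneg)

lemma quadratic_inequality_linear_term:
  fixes a b :: real
  assumes "\<And>t. 2 * t * b + t\<^sup>2 * a \<le> 0" shows "b = 0"
proof (rule ccontr)
  assume b: "b \<noteq> 0"
  \<comment> \<open>Small enough for the linear term to dominate the quadratic one.\<close>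
  define t where "t = b / (1 + \<bar>a\<bar>)"
  have "2 * t * b + t\<^sup>2 * a = b\<^sup>2 * (2 * (1 + \<bar>a\<bar>) + a) / (1 + \<bar>a\<bar>)\<^sup>2"
    by (simp add: t_def power2_eq_square divide_simps) (simp add: algebra_simps)
  moreover have "\<dots> > 0" using b by (intro divide_pos_pos mult_pos_pos) auto
  ultimately show False using assms[of t] by linarith
qed

text \<open>The spectral theorem for symmetric forms: a unit vector maximizing \<open>B x x\<close> is
  \<open>B\<close>-orthogonal to its orthogonal complement.\<close>
lemma orthonormal_diagonalization:
  fixes B :: "'a::euclidean_space \<Rightarrow> 'a \<Rightarrow> real"
  assumes bil: "bilinear B" and sym: "\<And>x y. B x y = B y x" and "subspace W"
  shows "\<exists>T. pairwise orthogonal T \<and> (\<forall>x\<in>T. norm x = 1) \<and> span T = W \<and>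
    (\<forall>x\<in>T. \<forall>y\<in>T. x \<noteq> y \<longrightarrow> B x y = 0)"
  using \<open>subspace W\<close>
proof (induction "dim W" arbitrary: W rule: less_induct)
  case less
  show ?case
  proof (cases "W = {0}")
    case True
    then show ?thesis by (intro exI[of _ "{}"]) auto
  next
    case False
    define K where "K = W \<inter> sphere 0 1"
    have "closed W" using less.prems by (rule closed_subspace)
    then have "compact K" unfolding K_def by (rule closed_Int_compact) simp
    obtain w where w: "w \<in> W" "w \<noteq> 0" using False less.prems subspace_0 by blast
    then have "(1 / norm w) *\<^sub>R w \<in> K" using less.prems by (auto simp: K_def subspace_scale)
    then have "K \<noteq> {}" by blast
    moreover have "continuous_on K (\<lambda>x. B x x)"
    proof -
      have "bounded_bilinear B" using bil by (rule bilinear_conv_bounded_bilinear[THEN iffD1])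
      then show ?thesis by (rule bounded_bilinear.continuous_on[OF _ continuous_on_id continuous_on_id])
    qed
    ultimately obtain u where u: "u \<in> K" "\<And>x. x \<in> K \<Longrightarrow> B x x \<le> B u u"
      using continuous_attains_sup[OF \<open>compact K\<close>, of "\<lambda>x. B x x"] by blast
    have uW: "u \<in> W" and nu: "norm u = 1" using u(1) by (auto simp: K_def)
    have max: "B x x \<le> B u u * (norm x)\<^sup>2" if "x \<in> W" for x
    proof (cases "x = 0")
      case False
      have "(1 / norm x) *\<^sub>R x \<in> K" using that False less.prems by (auto simp: K_def subspace_scale)
      then have "B ((1 / norm x) *\<^sub>R x) ((1 / norm x) *\<^sub>R x) \<le> B u u" by (rule u(2))
      then show ?thesis using False
        by (simp add: bilinear_simps[OF bil] divide_simps power2_eq_square)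
    qed (simp add: bilinear_simps[OF bil])
    have perp: "B u v = 0" if v: "v \<in> W" "orthogonal u v" for v
    proof (rule quadratic_inequality_linear_term)
      fix t :: real
      have "u + t *\<^sub>R v \<in> W" using v uW less.prems by (simp add: subspace_add subspace_scale)
      moreover have "(norm (u + t *\<^sub>R v))\<^sup>2 = 1 + t\<^sup>2 * (norm v)\<^sup>2"
        using v nu by (simp add: norm_add_Pythagorean orthogonal_clauses power_mult_distrib)
      ultimately have "B (u + t *\<^sub>R v) (u + t *\<^sub>R v) \<le> B u u * (1 + t\<^sup>2 * (norm v)\<^sup>2)"
        using max by fastforce
      then show "2 * t * B u v + t\<^sup>2 * (B v v - B u u * (norm v)\<^sup>2) \<le> 0"
        by (simp add: bilinear_simps[OF bil] sym[of v u] algebra_simps power2_eq_square)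
    qed
    define W' where "W' = {v\<in>W. orthogonal u v}"
    have sub: "subspace W'"
      using less.prems unfolding W'_def subspace_def by (auto simp: orthogonal_clauses)
    have "u \<notin> W'" using nu by (auto simp: W'_def orthogonal_self)
    then have "W' \<subset> W" using uW by (auto simp: W'_def)
    then have "dim W' < dim W"
      using dim_psubset[of W' W] sub less.prems by (simp add: span_eq_iff[THEN iffD2])
    from less.hyps[OF this sub] obtain T where T: "pairwise orthogonal T" "\<forall>x\<in>T. norm x = 1"
      "span T = W'" "\<forall>x\<in>T. \<forall>y\<in>T. x \<noteq> y \<longrightarrow> B x y = 0" by blast
    have TW: "x \<in> W" "orthogonal u x" if "x \<in> T" for x
      using that span_base[of x T] T(3) by (auto simp: W'_def)
    show ?thesis
    proof (intro exI[of _ "insert u T"] conjI)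
      show "pairwise orthogonal (insert u T)"
        using T(1) TW by (auto simp: pairwise_insert orthogonal_commute)
      show "\<forall>x\<in>insert u T. \<forall>y\<in>insert u T. x \<noteq> y \<longrightarrow> B x y = 0"
        using T(4) TW perp sym by (metis insert_iff)
      show "span (insert u T) = W"
      proof
        show "span (insert u T) \<subseteq> W" using TW uW less.prems by (intro span_minimal) auto
        show "W \<subseteq> span (insert u T)"
        proof
          fix x assume x: "x \<in> W"
          have "x - (u \<bullet> x) *\<^sub>R u \<in> W'"
            using x uW nu less.prems
            by (auto simp: W'_def subspace_diff subspace_scale orthogonal_def inner_diff_right dot_square_norm)
          then show "x \<in> span (insert u T)" using T(3) span_breakdown_eq by blast
        qed
      qed
    qed (use T nu in auto)
  qed
qed

text \<open>The columns of \<open>S\<close> are a basis through which the flag of forms becomes the coordinate model given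
  by \<open>l\<close> and \<open>e\<close>; all later computations with flags take place in such coordinates.\<close>
definition adapted_frame ::
    "nat \<Rightarrow> (nat \<Rightarrow> (real^'n) set) \<Rightarrow> (nat \<Rightarrow> (real^'n) set \<Rightarrow> real) \<Rightarrow>
      real^'n^'n \<Rightarrow> ('n \<Rightarrow> nat) \<Rightarrow> ('n \<Rightarrow> real) \<Rightarrow> bool" where
  "adapted_frame k V \<gamma> S l e \<longleftrightarrow> invertible S \<and> range l = {..k} \<and> (\<forall>j. e j = 1 \<or> e j = - 1) \<and>
     (\<forall>i\<le>Suc k. V i = (*v) S ` level_space l i) \<and>
     (\<forall>i\<le>k. \<forall>x\<in>level_space l i. pullback_form V \<gamma> i (S *v x) = level_form l e i x)"

lemma partial_flag_subspace: "partial_flag k V \<Longrightarrow> i \<le> Suc k \<Longrightarrow> subspace (V i)"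
  by (simp add: partial_flag_def)

lemma partial_flag_antimono:
  assumes "partial_flag k V" "i \<le> i'" "i' \<le> Suc k" shows "V i' \<subseteq> V i"
  using assms(2,3)
proof (induction i' rule: dec_induct)
  case (step j)
  then have "V (Suc j) \<subset> V j" using assms(1) by (simp add: partial_flag_def)
  then show ?case using step by auto
qed simp

lemma pullback_form_add:
  assumes "subspace (V (Suc i))" "w \<in> V (Suc i)"
  shows "pullback_form V \<gamma> i (x + w) = pullback_form V \<gamma> i x"
proof -
  have "(+) (x + w) ` V (Suc i) = (+) x ` V (Suc i)"
  proof (rule subset_antisym; rule subsetI)
    fix y assume "y \<in> (+) (x + w) ` V (Suc i)"
    then obtain v where "v \<in> V (Suc i)" "y = x + (w + v)" by auto
    then show "y \<in> (+) x ` V (Suc i)" using assms by (auto intro: subspace_add)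
  next
    fix y assume "y \<in> (+) x ` V (Suc i)"
    then obtain v where "v \<in> V (Suc i)" "y = (x + w) + (v - w)" by auto
    then show "y \<in> (+) (x + w) ` V (Suc i)" using assms by (blast intro: subspace_diff)
  qed
  then show ?thesis by (simp add: pullback_form_def)
qed

text \<open>The pullback is constant on cosets of \<open>V (Suc i)\<close>, which therefore lies in the radical of the polar
  form; nondegeneracy says that it is the whole radical.\<close>
lemma flag_form_bilinear:
  assumes pf: "partial_flag k V" and ff: "flag_of_forms k V \<gamma>" and i: "i \<le> k"
  shows "\<exists>B. bilinear B \<and> (\<forall>x y. B x y = B y x) \<and> (\<forall>x\<in>V i. pullback_form V \<gamma> i x = B x x) \<and>
    (\<forall>x\<in>V i. \<forall>w\<in>V (Suc i). B x w = 0) \<and> (\<forall>x\<in>V i. (\<forall>y\<in>V i. B x y = 0) \<longrightarrow> x \<in> V (Suc i))"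
proof -
  have sub: "subspace (V i)" "subspace (V (Suc i))"
    using partial_flag_subspace[OF pf] i by auto
  have mono: "V (Suc i) \<subseteq> V i" using partial_flag_antimono[OF pf, of i "Suc i"] i by simp
  obtain B0 where B0: "bilinear B0" "\<And>x. x \<in> V i \<Longrightarrow> pullback_form V \<gamma> i x = B0 x x"
    using ff i unfolding flag_of_forms_def quadratic_form_on_def by blast
  define B where "B x y = (B0 x y + B0 y x) / 2" for x y
  have bil: "bilinear B"
    unfolding bilinear_def B_def
    by (auto intro!: linearI simp: bilinear_simps[OF B0(1)] field_simps)
  have sym: "B x y = B y x" for x y by (simp add: B_def)
  have BQ: "pullback_form V \<gamma> i x = B x x" if "x \<in> V i" for x
    using B0(2)[OF that] by (simp add: B_def)
  have polar: "pullback_form V \<gamma> i (x + y) - pullback_form V \<gamma> i x - pullback_form V \<gamma> i y = 2 * B x y"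
    if "x \<in> V i" "y \<in> V i" for x y
    using that sub by (simp add: BQ subspace_add bilinear_simps[OF bil] sym[of y x])
  have rad: "B x w = 0" if "x \<in> V i" "w \<in> V (Suc i)" for x w
  proof -
    have "pullback_form V \<gamma> i w = pullback_form V \<gamma> i 0"
      using pullback_form_add[of V i w \<gamma> 0, OF sub(2) that(2)] by simp
    also have "\<dots> = 0" using BQ[OF subspace_0[OF sub(1)]] by (simp add: bilinear_simps[OF bil])
    finally show ?thesis
      using polar[OF that(1), of w] pullback_form_add[of V i w \<gamma> x, OF sub(2) that(2)] mono that by auto
  qed
  have nd: "x \<in> V (Suc i)" if "x \<in> V i" "\<forall>y\<in>V i. B x y = 0" for x
    using ff i that polar[OF that(1)] unfolding flag_of_forms_def nondegenerate_mod_def by auto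
  show ?thesis using bil sym BQ rad nd by blast
qed

text \<open>Orthonormal diagonalizing bases of the orthogonal complements of \<open>V (Suc i)\<close> in \<open>V i\<close>
  together form an orthonormal basis; rescaling it makes the forms \<open>\<plusminus>1\<close> diagonal.\<close>
lemma adapted_frame_exists:
  fixes V :: "nat \<Rightarrow> (real^'n) set"
  assumes pf: "partial_flag k V" and ff: "flag_of_forms k V \<gamma>"
  shows "\<exists>S l e. adapted_frame k V \<gamma> S l e"
proof -
  define is_polar where "is_polar i B \<longleftrightarrow> bilinear B \<and> (\<forall>x y. B x y = B y x) \<and>
    (\<forall>x\<in>V i. pullback_form V \<gamma> i x = B x x) \<and> (\<forall>x\<in>V i. \<forall>w\<in>V (Suc i). B x w = 0) \<and>
    (\<forall>x\<in>V i. (\<forall>y\<in>V i. B x y = 0) \<longrightarrow> x \<in> V (Suc i))" for i and B :: "real^'n \<Rightarrow> real^'n \<Rightarrow> real"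
  define B where "B i = (SOME B. is_polar i B)" for i
  have "is_polar i (B i)" if "i \<le> k" for i
    using flag_form_bilinear[OF pf ff that] unfolding B_def is_polar_def by (rule someI_ex)
  then have B: "\<And>i. i \<le> k \<Longrightarrow> bilinear (B i)" "\<And>i x y. i \<le> k \<Longrightarrow> B i x y = B i y x"
    "\<And>i x. i \<le> k \<Longrightarrow> x \<in> V i \<Longrightarrow> pullback_form V \<gamma> i x = B i x x"
    "\<And>i x w. i \<le> k \<Longrightarrow> x \<in> V i \<Longrightarrow> w \<in> V (Suc i) \<Longrightarrow> B i x w = 0"
    "\<And>i x. i \<le> k \<Longrightarrow> x \<in> V i \<Longrightarrow> (\<And>y. y \<in> V i \<Longrightarrow> B i x y = 0) \<Longrightarrow> x \<in> V (Suc i)"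
    unfolding is_polar_def by blast+
  have sub: "subspace (V i)" if "i \<le> Suc k" for i using partial_flag_subspace[OF pf that] .
  have mono: "V i' \<subseteq> V i" if "i \<le> i'" "i' \<le> Suc k" for i i'
    using partial_flag_antimono[OF pf that] .
  define W where "W i = V i \<inter> (V (Suc i))\<^sup>\<bottom>" for i
  have subW: "subspace (W i)" if "i \<le> k" for i
    unfolding W_def using that by (intro subspace_inter sub subspace_orthogonal_comp) simp
  define is_basis where "is_basis i T \<longleftrightarrow> pairwise orthogonal T \<and> (\<forall>x\<in>T. norm x = 1) \<and>
    span T = W i \<and> (\<forall>x\<in>T. \<forall>y\<in>T. x \<noteq> y \<longrightarrow> B i x y = 0)" for i T
  define T where "T i = (SOME T. is_basis i T)" for i
  have "is_basis i (T i)" if "i \<le> k" for i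
    using orthonormal_diagonalization[OF B(1,2)[OF that] subW[OF that]]
    unfolding T_def is_basis_def by (rule someI_ex)
  then have T: "\<And>i. i \<le> k \<Longrightarrow> pairwise orthogonal (T i)"
    "\<And>i x. i \<le> k \<Longrightarrow> x \<in> T i \<Longrightarrow> norm x = 1" "\<And>i. i \<le> k \<Longrightarrow> span (T i) = W i"
    "\<And>i x y. i \<le> k \<Longrightarrow> x \<in> T i \<Longrightarrow> y \<in> T i \<Longrightarrow> x \<noteq> y \<Longrightarrow> B i x y = 0"
    unfolding is_basis_def by blast+
  have TW: "x \<in> W i" if "i \<le> k" "x \<in> T i" for x i
    using T(3)[OF that(1)] span_base[OF that(2)] by simp
  have TV: "x \<in> V i" if "i \<le> k" "x \<in> T i" for x i using TW[OF that] by (simp add: W_def)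
  have decomp: "\<exists>y z. y \<in> V (Suc i) \<and> z \<in> W i \<and> x = y + z" if "i \<le> k" "x \<in> V i" for x i
  proof -
    obtain y z where yz: "y \<in> span (V (Suc i))" "\<And>w. w \<in> span (V (Suc i)) \<Longrightarrow> orthogonal z w" "x = y + z"
      using orthogonal_subspace_decomp_exists by metis
    have sp: "span (V (Suc i)) = V (Suc i)"
      using sub[of "Suc i"] that(1) by (simp only: span_eq_iff Suc_le_mono)
    have "y \<in> V i" using yz(1) sp mono[of i "Suc i"] that by auto
    then have "z \<in> V i"
      using that sub[of i] yz(3) subspace_diff[of "V i" x y] by simp
    then show ?thesis using yz(2,3) yz(1)[unfolded sp] orthogonal_commute
      unfolding W_def orthogonal_comp_def sp by blast
  qed
  have BT_nz: "B i x x \<noteq> 0" if "i \<le> k" "x \<in> T i" for i x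
  proof
    assume 0: "B i x x = 0"
    interpret r: linear "B i x" using B(1)[OF that(1)] by (simp add: bilinear_def)
    have "B i x y = 0" if "y \<in> T i" for y using T(4) 0 \<open>i \<le> k\<close> \<open>x \<in> T i\<close> that by metis
    then have W0: "B i x z = 0" if "z \<in> span (T i)" for z
      using that by (rule linear_eq_0_on_span[OF r.linear_axioms])
    have "B i x v = 0" if v: "v \<in> V i" for v
    proof -
      obtain y z where "y \<in> V (Suc i)" "z \<in> W i" "v = y + z" using decomp[OF \<open>i \<le> k\<close> v] by blast
      then show ?thesis
        using B(4)[OF \<open>i \<le> k\<close> TV[OF \<open>i \<le> k\<close> \<open>x \<in> T i\<close>]] W0 T(3)[OF \<open>i \<le> k\<close>] by (simp add: r.add)
    qed
    then have "x \<in> V (Suc i)" using B(5)[OF that(1) TV[OF that]] by blast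
    then have "orthogonal x x" using TW[OF that] by (auto simp: W_def orthogonal_comp_def)
    then show False using T(2)[OF that] by (auto simp: orthogonal_self)
  qed
  have span_tail: "span (\<Union>i'\<in>{i..k}. T i') = V i" if "i \<le> Suc k" for i
    using that
  proof (induction i rule: inc_induct)
    case base
    then show ?case using pf by (simp add: partial_flag_def)
  next
    case (step i)
    then have i: "i \<le> k" by simp
    show ?case
    proof
      show "span (\<Union>i'\<in>{i..k}. T i') \<subseteq> V i"
        using TV mono i by (intro span_minimal sub) (fastforce, simp)
      show "V i \<subseteq> span (\<Union>i'\<in>{i..k}. T i')"
      proof
        fix x assume "x \<in> V i"
        then obtain y z where yz: "y \<in> V (Suc i)" "z \<in> W i" "x = y + z" using decomp[OF i] by blast
        have "V (Suc i) \<subseteq> span (\<Union>i'\<in>{i..k}. T i')"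
          unfolding step.IH[symmetric] by (intro span_mono UN_mono) auto
        moreover have "W i \<subseteq> span (\<Union>i'\<in>{i..k}. T i')"
          unfolding T(3)[OF i, symmetric] using i by (intro span_mono) auto
        ultimately show "x \<in> span (\<Union>i'\<in>{i..k}. T i')" using yz by (auto intro: span_add)
      qed
    qed
  qed
  have orth: "orthogonal x y" if "i < i'" "i' \<le> k" "x \<in> T i" "y \<in> T i'" for i i' x y
  proof -
    have "y \<in> V (Suc i)" using TV[OF that(2,4)] mono[of "Suc i" i'] that by auto
    then show ?thesis
      using TW[of i x] that by (auto simp: W_def orthogonal_comp_def orthogonal_commute)
  qed
  \<comment> \<open>Bases of different steps are orthogonal to each other by the choice of W.\<close>
  define D where "D = (\<Union>i\<in>{..k}. T i)"
  have "pairwise orthogonal D"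
    unfolding pairwise_def D_def
  proof (intro ballI impI)
    fix x y assume "x \<in> (\<Union>i\<in>{..k}. T i)" "y \<in> (\<Union>i\<in>{..k}. T i)" "x \<noteq> y"
    then obtain i i' where ii: "i \<le> k" "i' \<le> k" "x \<in> T i" "y \<in> T i'" by auto
    consider "i < i'" | "i = i'" | "i' < i" by linarith
    then show "orthogonal x y"
    proof cases
      case 2
      then show ?thesis using T(1)[OF ii(1)] ii \<open>x \<noteq> y\<close> by (auto simp: pairwise_def)
    qed (use orth ii orthogonal_commute in blast)+
  qed
  moreover have "0 \<notin> D" using T(2) by (fastforce simp: D_def)
  ultimately have indep: "independent D" by (rule pairwise_orthogonal_independent)
  have "span D = UNIV"
    using span_tail[of 0] pf by (simp add: D_def partial_flag_def atMost_atLeast0)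
  then have "card D = CARD('n)"
    using dim_eq_card[of D UNIV] indep by (simp add: DIM_cart)
  moreover have "finite D" using indep by (rule independent_imp_finite)
  ultimately obtain h where h: "bij_betw h (UNIV :: 'n set) D"
    using finite_same_card_bij[of "UNIV :: 'n set" D] by auto
  then have "\<forall>j. \<exists>i. i \<le> k \<and> h j \<in> T i" unfolding D_def bij_betw_def by blast
  then obtain l where l: "\<And>j. l j \<le> k" "\<And>j. h j \<in> T (l j)" by metis
  have T_level: "l j = i" if "i \<le> k" "h j \<in> T i" for i j
  proof (rule ccontr)
    assume "l j \<noteq> i"
    then have "orthogonal (h j) (h j)"
      using orth[of "l j" i "h j" "h j"] orth[of i "l j" "h j" "h j"] that l(1)[of j] l(2)[of j]
      by (cases "l j < i") auto
    then show False using T(2)[OF l(1,2), of j] by (auto simp: orthogonal_self)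
  qed
  have T_range: "\<exists>j. x = h j \<and> l j = i" if "i \<le> k" "x \<in> T i" for i x
  proof -
    have "x \<in> D" using that by (auto simp: D_def)
    then obtain j where "x = h j" using h unfolding bij_betw_def by blast
    then show ?thesis using T_level that by blast
  qed
  define b where "b j = B (l j) (h j) (h j)" for j
  have b_nz: "b j \<noteq> 0" for j unfolding b_def using BT_nz l by blast
  define a where "a j = 1 / sqrt \<bar>b j\<bar>" for j
  have a_pos: "a j > 0" for j using b_nz by (simp add: a_def)
  define e where "e j = sgn (b j)" for j
  have ab: "(a j)\<^sup>2 * b j = e j" for j
    using b_nz[of j] by (simp add: a_def e_def power_divide sgn_real_def)
  define S where "S = (\<chi> r j. a j * h j $ r)"
  have S: "S *v x = (\<Sum>j\<in>UNIV. (x $ j * a j) *\<^sub>R h j)" for x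
    by (simp add: vec_eq_iff matrix_entry_expand S_def mult_ac)
  have S_inner: "(S *v x) \<bullet> h j = x $ j * a j" for x j
  proof -
    have hj: "h i \<bullet> h j = (if i = j then 1 else 0)" for i
    proof (cases "i = j")
      case False
      then have "h i \<noteq> h j" using h by (metis UNIV_I bij_betw_def inj_on_def)
      moreover have "h i \<in> D" "h j \<in> D" using h by (auto simp: bij_betw_def)
      ultimately show ?thesis using \<open>pairwise orthogonal D\<close> False
        by (auto simp: pairwise_def orthogonal_def)
    qed (use T(2)[OF l] in \<open>simp add: dot_square_norm\<close>)
    show ?thesis
      unfolding S inner_sum_left inner_scaleR_left hj by (simp add: if_distrib cong: if_cong)
  qed
  have inv_S: "invertible S"
  proof -
    have "x = 0" if "S *v x = 0" for x
    proof (simp only: vec_eq_iff, rule allI)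
      fix j show "x $ j = 0 $ j" using S_inner[of x j] a_pos[of j] that by auto
    qed
    then show ?thesis by (rule invertible_if_trivial_kernel)
  qed
  have S_axis: "S *v axis j (1 / a j) = h j" for j
    unfolding S using a_pos[of j] by (simp add: axis_def if_distrib if_distribR cong: if_cong)
  have hV: "h j \<in> V i" if "i \<le> l j" for i j
    using TV[OF l(1,2), of j] mono[of i "l j"] that l(1)[of j] by auto
  have V_eq: "V i = (*v) S ` level_space l i" if i: "i \<le> Suc k" for i
  proof
    show "(*v) S ` level_space l i \<subseteq> V i"
    proof (rule image_subsetI)
      fix x :: "real^'n" assume "x \<in> level_space l i"
      then have "(x $ j * a j) *\<^sub>R h j \<in> V i" for j
        using hV[of i j] subspace_scale[OF sub[OF i], of "h j"] subspace_0[OF sub[OF i]]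
        by (cases "l j < i") (auto simp: level_space_def)
      then show "S *v x \<in> V i" unfolding S by (intro subspace_sum sub i)
    qed
    show "V i \<subseteq> (*v) S ` level_space l i"
      unfolding span_tail[OF i, symmetric]
    proof (rule span_minimal)
      show "subspace ((*v) S ` level_space l i)"
        by (intro linear_subspace_image subspace_level_space) simp
      show "(\<Union>i'\<in>{i..k}. T i') \<subseteq> (*v) S ` level_space l i"
      proof
        fix x assume "x \<in> (\<Union>i'\<in>{i..k}. T i')"
        then obtain j where "x = h j" "i \<le> l j" using T_range by fastforce
        then have "x = S *v axis j (1 / a j)" "axis j (1 / a j) \<in> level_space l i"
          by (simp_all add: S_axis) (auto simp: level_space_def axis_def)
        then show "x \<in> (*v) S ` level_space l i" by blast
      qed
    qed
  qed
  have form: "pullback_form V \<gamma> i (S *v x) = level_form l e i x"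
    if i: "i \<le> k" and x: "x \<in> level_space l i" for i x
  proof -
    have hh: "x $ j * x $ j' * B i (h j) (h j') = (if j' = j then (if l j = i then b j * (x $ j)\<^sup>2 else 0) else 0)" for j j'
    proof -
      consider "l j < i" | "l j' < i" | "i < l j" "i \<le> l j'" | "i \<le> l j" "i < l j'" | "l j = i" "l j' = i"
        by linarith
      then show ?thesis
      proof cases
        case 3
        then have "B i (h j') (h j) = 0" by (intro B(4)[OF i] hV) auto
        then show ?thesis using B(2)[OF i, of "h j" "h j'"] 3 by auto
      next
        case 4
        then have "B i (h j) (h j') = 0" by (intro B(4)[OF i] hV) auto
        then show ?thesis using 4 by auto
      next
        case 5
        show ?thesis
        proof (cases "j = j'")
          case False
          then have "h j \<noteq> h j'" using h by (metis UNIV_I bij_betw_def inj_on_def)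
          moreover have "h j \<in> T i" "h j' \<in> T i" using l(2)[of j] l(2)[of j'] 5 by auto
          ultimately show ?thesis using T(4)[OF i] False by simp
        qed (use 5 in \<open>simp add: b_def power2_eq_square\<close>)
      qed (use x in \<open>auto simp: level_space_def\<close>)
    qed
    have "S *v x \<in> V i" using V_eq i x by auto
    then have "pullback_form V \<gamma> i (S *v x) = B i (S *v x) (S *v x)" by (rule B(3)[OF i])
    also have "\<dots> = (\<Sum>j\<in>UNIV. \<Sum>j'\<in>UNIV. a j * a j' * (x $ j * x $ j' * B i (h j) (h j')))"
      unfolding S bilinear_sum[OF B(1)[OF i]]
      by (simp add: bilinear_simps[OF B(1)[OF i]] sum.cartesian_product mult_ac)
    also have "\<dots> = (\<Sum>j\<in>UNIV. (if l j = i then e j else 0) * (x $ j)\<^sup>2)"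
      unfolding hh by (intro sum.cong)
        (auto simp: if_distrib ab[symmetric] power2_eq_square mult_ac cong: if_cong)
    finally show ?thesis by (simp add: level_form_def diag_form_def)
  qed
  have "range l = {..k}"
  proof
    show "range l \<subseteq> {..k}" using l by auto
    show "{..k} \<subseteq> range l"
    proof
      fix i assume "i \<in> {..k}"
      then have i: "i \<le> k" by simp
      have "T i \<noteq> {}"
      proof
        assume "T i = {}"
        then have "W i = {0}" using T(3)[OF i] by simp
        then have "V i \<subseteq> V (Suc i)" using decomp[OF i] by fastforce
        then show False using pf i by (auto simp: partial_flag_def)
      qed
      then show "i \<in> range l" using T_range[OF i] by blast
    qed
  qed
  moreover have "e j = 1 \<or> e j = - 1" for j using b_nz[of j] by (simp add: e_def sgn_real_def)
  ultimately have "adapted_frame k V \<gamma> S l e"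
    unfolding adapted_frame_def using inv_S V_eq form by blast
  then show ?thesis by blast
qed

section \<open>Flags with a prescribed frame\<close>

lemma level_form_add_higher:
  assumes "y \<in> level_space l (Suc i)" shows "level_form l e i (x + y) = level_form l e i x"
  using assms by (simp add: level_form_eq level_space_def)

lemma image_matrix_vector_iff:
  fixes S :: "real^'n^'n"
  assumes "invertible S"
  shows "x \<in> (*v) S ` U \<longleftrightarrow> matrix_inv S *v x \<in> U"
  using matrix_inv_vector[OF assms] by (metis image_iff)

text \<open>The form on a quotient is evaluated on a representative of the coset; the choice does not matter,
  because a level form ignores coordinates of higher level.\<close>
lemma adapted_flag_exists:
  fixes S :: "real^'n^'n"
  assumes inv: "invertible S" and l: "range l = {..k}" and e: "\<And>j. e j = 1 \<or> e j = - 1"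
  shows "\<exists>V \<gamma>. partial_flag k V \<and> flag_of_forms k V \<gamma> \<and> adapted_frame k V \<gamma> S l e"
proof -
  define V where "V i = (*v) S ` level_space l i" for i
  define \<gamma> where "\<gamma> i C = level_form l e i (matrix_inv S *v (SOME y. y \<in> C))" for i C
  have sub: "subspace (V i)" for i
    unfolding V_def by (intro linear_subspace_image subspace_level_space) simp
  have V_iff: "x \<in> V i \<longleftrightarrow> matrix_inv S *v x \<in> level_space l i" for x i
    unfolding V_def by (rule image_matrix_vector_iff[OF inv])
  have V_strict: "V (Suc i) \<subset> V i" if i: "i \<le> k" for i
  proof -
    obtain j where j: "l j = i" using i l by (metis atMost_iff imageE)
    have "S *v axis j 1 \<in> V i" "S *v axis j 1 \<notin> V (Suc i)"
      unfolding V_iff by (simp_all add: matrix_inv_vector inv axis_in_level_space j)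
    moreover have "V (Suc i) \<subseteq> V i"
      unfolding V_def by (intro image_mono level_space_mono) simp
    ultimately show ?thesis by blast
  qed
  have "level_space l (Suc k) = {0}"
    using l by (auto simp: level_space_def vec_eq_iff) (metis atMost_iff le_imp_less_Suc rangeI)
  then have pf: "partial_flag k V"
    unfolding partial_flag_def using sub V_strict V_iff
    by (auto simp: V_def level_space_0 inv) (metis inv matrix_inv_vector(1) rangeI)
  have pull: "pullback_form V \<gamma> i x = level_form l e i (matrix_inv S *v x)" for i x
  proof -
    define y where "y = (SOME y. y \<in> (+) x ` V (Suc i))"
    have "\<exists>y. y \<in> (+) x ` V (Suc i)" using subspace_0[OF sub] by blast
    then have "y \<in> (+) x ` V (Suc i)" unfolding y_def by (rule someI_ex)
    then obtain w where w: "w \<in> V (Suc i)" "y = x + w" by blast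
    then have "matrix_inv S *v w \<in> level_space l (Suc i)" by (simp add: V_iff)
    then show ?thesis
      using w by (simp add: pullback_form_def \<gamma>_def flip: y_def)
        (simp add: matrix_vector_right_distrib level_form_add_higher)
  qed
  have ff: "flag_of_forms k V \<gamma>"
    unfolding flag_of_forms_def
  proof (intro allI impI conjI)
    fix i assume i: "i \<le> k"
    define d where "d j = (if l j = i then e j else 0)" for j
    have pull': "pullback_form V \<gamma> i x = diag_form d (matrix_inv S *v x)" for x
      unfolding pull level_form_def d_def ..
    show "quadratic_form_on (V i) (pullback_form V \<gamma> i)"
      unfolding quadratic_form_on_def pull' diag_form_bilinear using bilinear_diag_bilinear by blast
    show "nondegenerate_mod (V i) (V (Suc i)) (pullback_form V \<gamma> i)"
      unfolding nondegenerate_mod_def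
    proof (intro ballI impI)
      fix x assume x: "x \<in> V i"
        and 0: "\<forall>y\<in>V i. pullback_form V \<gamma> i (x + y) - pullback_form V \<gamma> i x - pullback_form V \<gamma> i y = 0"
      define z where "z = matrix_inv S *v x"
      have "z $ j = 0" if "l j = i" for j
      proof -
        have "S *v axis j 1 \<in> V i" unfolding V_iff by (simp add: matrix_inv_vector inv axis_in_level_space that)
        from bspec[OF 0 this] have "diag_bilinear d z (axis j 1) = 0"
          unfolding pull' by (simp add: matrix_vector_right_distrib diag_form_add matrix_inv_vector inv z_def)
        then show ?thesis using e[of j] that by (auto simp: diag_bilinear_axis d_def)
      qed
      then show "x \<in> V (Suc i)"
        using x unfolding V_iff level_space_def z_def by (auto simp: less_Suc_eq)
    qed
  qed
  have "adapted_frame k V \<gamma> S l e"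
    unfolding adapted_frame_def using inv l e by (auto simp: V_def pull matrix_inv_vector)
  then show ?thesis using pf ff by blast
qed

section \<open>Signatures\<close>

lemma dim_coordinate_image:
  fixes S :: "real^'n^'n"
  assumes "invertible S"
  shows "dim ((*v) S ` {x. \<forall>j. j \<notin> T \<longrightarrow> x $ j = 0}) = card T"
proof -
  have "dim ((*v) S ` {x. \<forall>j. j \<notin> T \<longrightarrow> x $ j = 0}) = dim {x::real^'n. \<forall>j. j \<notin> T \<longrightarrow> x $ j = 0}"
    by (rule dim_image_eq) (use inj_matrix_vector_mult[OF assms] in \<open>auto intro: inj_on_subset\<close>)
  then show ?thesis using dim_substandard_cart[of T, where 'a=real] by (simp add: dim_vec_eq)
qed

lemma subspace_coordinate_image:
  fixes S :: "real^'n^'n"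
  shows "subspace ((*v) S ` {x. \<forall>j. j \<notin> T \<longrightarrow> x $ j = 0})"
  by (intro linear_subspace_image) (auto simp: subspace_def)

lemma level_space_coordinates: "level_space l i = {x. \<forall>j. j \<notin> {j. i \<le> l j} \<longrightarrow> x $ j = 0}"
  by (auto simp: level_space_def not_le)

text \<open>Sylvester's law of inertia: a subspace on which the form is negative modulo \<open>W\<close> meets the
  span of the positive coordinate vectors trivially.\<close>
lemma negative_index_of_frame:
  fixes S :: "real^'n^'n"
  assumes inv: "invertible S" and e: "\<And>j. e j = 1 \<or> e j = - 1"
    and V: "V = (*v) S ` level_space l i" and W: "W = (*v) S ` level_space l (Suc i)"
    and Q: "\<And>x. x \<in> level_space l i \<Longrightarrow> Q (S *v x) = level_form l e i x"
  shows "Max {dim U - dim W | U. subspace U \<and> W \<subseteq> U \<and> U \<subseteq> V \<and> (\<forall>x\<in>U - W. Q x < 0)} =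
    card {j. l j = i \<and> e j = - 1}"
    (is "Max ?M = card ?N")
proof -
  define C where "C T = (*v) S ` {x. \<forall>j. j \<notin> T \<longrightarrow> x $ j = 0}" for T
  have dimC: "dim (C T) = card T" and subC: "subspace (C T)" for T
    unfolding C_def by (simp_all add: dim_coordinate_image inv subspace_coordinate_image)
  have C_iff: "x \<in> C T \<longleftrightarrow> (\<forall>j. j \<notin> T \<longrightarrow> (matrix_inv S *v x) $ j = 0)" for x T
    unfolding C_def by (simp add: image_matrix_vector_iff inv)
  define A where "A = {j. Suc i \<le> l j}"
  define P where "P = {j. l j = i \<and> e j = 1}"
  have W: "W = C A" unfolding W C_def A_def level_space_coordinates ..
  have V': "V = C (A \<union> ?N \<union> P)"
  proof -
    have "{j. i \<le> l j} = A \<union> ?N \<union> P" using e by (auto simp: A_def P_def)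
    then show ?thesis unfolding V C_def level_space_coordinates by simp
  qed
  have V_iff: "x \<in> V \<longleftrightarrow> matrix_inv S *v x \<in> level_space l i" for x
    unfolding V by (rule image_matrix_vector_iff[OF inv])
  have Q': "Q x = level_form l e i (matrix_inv S *v x)" if "x \<in> V" for x
    using Q[of "matrix_inv S *v x"] that by (simp add: V_iff matrix_inv_vector inv)
  have disj: "A \<inter> ?N = {}" "(A \<union> ?N) \<inter> P = {}" "P \<inter> A = {}" by (auto simp: A_def P_def)
  have upper: "r \<le> card ?N" if r: "r \<in> ?M" for r
  proof -
    obtain U where U: "r = dim U - dim W" "subspace U" "W \<subseteq> U" "U \<subseteq> V" "\<And>x. x \<in> U - W \<Longrightarrow> Q x < 0"
      using r by blast
    have "U \<inter> C P \<subseteq> {0}"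
    proof
      fix x assume x: "x \<in> U \<inter> C P"
      then have "x \<in> V" using U by auto
      have "Q x \<ge> 0"
        unfolding Q'[OF \<open>x \<in> V\<close>] level_form_eq
      proof (intro sum_nonneg)
        fix j assume "j \<in> {j. l j = i}"
        then show "0 \<le> e j * ((matrix_inv S *v x) $ j)\<^sup>2"
          using x e[of j] by (auto simp: C_iff P_def)
      qed
      then have "x \<in> C A" using U(5)[of x] x W by force
      then have "(matrix_inv S *v x) $ j = 0" for j
        using x disj(3) C_iff[of x A] C_iff[of x P] by (cases "j \<in> A") auto
      then have "matrix_inv S *v x = 0" by (simp add: vec_eq_iff)
      then show "x \<in> {0}" by (simp add: invertible_vector_nonzero invertible_matrix_inv inv)
    qed
    then have "dim (U \<inter> C P) = 0" by (simp only: dim_eq_0)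
    then have "dim U + card P = dim {x + y | x y. x \<in> U \<and> y \<in> C P}"
      using dim_sums_Int[OF U(2) subC[of P]] unfolding dimC by linarith
    also have "\<dots> \<le> dim V"
    proof (rule dim_subset)
      have "subspace V" unfolding V' by (rule subC)
      moreover have "C P \<subseteq> V" unfolding V' by (auto simp: C_iff)
      ultimately show "{x + y | x y. x \<in> U \<and> y \<in> C P} \<subseteq> V" using U(4) by (auto intro: subspace_add)
    qed
    also have "dim V = card A + card ?N + card P"
      unfolding V' dimC using disj by (simp add: card_Un_disjoint)
    finally show ?thesis using U(1) by (simp add: W dimC)
  qed
  moreover have "card ?N \<in> ?M"
  proof -
    have "card ?N = dim (C (A \<union> ?N)) - dim W"
      unfolding W dimC using disj by (simp add: card_Un_disjoint)
    moreover have "W \<subseteq> C (A \<union> ?N)" "C (A \<union> ?N) \<subseteq> V"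
      unfolding W V' by (auto simp: C_iff)
    moreover have "Q x < 0" if x: "x \<in> C (A \<union> ?N) - W" for x
    proof -
      define z where "z = matrix_inv S *v x"
      have "x \<in> V" using x \<open>C (A \<union> ?N) \<subseteq> V\<close> by blast
      have z: "z $ j = 0" if "j \<notin> A \<union> ?N" for j using x that by (auto simp: C_iff z_def)
      obtain j where j: "j \<notin> A" "z $ j \<noteq> 0" using x by (auto simp: W C_iff z_def)
      have "(\<Sum>j | l j = i. e j * (z $ j)\<^sup>2) < (\<Sum>j | l j = i. 0)"
      proof (rule sum_strict_mono_ex1)
        show "\<forall>j\<in>{j. l j = i}. e j * (z $ j)\<^sup>2 \<le> 0"
        proof
          fix j assume "j \<in> {j. l j = i}"
          then show "e j * (z $ j)\<^sup>2 \<le> 0" using e[of j] z[of j] by (auto simp: A_def)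
        qed
        show "\<exists>j\<in>{j. l j = i}. e j * (z $ j)\<^sup>2 < 0"
        proof -
          have "l j = i" "e j = - 1" using j z[of j] by auto
          then show ?thesis using j(2) by (intro bexI[of _ j]) auto
        qed
      qed simp
      then show ?thesis unfolding Q'[OF \<open>x \<in> V\<close>] level_form_eq z_def by simp
    qed
    ultimately show ?thesis using subC[of "A \<union> ?N"] by blast
  qed
  moreover have "finite ?M" using upper by (meson finite_nat_set_iff_bounded_le)
  ultimately show ?thesis by (intro Max_eqI) auto
qed

lemma level_form_uminus: "level_form l (\<lambda>j. - e j) i x = - level_form l e i x"
  by (simp add: level_form_eq sum_negf)

lemma flag_signature_of_frame:
  assumes fr: "adapted_frame k V \<gamma> S l e" and i: "i \<le> k"
  shows "flag_signature V \<gamma> i = (card {j. l j = i \<and> e j = - 1}, card {j. l j = i \<and> e j = 1})"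
proof -
  define Q where "Q = pullback_form V \<gamma> i"
  have fr': "invertible S" "\<And>j. e j = 1 \<or> e j = - 1" "V i = (*v) S ` level_space l i"
    "V (Suc i) = (*v) S ` level_space l (Suc i)"
    "\<And>x. x \<in> level_space l i \<Longrightarrow> Q (S *v x) = level_form l e i x"
    using fr i by (auto simp: adapted_frame_def Q_def)
  have neg: "- e j = 1 \<or> - e j = - 1" for j using fr'(2)[of j] by auto
  have form: "- Q (S *v x) = level_form l (\<lambda>j. - e j) i x" if "x \<in> level_space l i" for x
    using fr'(5)[OF that] by (simp add: level_form_uminus)
  show ?thesis
    using negative_index_of_frame[OF fr']
      negative_index_of_frame[where e = "\<lambda>j. - e j" and Q = "\<lambda>x. - Q x", OF fr'(1) neg fr'(3,4) form]
    unfolding flag_signature_def signature_mod_def Q_def by simp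
qed

section \<open>The geometry of a flag of forms\<close>

lemma adapted_frameD:
  assumes "adapted_frame k V \<gamma> S l e"
  shows "invertible S" "range l = {..k}" "\<And>j. l j \<le> k" "\<And>j. e j = 1 \<or> e j = - 1"
    "\<And>i. i \<le> Suc k \<Longrightarrow> V i = (*v) S ` level_space l i"
    "\<And>i x. i \<le> k \<Longrightarrow> x \<in> level_space l i \<Longrightarrow> pullback_form V \<gamma> i (S *v x) = level_form l e i x"
    "\<And>i x. i \<le> Suc k \<Longrightarrow> x \<in> V i \<longleftrightarrow> matrix_inv S *v x \<in> level_space l i"
    "\<And>i x. i \<le> k \<Longrightarrow> x \<in> V i \<Longrightarrow> pullback_form V \<gamma> i x = level_form l e i (matrix_inv S *v x)"
proof -
  show inv: "invertible S" and l: "range l = {..k}" and "\<And>j. e j = 1 \<or> e j = - 1"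
    and V: "\<And>i. i \<le> Suc k \<Longrightarrow> V i = (*v) S ` level_space l i"
    and Q: "\<And>i x. i \<le> k \<Longrightarrow> x \<in> level_space l i \<Longrightarrow> pullback_form V \<gamma> i (S *v x) = level_form l e i x"
    using assms unfolding adapted_frame_def by blast+
  show "l j \<le> k" for j using l by auto
  show V': "x \<in> V i \<longleftrightarrow> matrix_inv S *v x \<in> level_space l i" if "i \<le> Suc k" for i x
    unfolding V[OF that] by (rule image_matrix_vector_iff[OF inv])
  show "pullback_form V \<gamma> i x = level_form l e i (matrix_inv S *v x)" if "i \<le> k" "x \<in> V i" for i x
    using Q[OF that(1), of "matrix_inv S *v x"] V'[of i x] that by (simp add: matrix_inv_vector inv)
qed

lemma level_space_above:
  assumes "\<And>j. l j \<le> k" "k < i" shows "level_space l i = {0}"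
  using assms by (auto simp: level_space_def vec_eq_iff) (meson le_less_trans)

lemma level_form_0: "level_form l e i 0 = 0"
  by (simp add: level_form_eq)

lemma flag_similarity_of_frame:
  assumes fr: "adapted_frame k V \<gamma> S l e"
  shows "flag_similarity l e s (matrix_inv S ** M ** S) \<longleftrightarrow>
    (\<forall>i\<le>k. \<forall>x\<in>V i. M *v x \<in> V i \<and> pullback_form V \<gamma> i (M *v x) = s * pullback_form V \<gamma> i x)"
proof
  note D = adapted_frameD[OF fr]
  have conj: "matrix_inv S *v (M *v x) = (matrix_inv S ** M ** S) *v (matrix_inv S *v x)" for x
    by (simp only: matrix_vector_mul_assoc matrix_inv_cancel(4)[OF D(1)])
      (simp only: matrix_mul_assoc[symmetric] matrix_inv_cancel(1)[OF D(1)]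
        matrix_inv_right[OF D(1)] matrix_mul_rid)
  show "\<forall>i\<le>k. \<forall>x\<in>V i. M *v x \<in> V i \<and> pullback_form V \<gamma> i (M *v x) = s * pullback_form V \<gamma> i x"
    if sim: "flag_similarity l e s (matrix_inv S ** M ** S)"
  proof (intro allI impI ballI)
    fix i x assume i: "i \<le> k" and x: "x \<in> V i"
    then have "matrix_inv S *v x \<in> level_space l i" using D(7)[of i x] by simp
    with sim have *: "matrix_inv S *v (M *v x) \<in> level_space l i"
      "level_form l e i (matrix_inv S *v (M *v x)) = s * level_form l e i (matrix_inv S *v x)"
      unfolding conj flag_similarity_def by auto
    then have "M *v x \<in> V i" using D(7)[of i "M *v x"] i by simp
    then show "M *v x \<in> V i \<and> pullback_form V \<gamma> i (M *v x) = s * pullback_form V \<gamma> i x"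
      using D(8)[OF i] x * by simp
  qed
  show "flag_similarity l e s (matrix_inv S ** M ** S)"
    if sim: "\<forall>i\<le>k. \<forall>x\<in>V i. M *v x \<in> V i \<and> pullback_form V \<gamma> i (M *v x) = s * pullback_form V \<gamma> i x"
    unfolding flag_similarity_def
  proof (intro allI ballI)
    fix i z assume z: "z \<in> level_space l i"
    show "(matrix_inv S ** M ** S) *v z \<in> level_space l i \<and>
      level_form l e i ((matrix_inv S ** M ** S) *v z) = s * level_form l e i z"
    proof (cases "i \<le> k")
      case True
      have x: "S *v z \<in> V i" using D(7)[of i "S *v z"] z True by (simp add: matrix_inv_vector D(1))
      have *: "(matrix_inv S ** M ** S) *v z = matrix_inv S *v (M *v (S *v z))"
        by (simp only: matrix_vector_mul_assoc matrix_mul_assoc)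
      show ?thesis
        using sim True x D(7)[of i "M *v (S *v z)"] D(8)[OF True, of "M *v (S *v z)"] D(6)[OF True z]
        unfolding * by auto
    next
      case False
      then have "z = 0" using z level_space_above[of l k i] D(3) by auto
      then show ?thesis by (simp add: level_form_0 subspace_0 subspace_level_space)
    qed
  qed
qed

lemma flag_subspace_of_frame:
  assumes "adapted_frame k V \<gamma> S l e" "i \<le> Suc k" shows "subspace (V i)"
  unfolding adapted_frameD(5)[OF assms] by (intro linear_subspace_image subspace_level_space) simp

lemma Isom_flag_iff_frame:
  assumes fr: "adapted_frame k V \<gamma> S l e"
  shows "M \<in> Isom_flag k V \<gamma> \<longleftrightarrow> invertible M \<and> flag_similarity l e 1 (matrix_inv S ** M ** S)"
proof -
  note D = adapted_frameD[OF fr]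
  have "V (Suc k) = {0}" using D(5)[of "Suc k"] level_space_above[of l k "Suc k"] D(3) by auto
  then have "(*v) M ` V i = V i" if "invertible M" "\<forall>i\<le>k. \<forall>x\<in>V i. M *v x \<in> V i" "i \<le> Suc k" for i
    using invertible_image_subspace[OF that(1) flag_subspace_of_frame[OF fr that(3)]] that
    by (cases "i = Suc k") auto
  then show ?thesis
    unfolding Isom_flag_def flag_similarity_of_frame[OF fr]
    by (auto intro: image_eqI) (metis imageI le_SucI)
qed

lemma flag_similarity_scale:
  assumes "flag_similarity l e s A"
  shows "flag_similarity l e (c\<^sup>2 * s) (c *\<^sub>R A)"
  using assms unfolding flag_similarity_def
  by (simp add: scaleR_matrix_vector_assoc[symmetric] subspace_scale[OF subspace_level_space]
      level_form_def diag_form_scale)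

lemma P_Isom_iff_frame:
  assumes fr: "adapted_frame k V \<gamma> S l e" and inv: "invertible M"
  shows "pgl_class M \<in> P_Isom k V \<gamma> \<longleftrightarrow> (\<exists>s>0. flag_similarity l e s (matrix_inv S ** M ** S))"
proof
  have conj_scale: "matrix_inv S ** (c *\<^sub>R M) ** S = c *\<^sub>R (matrix_inv S ** M ** S)" for c M
    by (simp add: matrix_scalar_ac scalar_matrix_assoc[symmetric])
  assume "pgl_class M \<in> P_Isom k V \<gamma>"
  then obtain A where A: "A \<in> Isom_flag k V \<gamma>" "pgl_class M = pgl_class A"
    by (auto simp: P_Isom_def)
  then have A': "invertible A" "flag_similarity l e 1 (matrix_inv S ** A ** S)"
    using Isom_flag_iff_frame[OF fr] by auto
  then obtain c where "c \<noteq> 0" "M = c *\<^sub>R A" using pgl_class_eq_iff[of A M] A inv by auto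
  then show "\<exists>s>0. flag_similarity l e s (matrix_inv S ** M ** S)"
    using flag_similarity_scale[OF A'(2), of c]
    by (intro exI[of _ "c\<^sup>2"]) (simp add: conj_scale)
next
  assume "\<exists>s>0. flag_similarity l e s (matrix_inv S ** M ** S)"
  then obtain s where s: "s > 0" "flag_similarity l e s (matrix_inv S ** M ** S)" by blast
  define A where "A = (1 / sqrt s) *\<^sub>R M"
  have "matrix_inv S ** A ** S = (1 / sqrt s) *\<^sub>R (matrix_inv S ** M ** S)"
    by (simp add: A_def matrix_scalar_ac scalar_matrix_assoc[symmetric])
  then have "flag_similarity l e 1 (matrix_inv S ** A ** S)"
    using flag_similarity_scale[OF s(2), of "1 / sqrt s"] s(1) by (simp add: power_divide)
  moreover have "invertible A" unfolding A_def using s inv by (intro scalar_invertible) auto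
  ultimately have "A \<in> Isom_flag k V \<gamma>" using Isom_flag_iff_frame[OF fr] by blast
  moreover have "pgl_class A = pgl_class M" unfolding A_def using s inv by (intro pgl_class_scale) auto
  ultimately show "pgl_class M \<in> P_Isom k V \<gamma>" unfolding P_Isom_def by (metis imageI)
qed

text \<open>The factors are, up to sign, the values of the top form at the images of a coordinate vector of level 0, so they
  converge; the limit factor is nonzero because the limit matrix is invertible.\<close>
lemma flag_similarity_limit:
  fixes A :: "nat \<Rightarrow> real^'n^'n"
  assumes l: "l j = 0" and e: "e j = 1 \<or> e j = - 1"
    and lim: "A \<longlonglongrightarrow> a" and inv: "invertible a" and pos: "\<And>m. s m > 0"
    and sim: "\<And>m. flag_similarity l e (s m) (A m)"
  shows "\<exists>t>0. flag_similarity l e t a"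
proof -
  have cont: "(\<lambda>m. level_form l e i (A m *v x)) \<longlonglongrightarrow> level_form l e i (a *v x)" for i x
    unfolding level_form_def diag_form_def by (intro tendsto_intros lim)
  have axis: "level_form l e 0 (axis j 1) = e j"
  proof -
    have "level_form l e 0 (axis j 1) = (\<Sum>i | l i = 0. if i = j then e j else 0)"
      unfolding level_form_eq by (intro sum.cong) (auto simp: axis_def)
    then show ?thesis using l by (simp add: sum.delta)
  qed
  define t where "t = e j * level_form l e 0 (a *v axis j 1)"
  have "s m = e j * level_form l e 0 (A m *v axis j 1)" for m
    using sim[of m] e axis by (auto simp: flag_similarity_def level_space_0)
  then have "s = (\<lambda>m. e j * level_form l e 0 (A m *v axis j 1))" by (rule ext)
  moreover have "(\<lambda>m. e j * level_form l e 0 (A m *v axis j 1)) \<longlonglongrightarrow> t"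
    unfolding t_def by (intro tendsto_intros cont)
  ultimately have s_lim: "s \<longlonglongrightarrow> t" by simp
  have form: "level_form l e i (a *v x) = t * level_form l e i x" if "x \<in> level_space l i" for i x
  proof -
    have "(\<lambda>m. s m * level_form l e i x) \<longlonglongrightarrow> t * level_form l e i x"
      by (intro tendsto_intros s_lim)
    moreover have "s m * level_form l e i x = level_form l e i (A m *v x)" for m
      using sim[of m] that by (simp add: flag_similarity_def)
    ultimately show ?thesis using cont[of i x] LIMSEQ_unique by simp blast
  qed
  have "t \<ge> 0" using pos by (intro LIMSEQ_le_const[OF s_lim]) (auto intro: less_imp_le)
  moreover have "t \<noteq> 0"
  proof
    assume "t = 0"
    then have "level_form l e 0 (a *v (matrix_inv a *v axis j 1)) = 0"
      using form[of "matrix_inv a *v axis j 1" 0] by (simp add: level_space_0)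
    then show False using axis e by (auto simp: matrix_inv_vector inv)
  qed
  moreover have "flag_similarity l e t a"
    unfolding flag_similarity_def
  proof (intro allI ballI conjI)
    fix i and x :: "real^'n" assume x: "x \<in> level_space l i"
    have "A m *v x \<in> level_space l i" for m using sim[of m] x by (simp add: flag_similarity_def)
    moreover have "(\<lambda>m. A m *v x) \<longlonglongrightarrow> a *v x" by (intro tendsto_intros lim)
    ultimately show "a *v x \<in> level_space l i"
      using closed_sequentially[OF closed_subspace[OF subspace_level_space]] by metis
  qed (rule form)
  ultimately show ?thesis by (metis less_eq_real_def)
qed

lemma closed_P_Isom:
  assumes fr: "adapted_frame k V \<gamma> S l e"
  shows "closed (P_Isom k V \<gamma>)"
proof -
  note D = adapted_frameD[OF fr]
  obtain j where j: "l j = 0" using D(2) by (metis atMost_iff imageE le0)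
  define F where "F = {A. invertible A \<and> pgl_class A \<in> P_Isom k V \<gamma>}"
  have "A \<in> F" if A: "invertible A" "A \<in> closure F" for A
  proof -
    obtain B where B: "\<And>m. B m \<in> F" "B \<longlonglongrightarrow> A" using A(2) unfolding closure_sequential by blast
    have "\<forall>m. \<exists>s>0. flag_similarity l e s (matrix_inv S ** B m ** S)"
      using B(1) P_Isom_iff_frame[OF fr] by (auto simp: F_def)
    then obtain s where s: "\<And>m. s m > 0" "\<And>m. flag_similarity l e (s m) (matrix_inv S ** B m ** S)"
      by metis
    have "\<exists>t>0. flag_similarity l e t (matrix_inv S ** A ** S)"
    proof (rule flag_similarity_limit[where s = s, OF j D(4) _ _ s])
      show "(\<lambda>m. matrix_inv S ** B m ** S) \<longlonglongrightarrow> matrix_inv S ** A ** S"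
        by (intro tendsto_intros B(2))
    qed (simp add: invertible_mult invertible_matrix_inv D(1) A(1))
    then show ?thesis using P_Isom_iff_frame[OF fr A(1)] A(1) by (simp add: F_def)
  qed
  moreover have "F \<subseteq> closure F" by (rule closure_subset)
  ultimately have "{A. invertible A \<and> pgl_class A \<in> - P_Isom k V \<gamma>} = {A. invertible A} \<inter> - closure F"
    by (auto simp: F_def)
  then have "open (- P_Isom k V \<gamma>)"
    unfolding open_pgl_def by (simp only:) (intro open_Int open_invertible open_Compl closed_closure)
  then show ?thesis by (simp add: closed_def)
qed

lemma subgroup_P_Isom: "subgroup (P_Isom k V \<gamma>) PGL"
proof -
  interpret Group.group PGL by (rule group_PGL)
  show ?thesis
  proof (rule subgroupI)
    have "mat 1 \<in> Isom_flag k V \<gamma>" by (simp add: Isom_flag_def invertible_mat_1)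
    then show "P_Isom k V \<gamma> \<noteq> {}" by (auto simp: P_Isom_def)
  next
    fix x assume "x \<in> P_Isom k V \<gamma>"
    then obtain A where A: "A \<in> Isom_flag k V \<gamma>" "x = pgl_class A" by (auto simp: P_Isom_def)
    then have inv: "invertible A" by (simp add: Isom_flag_def)
    have img: "(*v) A ` V i = V i" if "i \<le> Suc k" for i using A that by (simp add: Isom_flag_def)
    have img': "(*v) (matrix_inv A) ` V i = V i" if "i \<le> Suc k" for i
    proof -
      have "(*v) (matrix_inv A) ` V i = (*v) (matrix_inv A) ` ((*v) A ` V i)" by (simp only: img[OF that])
      also have "\<dots> = V i" by (simp only: image_image matrix_inv_vector[OF inv] image_ident)
      finally show ?thesis .
    qed
    have "pullback_form V \<gamma> i (matrix_inv A *v y) = pullback_form V \<gamma> i y"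
      if i: "i \<le> k" and y: "y \<in> V i" for i y
    proof -
      have "matrix_inv A *v y \<in> V i" using img'[of i] i y by auto
      then have "pullback_form V \<gamma> i (A *v (matrix_inv A *v y)) = pullback_form V \<gamma> i (matrix_inv A *v y)"
        using A(1) i by (simp add: Isom_flag_def)
      then show ?thesis by (simp add: matrix_inv_vector inv)
    qed
    then have "matrix_inv A \<in> Isom_flag k V \<gamma>"
      using img' by (simp add: Isom_flag_def invertible_matrix_inv inv)
    then show "inv\<^bsub>PGL\<^esub> x \<in> P_Isom k V \<gamma>" by (simp add: A(2) pgl_class_inv inv P_Isom_def)
  next
    fix x y assume "x \<in> P_Isom k V \<gamma>" "y \<in> P_Isom k V \<gamma>"
    then obtain A B where A: "A \<in> Isom_flag k V \<gamma>" "x = pgl_class A"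
      and B: "B \<in> Isom_flag k V \<gamma>" "y = pgl_class B" by (auto simp: P_Isom_def)
    have "A ** B \<in> Isom_flag k V \<gamma>"
    proof -
      have "(*v) (A ** B) ` V i = V i" if "i \<le> Suc k" for i
        using A(1) B(1) that by (simp add: Isom_flag_def image_image flip: matrix_vector_mul_assoc)
          (metis image_image)
      moreover have "B *v z \<in> V i" if "i \<le> k" "z \<in> V i" for i z
      proof -
        have "(*v) B ` V i = V i" using B(1) that by (simp add: Isom_flag_def)
        then show ?thesis using that by blast
      qed
      ultimately show ?thesis
        using A(1) B(1) by (simp add: Isom_flag_def invertible_mult flip: matrix_vector_mul_assoc)
    qed
    then show "x \<otimes>\<^bsub>PGL\<^esub> y \<in> P_Isom k V \<gamma>"
      using A B by (auto simp: P_Isom_def Isom_flag_def pgl_class_mult)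
  qed (simp add: carrier_PGL)
qed

lemma X_space_iff:
  assumes "\<And>c x. Q (c *\<^sub>R x) = c\<^sup>2 * Q x" "x \<noteq> 0"
  shows "rp_class x \<in> X_space Q \<longleftrightarrow> Q x < 0"
proof
  assume "rp_class x \<in> X_space Q"
  then obtain y where y: "rp_class x = rp_class y" "y \<noteq> 0" "Q y < 0" by (auto simp: X_space_def)
  then obtain c where "c \<noteq> 0" "y = c *\<^sub>R x" using rp_class_eq_iff[OF assms(2) y(2)] by blast
  then show "Q x < 0" using y(3) by (simp add: assms(1) mult_less_0_iff not_less zero_le_power2)
qed (use assms in \<open>auto simp: X_space_def\<close>)

text \<open>Two negative vectors, one of them replaced by its opposite if necessary, are joined by a
  segment of negative vectors.\<close>
lemma X_space_open_connected:
  fixes B :: "real^'n \<Rightarrow> real^'n \<Rightarrow> real"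
  assumes bil: "bilinear B" and sym: "\<And>x y. B x y = B y x" and Q: "\<And>x. Q x = B x x"
  shows "open (X_space Q)" "connected (X_space Q)"
proof -
  have scale: "Q (c *\<^sub>R x) = c\<^sup>2 * Q x" for c x
    by (simp add: Q bilinear_simps[OF bil] power2_eq_square)
  have Q0: "Q 0 = 0" by (simp add: Q bilinear_simps[OF bil])
  have "bounded_bilinear B" using bil by (rule bilinear_conv_bounded_bilinear[THEN iffD1])
  then have "continuous_on UNIV Q"
    unfolding Q by (rule bounded_bilinear.continuous_on[OF _ continuous_on_id continuous_on_id])
  then have "open (Q -` {..<0})" by (intro open_vimage) auto
  moreover have "x \<noteq> 0 \<and> rp_class x \<in> X_space Q \<longleftrightarrow> Q x < 0" for x
    using X_space_iff[OF scale, of x] Q0 by (cases "x = 0") auto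
  then have "{x. x \<noteq> 0 \<and> rp_class x \<in> X_space Q} = Q -` {..<0}" by auto
  ultimately show "open (X_space Q)" by (simp add: open_rp_def)
  have seg: "\<exists>T\<subseteq>X_space Q. connected T \<and> rp_class x \<in> T \<and> rp_class y \<in> T"
    if neg: "Q x < 0" "Q y < 0" and B: "B x y \<le> 0" for x y
  proof (intro exI[of _ "rp_class ` closed_segment x y"] conjI)
    have "Q z < 0" if z: "z \<in> closed_segment x y" for z
    proof -
      obtain u where u: "0 \<le> u" "u \<le> 1" "z = (1 - u) *\<^sub>R x + u *\<^sub>R y"
        using z by (auto simp: in_segment)
      have "Q z = (1 - u)\<^sup>2 * Q x + 2 * ((1 - u) * u) * B x y + u\<^sup>2 * Q y"
        unfolding u(3) by (simp add: Q bilinear_simps[OF bil] sym[of y x] power2_eq_square algebra_simps)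
      moreover have "2 * ((1 - u) * u) * B x y \<le> 0"
        using u B by (intro mult_nonneg_nonpos) auto
      moreover have "(1 - u)\<^sup>2 * Q x + u\<^sup>2 * Q y < 0"
      proof (cases "u = 0")
        case False
        have "(1 - u)\<^sup>2 * Q x \<le> 0" using neg by (intro mult_nonneg_nonpos) auto
        moreover have "u\<^sup>2 * Q y < 0" using neg False by (intro mult_pos_neg) auto
        ultimately show ?thesis by simp
      qed (use neg in simp)
      ultimately show ?thesis by linarith
    qed
    then have neg': "z \<noteq> 0 \<and> Q z < 0" if "z \<in> closed_segment x y" for z using that Q0 by force
    then show "rp_class ` closed_segment x y \<subseteq> X_space Q" by (auto simp: X_space_def)
    show "connected (rp_class ` closed_segment x y)"
      by (intro connected_continuous_image continuous_on_subset[OF continuous_on_rp_class]) (use neg' in auto)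
  qed auto
  show "connected (X_space Q)"
  proof (rule connectedI)
    fix U U' assume U: "open U" "open U'" "U \<inter> X_space Q \<noteq> {}" "U' \<inter> X_space Q \<noteq> {}"
      "U \<inter> U' \<inter> X_space Q = {}" "X_space Q \<subseteq> U \<union> U'"
    obtain x where x: "x \<noteq> 0" "Q x < 0" "rp_class x \<in> U" using U(3) by (auto simp: X_space_def)
    obtain y where y: "y \<noteq> 0" "Q y < 0" "rp_class y \<in> U'" using U(4) by (auto simp: X_space_def)
    have "rp_class (- y) = rp_class y"
      using y rp_class_eq_iff[of "- y" y] by (auto intro!: exI[of _ "- 1"])
    moreover have "Q (- y) < 0" "B x (- y) = - B x y" using y by (simp_all add: Q bilinear_simps[OF bil])
    ultimately obtain T where "T \<subseteq> X_space Q" "connected T" "rp_class x \<in> T" "rp_class y \<in> T"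
      using seg[of x y] seg[of x "- y"] x y by (cases "B x y \<le> 0") auto
    then show False using U x y connectedD[of T U U'] by blast
  qed
qed

lemma matrix_of_linear:
  fixes f :: "real^'n \<Rightarrow> real^'n"
  assumes "linear f" obtains A where "\<And>x. A *v x = f x"
  using assms matrix_works[of f] by (metis scalar_mult_eq_scaleR matrix_vector_mul(2) matrix_works)

text \<open>The reflection in \<open>x - y\<close> or in \<open>x + y\<close> carries \<open>x\<close> to \<open>\<plusminus>y\<close>; it fixes the radical of the
  top form pointwise, hence preserves the flag and the lower forms.\<close>
lemma subgeometry_flag:
  assumes pf: "partial_flag k V" and ff: "flag_of_forms k V \<gamma>"
  shows "subgeometry (X_flag V \<gamma>) (P_Isom k V \<gamma>)"
proof -
  obtain S l e where fr: "adapted_frame k V \<gamma> S l e" using adapted_frame_exists[OF pf ff] by blast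
  define Q where "Q = pullback_form V \<gamma> 0"
  have V0: "V 0 = UNIV" using pf by (simp add: partial_flag_def)
  obtain B where bil: "bilinear B" and sym: "\<And>x y. B x y = B y x" and Q: "\<And>x. Q x = B x x"
    and rad: "\<And>x w. w \<in> V 1 \<Longrightarrow> B x w = 0"
    using flag_form_bilinear[OF pf ff, of 0] by (auto simp: V0 Q_def)
  have scale: "Q (c *\<^sub>R x) = c\<^sup>2 * Q x" for c x
    by (simp add: Q bilinear_simps[OF bil] power2_eq_square)
  have X: "X_flag V \<gamma> = X_space Q" by (simp add: X_flag_def Q_def)
  have pres: "pgl_act h z \<in> X_space Q" if "h \<in> P_Isom k V \<gamma>" "z \<in> X_space Q" for h z
  proof -
    obtain A where A: "A \<in> Isom_flag k V \<gamma>" "h = pgl_class A" using \<open>h \<in> _\<close> by (auto simp: P_Isom_def)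
    obtain x where x: "x \<noteq> 0" "Q x < 0" "z = rp_class x" using \<open>z \<in> _\<close> by (auto simp: X_space_def)
    have "invertible A" "Q (A *v x) = Q x" using A by (auto simp: Isom_flag_def Q_def V0)
    then show ?thesis
      using A x by (simp add: pgl_class_act X_space_iff[OF scale] invertible_vector_nonzero)
  qed
  have reflection: "\<exists>h\<in>P_Isom k V \<gamma>. pgl_act h (rp_class x) = rp_class y"
    if nz: "x \<noteq> 0" "y \<noteq> 0" and eq: "Q x = Q y" and ne: "Q (x - y) \<noteq> 0" for x y
  proof -
    \<comment> \<open>The reflection in x - y, defined because x - y is not isotropic.\<close>
    define f where "f z = z - (2 * B z (x - y) / Q (x - y)) *\<^sub>R (x - y)" for z
    define g where "g z = 2 * B z (x - y) / Q (x - y)" for z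
    have "g (z + z') = g z + g z'" "g (c *\<^sub>R z) = c * g z" for c z z'
      unfolding g_def by (simp_all add: bilinear_simps(1,5)[OF bil] add_divide_distrib distrib_left)
    then have "linear (\<lambda>z. z - g z *\<^sub>R (x - y))"
      by (intro linearI) (simp_all add: scaleR_add_left scaleR_diff_right algebra_simps)
    then have "linear f" by (simp add: f_def[abs_def] g_def)
    then obtain A where A: "\<And>z. A *v z = f z" using matrix_of_linear by blast
    have "2 * B x (x - y) = Q (x - y)" using eq by (simp add: Q bilinear_simps[OF bil] sym[of y x])
    then have "A *v x = y" using ne by (simp add: A f_def)
    have ff: "f (f z) = z" for z
    proof -
      have "B (f z) (x - y) = - B z (x - y)"
        unfolding f_def using ne by (simp add: bilinear_simps(3,5)[OF bil] Q)
      then show ?thesis by (simp add: f_def[of "f z"]) (simp add: f_def)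
    qed
    have "A ** A = mat 1" by (simp add: matrix_eq A ff flip: matrix_vector_mul_assoc)
    then have inv: "invertible A" unfolding invertible_right_inverse by blast
    have QA: "Q (A *v z) = Q z" for z
    proof -
      have "Q (z - t *\<^sub>R w) = Q z - 2 * t * B z w + t\<^sup>2 * Q w" for t w
        by (simp add: Q bilinear_simps[OF bil] sym[of w z] power2_eq_square algebra_simps)
      then show ?thesis using ne by (simp add: A f_def power2_eq_square)
    qed
    have fix_rad: "A *v z = z" if "z \<in> V 1" for z
      using rad[OF that, of "x - y"] by (simp add: A f_def sym[of z])
    have fix_lower: "A *v z = z" if "z \<in> V i" "1 \<le> i" "i \<le> Suc k" for z i
      using partial_flag_antimono[OF pf that(2,3)] that(1) fix_rad by blast
    have "A \<in> Isom_flag k V \<gamma>"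
      unfolding Isom_flag_def
    proof (intro CollectI conjI allI impI ballI inv)
      fix i assume i: "i \<le> Suc k"
      show "(*v) A ` V i = V i"
      proof (cases "i = 0")
        case True
        have "surj ((*v) A)" by (metis A ff surjI)
        then show ?thesis by (simp add: True V0)
      next
        case False
        then show ?thesis using fix_lower[of _ i] i by auto
      qed
    next
      fix i z assume "i \<le> k" "z \<in> V i"
      then show "pullback_form V \<gamma> i (A *v z) = pullback_form V \<gamma> i z"
        using fix_lower[of z i] QA[of z] by (cases "i = 0") (auto simp: Q_def)
    qed
    then have "pgl_class A \<in> P_Isom k V \<gamma>" by (auto simp: P_Isom_def)
    moreover have "pgl_act (pgl_class A) (rp_class x) = rp_class y"
      using inv nz \<open>A *v x = y\<close> by (simp add: pgl_class_act)
    ultimately show ?thesis by blast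
  qed
  have trans: "\<exists>h\<in>P_Isom k V \<gamma>. pgl_act h z = z'" if z: "z \<in> X_space Q" "z' \<in> X_space Q" for z z'
  proof -
    obtain x where x: "x \<noteq> 0" "Q x < 0" "z = rp_class x" using z(1) by (auto simp: X_space_def)
    obtain y0 where y0: "y0 \<noteq> 0" "Q y0 < 0" "z' = rp_class y0" using z(2) by (auto simp: X_space_def)
    \<comment> \<open>The representative of the second point at which the form takes the same value as at x.\<close>
    define y where "y = sqrt (Q x / Q y0) *\<^sub>R y0"
    have pos: "Q x / Q y0 > 0" using x y0 by (simp add: divide_neg_neg)
    have y: "y \<noteq> 0" "Q y = Q x" using x y0 pos by (simp_all add: y_def scale)
    have z': "rp_class y = z'" "rp_class (- y) = z'"
      unfolding y0(3)
      using y0(1) y(1) pos rp_class_eq_iff[of y0 y] rp_class_eq_iff[of y0 "- y"]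
      by (auto simp: y_def intro!: exI[of _ "sqrt (Q x / Q y0)"] exI[of _ "- sqrt (Q x / Q y0)"])
    \<comment> \<open>By the parallelogram law x - y and x + y are not both isotropic.\<close>
    have "Q (x - y) + Q (x - (- y)) = 4 * Q x"
      using y(2) by (simp add: Q bilinear_simps[OF bil])
    then have "Q (x - y) \<noteq> 0 \<or> Q (x - (- y)) \<noteq> 0" using x by linarith
    moreover have "Q (- y) = Q x" using scale[of "- 1" y] y(2) by simp
    ultimately show ?thesis
      using reflection[of x y] reflection[of x "- y"] x y z' by fastforce
  qed
  show ?thesis
    unfolding subgeometry_def X
    using subgroup_P_Isom closed_P_Isom[OF fr] X_space_open_connected[OF bil sym Q] pres trans by blast
qed

section \<open>Geometric convergence\<close>

context separating_scales
begin

text \<open>Both inclusions reduce to the diagonal forms by conjugation with \<open>T m\<close>, which converges to \<open>S\<close>.\<close>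
lemma PO_converges:
  assumes fr: "adapted_frame k V \<gamma> S l e"
    and lim: "T \<longlonglongrightarrow> S" and inv: "\<And>m. invertible (T m)"
    and form: "\<And>m x. \<beta> m (T m *v x) = diag_form (coeff m) x"
  shows "converges_geometrically (\<lambda>m. PO (\<beta> m)) (P_Isom k V \<gamma>)"
proof -
  note D = adapted_frameD[OF fr]
  have form': "\<beta> m x = diag_form (coeff m) (matrix_inv (T m) *v x)" for m x
    using form[of m "matrix_inv (T m) *v x"] by (simp add: matrix_inv_vector inv)
  have "\<exists>h. (\<forall>m. h m \<in> PO (\<beta> m)) \<and> h \<longlonglongrightarrow> g" if g: "g \<in> P_Isom k V \<gamma>" for g
  proof -
    obtain A where A: "A \<in> Isom_flag k V \<gamma>" "g = pgl_class A" using g by (auto simp: P_Isom_def)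
    then have A': "invertible A" "flag_similarity l e 1 (matrix_inv S ** A ** S)"
      using Isom_flag_iff_frame[OF fr] by auto
    have inv_conj: "invertible (matrix_inv S ** A ** S)"
      by (intro invertible_mult invertible_matrix_inv A' D(1))
    obtain M where M: "M \<longlonglongrightarrow> matrix_inv S ** A ** S" "\<And>m. invertible (M m)"
      "\<And>m x. diag_form (coeff m) (M m *v x) = diag_form (coeff m) x"
      using isometry_is_limit[OF A'(2) inv_conj] by blast
    define N where "N m = T m ** M m ** matrix_inv (T m)" for m
    have "\<beta> m (N m *v x) = \<beta> m x" for m x
      by (simp add: N_def form' matrix_inv_vector inv M(3) flip: matrix_vector_mul_assoc)
    moreover have inv_N: "invertible (N m)" for m
      unfolding N_def by (intro invertible_mult invertible_matrix_inv inv M)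
    ultimately have "pgl_class (N m) \<in> PO (\<beta> m)" for m unfolding PO_def by blast
    moreover have "N \<longlonglongrightarrow> S ** (matrix_inv S ** A ** S) ** matrix_inv S"
      unfolding N_def by (intro tendsto_intros tendsto_matrix_inv lim M D)
    then have "N \<longlonglongrightarrow> A"
      by (simp add: matrix_inv_cancel(1)[OF D(1)] matrix_inv_right[OF D(1)] flip: matrix_mul_assoc)
    then have "(\<lambda>m. pgl_class (N m)) \<longlonglongrightarrow> g" unfolding A(2) by (rule tendsto_pgl_class[OF _ A'(1)])
    ultimately show ?thesis by (intro exI[of _ "\<lambda>m. pgl_class (N m)"]) auto
  qed
  moreover have "g \<in> P_Isom k V \<gamma>" if h: "\<And>m. h m \<in> PO (\<beta> m)" and acc: "accumulation_point h g" for h g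
  proof -
    obtain A where A: "invertible A" "g = pgl_class A" by (rule pgl_class_cases)
    obtain r B where r: "strict_mono r" "B \<longlonglongrightarrow> A" "\<And>m. invertible (B m)" "\<And>m. h (r m) = pgl_class (B m)"
      using accumulation_point_lift[of h A] acc A by metis
    interpret sub: separating_scales l e "\<lambda>i m. c i (r m)" by (rule subseq_scales[OF r(1)])
    have sub_coeff: "sub.coeff m = coeff (r m)" for m by (simp add: fun_eq_iff sub.coeff_def coeff_def)
    define N where "N m = matrix_inv (T (r m)) ** B m ** T (r m)" for m
    have "\<exists>s>0. \<forall>x. diag_form (coeff (r m)) (N m *v x) = s * diag_form (coeff (r m)) x" for m
    proof -
      obtain M where M: "invertible M" "\<And>x. \<beta> (r m) (M *v x) = \<beta> (r m) x" "h (r m) = pgl_class M"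
        using h[of "r m"] by (auto simp: PO_def)
      then obtain a where a: "a \<noteq> 0" "B m = a *\<^sub>R M"
        using pgl_class_eq_iff[of M "B m"] r by auto
      have "diag_form (coeff (r m)) (N m *v x) = a\<^sup>2 * diag_form (coeff (r m)) x" for x
      proof -
        have "N m *v x = a *\<^sub>R (matrix_inv (T (r m)) *v (M *v (T (r m) *v x)))"
          by (simp add: N_def a matrix_scaleR_vector_ac flip: matrix_vector_mul_assoc scaleR_matrix_vector_assoc)
        then show ?thesis using M(2)[of "T (r m) *v x"] by (simp add: diag_form_scale form' matrix_inv_vector inv)
      qed
      then show ?thesis using a by (intro exI[of _ "a\<^sup>2"]) auto
    qed
    then obtain s where s: "\<And>m. s m > 0"
      "\<And>m x. diag_form (coeff (r m)) (N m *v x) = s m * diag_form (coeff (r m)) x" by metis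
    have "N \<longlonglongrightarrow> matrix_inv S ** A ** S"
      unfolding N_def using LIMSEQ_subseq_LIMSEQ[OF lim r(1)]
      by (intro tendsto_intros tendsto_matrix_inv r D) (simp_all add: comp_def)
    moreover have "invertible (N m)" for m
      unfolding N_def by (intro invertible_mult invertible_matrix_inv inv r)
    moreover have "invertible (matrix_inv S ** A ** S)"
      by (intro invertible_mult invertible_matrix_inv A D(1))
    ultimately have "\<exists>t>0. flag_similarity l e t (matrix_inv S ** A ** S)"
      by (intro sub.limit_of_similarities[where s = s and A = N]) (simp_all add: sub_coeff s)
    then show ?thesis using P_Isom_iff_frame[OF fr A(1)] A(2) by simp
  qed
  ultimately show ?thesis unfolding converges_geometrically_def by blast
qed

text \<open>In the limit only the largest size survives. This carries the sign of the forms at a fixed vector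
  over to the top form.\<close>
lemma rescaled_forms_converge:
  assumes fr: "adapted_frame k V \<gamma> S l e" and V0: "V 0 = UNIV"
    and lim: "T \<longlonglongrightarrow> S" and inv: "\<And>m. invertible (T m)"
    and form: "\<And>m x. \<beta> m (T m *v x) = diag_form (coeff m) x"
  shows "(\<lambda>m. \<beta> m x / c 0 m) \<longlonglongrightarrow> pullback_form V \<gamma> 0 x"
proof -
  note D = adapted_frameD[OF fr]
  obtain j0 where j0: "l j0 = 0" using D(2) by (metis atMost_iff imageE le0)
  have ratio: "(\<lambda>m. coeff m j / c 0 m) \<longlonglongrightarrow> (if l j = 0 then e j else 0)" for j
  proof (cases "l j = 0")
    case True
    have "c 0 m \<noteq> 0" for m using c_pos[of 0 m] by simp
    then show ?thesis using True by (simp add: coeff_def)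
  next
    case False
    then have "(\<lambda>m. e j * (c (l j) m / c 0 m)) \<longlonglongrightarrow> 0"
      using c_sep[of j0 j] j0 by (intro tendsto_mult_right_zero) simp
    then show ?thesis using False by (simp add: coeff_def)
  qed
  have "\<beta> m x / c 0 m = (\<Sum>j\<in>UNIV. coeff m j / c 0 m * ((matrix_inv (T m) *v x) $ j)\<^sup>2)" for m
    using form[of m "matrix_inv (T m) *v x"]
    by (simp add: matrix_inv_vector inv diag_form_def sum_divide_distrib)
  moreover have "(\<lambda>m. \<Sum>j\<in>UNIV. coeff m j / c 0 m * ((matrix_inv (T m) *v x) $ j)\<^sup>2) \<longlonglongrightarrow>
      (\<Sum>j\<in>UNIV. (if l j = 0 then e j else 0) * ((matrix_inv S *v x) $ j)\<^sup>2)"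
    by (intro tendsto_intros ratio tendsto_matrix_inv lim D)
  moreover have "(\<Sum>j\<in>UNIV. (if l j = 0 then e j else 0) * ((matrix_inv S *v x) $ j)\<^sup>2) =
      pullback_form V \<gamma> 0 x"
    using D(8)[of 0 x] V0 by (simp add: level_form_def diag_form_def)
  ultimately show ?thesis by simp
qed

end

lemma orthogonal_matrix_entry_le:
  fixes P :: "real^'n^'n"
  assumes "orthogonal_matrix P" shows "\<bar>P $ i $ j\<bar> \<le> 1"
proof -
  have "norm (P *v axis j 1) = 1"
    using assms orthogonal_transformation_matrix[of "(*v) P"]
    by (simp add: orthogonal_transformation_norm norm_axis_1)
  then show ?thesis using component_le_norm_cart[of "P *v axis j 1" i] by (simp add: matrix_axis_nth)
qed

lemma norm_matrix_le:
  fixes P :: "real^'n^'n"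
  assumes "\<And>i j. \<bar>P $ i $ j\<bar> \<le> 1"
  shows "norm P \<le> CARD('n) * CARD('n)"
proof -
  have "norm P \<le> (\<Sum>i\<in>UNIV. norm (P $ i))"
    unfolding norm_vec_def by (rule L2_set_le_sum) simp
  also have "\<dots> \<le> (\<Sum>i\<in>UNIV. \<Sum>j\<in>UNIV. \<bar>P $ i $ j\<bar>)"
    by (intro sum_mono norm_le_l1_cart)
  also have "\<dots> \<le> (\<Sum>i\<in>(UNIV :: 'n set). \<Sum>j\<in>(UNIV :: 'n set). 1)"
    by (intro sum_mono assms)
  finally show ?thesis by simp
qed

lemma orthogonal_diagonalization:
  fixes B :: "real^'n \<Rightarrow> real^'n \<Rightarrow> real"
  assumes bil: "bilinear B" and sym: "\<And>x y. B x y = B y x"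
    and nd: "\<And>x. (\<And>y. B x y = 0) \<Longrightarrow> x = 0"
  shows "\<exists>P d. orthogonal_matrix P \<and> (\<forall>j. d j \<noteq> 0) \<and> (\<forall>x. B (P *v x) (P *v x) = diag_form d x)"
proof -
  obtain T where T: "pairwise orthogonal T" "\<And>x. x \<in> T \<Longrightarrow> norm x = 1" "span T = UNIV"
    "\<And>x y. x \<in> T \<Longrightarrow> y \<in> T \<Longrightarrow> x \<noteq> y \<Longrightarrow> B x y = 0"
    using orthonormal_diagonalization[OF bil sym subspace_UNIV] by blast
  have "0 \<notin> T" using T(2) by fastforce
  then have indep: "independent T" using T(1) by (intro pairwise_orthogonal_independent)
  then have "card T = CARD('n)" using dim_eq_card[of T UNIV] T(3) by (simp add: DIM_cart)
  then obtain h where h: "bij_betw h (UNIV :: 'n set) T"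
    using finite_same_card_bij[of "UNIV :: 'n set" T] independent_imp_finite[OF indep] by auto
  then have hT: "h j \<in> T" and h_inj: "h i = h j \<longleftrightarrow> i = j" for i j
    by (auto simp: bij_betw_def inj_on_def)
  define P where "P = (\<chi> r j. h j $ r)"
  have P: "P *v x = (\<Sum>j\<in>UNIV. x $ j *\<^sub>R h j)" for x
    by (simp add: vec_eq_iff matrix_entry_expand P_def mult_ac)
  have "column j P = h j" for j by (simp add: column_def P_def)
  then have "orthogonal_matrix P"
    unfolding orthogonal_matrix_orthonormal_columns
    using T(1,2) hT h_inj by (auto simp: pairwise_def)
  moreover have Bh: "B (h i) (h j) = (if j = i then B (h i) (h i) else 0)" for i j
    using T(4)[OF hT hT, of i j] h_inj by auto
  have "B (P *v x) (P *v x) = diag_form (\<lambda>j. B (h j) (h j)) x" for x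
  proof -
    have "B (P *v x) (P *v x) = (\<Sum>i\<in>UNIV. \<Sum>j\<in>UNIV. x $ i * (x $ j * B (h i) (h j)))"
      unfolding P bilinear_sum[OF bil] by (simp add: bilinear_simps[OF bil] sum.cartesian_product mult_ac)
    also have "\<dots> = (\<Sum>i\<in>UNIV. B (h i) (h i) * (x $ i)\<^sup>2)"
      by (subst Bh) (simp add: if_distrib power2_eq_square mult_ac cong: if_cong)
    finally show ?thesis by (simp add: diag_form_def)
  qed
  moreover have "B (h j) (h j) \<noteq> 0" for j
  proof
    assume "B (h j) (h j) = 0"
    then have "B (h j) y = 0" if "y \<in> T" for y using T(4)[OF hT that] by (cases "y = h j") auto
    then have "B (h j) y = 0" for y
      using linear_eq_0_on_span[of "B (h j)" T y] bil T(3) by (simp add: bilinear_def)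
    then have "h j = 0" by (rule nd)
    then show False using T(2)[OF hT[of j]] by simp
  qed
  ultimately show ?thesis by (intro exI[of _ P] exI[of _ "\<lambda>j. B (h j) (h j)"]) auto
qed

lemma dense_rank:
  fixes f :: "'n::finite \<Rightarrow> nat"
  shows "\<exists>(l :: 'n \<Rightarrow> nat) k. range l = {..k} \<and> (\<forall>i j. l i < l j \<longleftrightarrow> f i < f j)"
proof -
  \<comment> \<open>The rank of a value among the values of f, counted from 0 without gaps.\<close>
  define h where "h v = card (range f \<inter> {..<v})" for v
  have mono: "h v \<le> h w" if "v \<le> w" for v w
    unfolding h_def using that by (intro card_mono) auto
  have strict: "h v < h w" if "v < w" "v \<in> range f" for v w
    unfolding h_def using that by (intro psubset_card_mono) auto
  have iff: "h (f i) < h (f j) \<longleftrightarrow> f i < f j" for i j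
    using mono[of "f j" "f i"] strict[of "f i" "f j"] by (auto simp: not_less[symmetric])
  have "inj_on h (range f)"
    by (rule inj_onI) (metis less_irrefl linorder_neqE_nat strict)
  then have card: "card (h ` range f) = card (range f)" by (rule card_image)
  have "range f \<inter> {..<f j} \<subset> range f" for j by auto
  then have "h (f j) < card (range f)" for j
    unfolding h_def by (intro psubset_card_mono) auto
  then have "h ` range f \<subseteq> {..<card (range f)}" by auto
  then have "h ` range f = {..<card (range f)}" using card by (intro card_subset_eq) auto
  moreover have "card (range f) > 0" by (simp add: card_gt_0_iff)
  then have "{..<card (range f)} = {..card (range f) - 1}" by auto
  ultimately have "range (h \<circ> f) = {..card (range f) - 1}" by (simp add: image_comp)
  then show ?thesis using iff by (intro exI[of _ "h \<circ> f"]) auto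
qed

section \<open>Normal form of a sequence of quadratic forms\<close>

definition diagonal_rescaling :: "('n \<Rightarrow> real) \<Rightarrow> real^'n^'n" where
  "diagonal_rescaling t = (\<chi> i j. if i = j then 1 / sqrt (t j) else 0)"

lemma diagonal_rescaling:
  assumes t: "\<And>j. t j > 0"
  shows "diag_form d (diagonal_rescaling t *v x) = diag_form (\<lambda>j. d j / t j) x"
    and "invertible (diagonal_rescaling t)"
proof -
  have vec: "(diagonal_rescaling t *v x) $ j = x $ j / sqrt (t j)" for x j
    by (simp add: diagonal_rescaling_def matrix_entry_expand if_distrib if_distribR cong: if_cong)
  show "diag_form d (diagonal_rescaling t *v x) = diag_form (\<lambda>j. d j / t j) x"
    unfolding diag_form_def using t by (intro sum.cong) (simp_all add: vec power_divide less_imp_le)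
  have "x = 0" if "diagonal_rescaling t *v x = 0" for x
  proof (simp only: vec_eq_iff, rule allI)
    fix j
    have "x $ j / sqrt (t j) = 0" using vec[of x j] that by simp
    then show "x $ j = 0 $ j" using t[of j] by simp
  qed
  then show "invertible (diagonal_rescaling t)" by (rule invertible_if_trivial_kernel)
qed

lemma ratio_identities:
  fixes x y :: real
  assumes "x > 0" "y > 0"
  shows "x / y = x / (x + y) / (1 - x / (x + y))" "x / (x + y) = x / y / (1 + x / y)"
proof -
  have "1 - x / (x + y) = y / (x + y)" using assms by (simp add: field_simps)
  then show "x / y = x / (x + y) / (1 - x / (x + y))" using assms by simp
  have "1 + x / y = (x + y) / y" using assms by (simp add: field_simps)
  then show "x / (x + y) = x / y / (1 + x / y)" using assms by simp
qed

text \<open>The level counts how many sizes dominate the given one, with gaps closed. Being negligible is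
  transitive and is inherited by comparable sizes, so two counts agree exactly when the sizes are comparable.
  The hypothesis uses the shares \<open>\<delta> i / (\<delta> i + \<delta> j)\<close> because they are bounded, unlike the quotients.\<close>
lemma levels_of_sizes:
  fixes \<delta> :: "nat \<Rightarrow> 'n::finite \<Rightarrow> real" and R :: "'n \<Rightarrow> 'n \<Rightarrow> real"
  assumes pos: "\<And>m j. \<delta> m j > 0" and lim: "\<And>i j. (\<lambda>m. \<delta> m i / (\<delta> m i + \<delta> m j)) \<longlonglongrightarrow> R i j"
  shows "\<exists>(l :: 'n \<Rightarrow> nat) k. range l = {..k} \<and>
    (\<forall>i j. l j < l i \<longrightarrow> (\<lambda>m. \<delta> m i / \<delta> m j) \<longlonglongrightarrow> 0) \<and>
    (\<forall>i j. l i = l j \<longrightarrow> (\<exists>a>0. (\<lambda>m. \<delta> m i / \<delta> m j) \<longlonglongrightarrow> a))"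
proof -
  have complement: "R j i = 1 - R i j" for i j
  proof -
    have "\<delta> m j / (\<delta> m j + \<delta> m i) = 1 - \<delta> m i / (\<delta> m i + \<delta> m j)" for m
      using pos[of m i] pos[of m j] by (simp add: field_simps)
    then have "(\<lambda>m. \<delta> m j / (\<delta> m j + \<delta> m i)) \<longlonglongrightarrow> 1 - R i j"
      using tendsto_diff[OF tendsto_const lim[of i j], of 1] by simp
    then show ?thesis using lim[of j i] LIMSEQ_unique by blast
  qed
  have R_nonneg: "R i j \<ge> 0" for i j
  proof (rule LIMSEQ_le_const[OF lim])
    have "0 \<le> \<delta> m i / (\<delta> m i + \<delta> m j)" for m
      using pos[of m i] pos[of m j] by simp
    then show "\<exists>N. \<forall>m\<ge>N. 0 \<le> \<delta> m i / (\<delta> m i + \<delta> m j)" by blast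
  qed
  have quotient_lim: "(\<lambda>m. \<delta> m i / \<delta> m j) \<longlonglongrightarrow> R i j / (1 - R i j)" if "R i j \<noteq> 1" for i j
  proof -
    have "(\<lambda>m. \<delta> m i / (\<delta> m i + \<delta> m j) / (1 - \<delta> m i / (\<delta> m i + \<delta> m j))) \<longlonglongrightarrow> R i j / (1 - R i j)"
      using that by (intro tendsto_intros lim) simp
    moreover have "\<delta> m i / \<delta> m j = \<delta> m i / (\<delta> m i + \<delta> m j) / (1 - \<delta> m i / (\<delta> m i + \<delta> m j))" for m
      by (rule ratio_identities(1)[OF pos pos])
    ultimately show ?thesis by (simp only:)
  qed
  have quotient_0: "(\<lambda>m. \<delta> m i / \<delta> m j) \<longlonglongrightarrow> 0 \<longleftrightarrow> R i j = 0" for i j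
  proof
    assume "(\<lambda>m. \<delta> m i / \<delta> m j) \<longlonglongrightarrow> 0"
    then have "(\<lambda>m. \<delta> m i / \<delta> m j / (1 + \<delta> m i / \<delta> m j)) \<longlonglongrightarrow> 0 / (1 + 0)"
      by (intro tendsto_intros) simp_all
    moreover have "\<delta> m i / (\<delta> m i + \<delta> m j) = \<delta> m i / \<delta> m j / (1 + \<delta> m i / \<delta> m j)" for m
      by (rule ratio_identities(2)[OF pos pos])
    ultimately have "(\<lambda>m. \<delta> m i / (\<delta> m i + \<delta> m j)) \<longlonglongrightarrow> 0 / (1 + 0)" by (simp only:)
    then have "(\<lambda>m. \<delta> m i / (\<delta> m i + \<delta> m j)) \<longlonglongrightarrow> 0" by simp
    then show "R i j = 0" using lim[of i j] LIMSEQ_unique by blast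
  qed (use quotient_lim[of i j] in simp)
  have chain: "(\<lambda>m. \<delta> m i / \<delta> m x) \<longlonglongrightarrow> a * 0"
    if "(\<lambda>m. \<delta> m i / \<delta> m j) \<longlonglongrightarrow> a" "(\<lambda>m. \<delta> m j / \<delta> m x) \<longlonglongrightarrow> 0" for i j x a
  proof -
    have "\<delta> m i / \<delta> m j * (\<delta> m j / \<delta> m x) = \<delta> m i / \<delta> m x" for m using pos[of m j] by simp
    with tendsto_mult[OF that] show ?thesis by (simp only:)
  qed
  \<comment> \<open>The number of sizes compared to which the i-th one is negligible.\<close>
  define f where "f i = card {x. R i x = 0}" for i
  have f_iff: "f j < f i \<longleftrightarrow> R i j = 0" for i j
  proof
    assume 0: "R i j = 0"
    have "{x. R j x = 0} \<subseteq> {x. R i x = 0}"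
      using chain[of i j 0] 0 by (auto simp flip: quotient_0)
    moreover have "R j j \<noteq> 0" using complement[of j j] by auto
    ultimately have "{x. R j x = 0} \<subset> {x. R i x = 0}" using 0 by blast
    then show "f j < f i" unfolding f_def by (intro psubset_card_mono) auto
  next
    assume "f j < f i"
    show "R i j = 0"
    proof (rule ccontr)
      assume "R i j \<noteq> 0"
      then have "R j i \<noteq> 1" using complement[of j i] by auto
      from quotient_lim[OF this] have "{x. R i x = 0} \<subseteq> {x. R j x = 0}"
        using chain[of j i "R j i / (1 - R j i)"] by (auto simp flip: quotient_0)
      then have "f i \<le> f j" unfolding f_def by (intro card_mono) auto
      with \<open>f j < f i\<close> show False by simp
    qed
  qed
  obtain l :: "'n \<Rightarrow> nat" and k where l: "range l = {..k}" "\<And>i j. l i < l j \<longleftrightarrow> f i < f j"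
    using dense_rank[of f] by blast
  have "\<exists>a>0. (\<lambda>m. \<delta> m i / \<delta> m j) \<longlonglongrightarrow> a" if "l i = l j" for i j
  proof -
    have "R i j \<noteq> 0" "R j i \<noteq> 0" using l(2) f_iff that by (metis less_irrefl)+
    then have "R i j > 0" "R i j < 1" using R_nonneg[of i j] R_nonneg[of j i] complement[of i j] by auto
    then show ?thesis using quotient_lim[of i j] by (intro exI[of _ "R i j / (1 - R i j)"]) auto
  qed
  then show ?thesis using l f_iff quotient_0 by (intro exI[of _ l] exI[of _ k]) auto
qed

text \<open>Orthogonal diagonalizations, the signs of the eigenvalues and the shares of their sizes
  subconverge together by compactness. Within a level the quotients of eigenvalues have positive limits,
  so a convergent diagonal rescaling makes them equal up to sign.\<close>
lemma forms_normal_form: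
  fixes B :: "nat \<Rightarrow> real^'n \<Rightarrow> real^'n \<Rightarrow> real"
  assumes bil: "\<And>m. bilinear (B m)" and sym: "\<And>m x y. B m x y = B m y x"
    and nd: "\<And>m x. (\<And>y. B m x y = 0) \<Longrightarrow> x = 0"
  shows "\<exists>r (S :: real^'n^'n) T l e k c. strict_mono r \<and> invertible S \<and> T \<longlonglongrightarrow> S \<and> (\<forall>m. invertible (T m)) \<and>
    range l = {..k} \<and> (\<forall>j. e j = 1 \<or> e j = - 1) \<and> separating_scales l e c \<and>
    (\<forall>m x. B (r m) (T m *v x) (T m *v x) = diag_form (separating_scales.coeff l e c m) x)"
proof -
  have "\<exists>P d. orthogonal_matrix P \<and> (\<forall>j. d j \<noteq> 0) \<and> (\<forall>x. B m (P *v x) (P *v x) = diag_form d x)" for m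
    by (rule orthogonal_diagonalization[OF bil sym]) (rule nd)
  then obtain P d where P: "\<And>m. orthogonal_matrix (P m)" and d_nz: "\<And>m j. d m j \<noteq> 0"
    and BP: "\<And>m x. B m (P m *v x) (P m *v x) = diag_form (d m) x"
    by metis
  define \<rho> where "\<rho> m = (\<chi> i j. \<bar>d m i\<bar> / (\<bar>d m i\<bar> + \<bar>d m j\<bar>))" for m
  \<comment> \<open>The signs are stored in a matrix with constant rows, so that one bound serves for all three sequences.\<close>
  define \<sigma> where "\<sigma> m = (\<chi> i j :: 'n. sgn (d m i))" for m
  define C where "C = cball (0 :: real^'n^'n) (CARD('n) * CARD('n))"
  have "P m \<in> C" for m
    unfolding C_def using norm_matrix_le[OF orthogonal_matrix_entry_le[OF P]] by simp
  moreover have "\<rho> m \<in> C" for m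
  proof -
    have "\<bar>\<rho> m $ i $ j\<bar> \<le> 1" for i j
    proof -
      have "0 \<le> \<rho> m $ i $ j" "\<rho> m $ i $ j \<le> 1"
        using d_nz[of m i] by (simp_all add: \<rho>_def divide_le_eq_1 add_pos_nonneg)
      then show ?thesis by (simp only: abs_of_nonneg)
    qed
    then show ?thesis unfolding C_def using norm_matrix_le[of "\<rho> m"] by simp
  qed
  moreover have "\<sigma> m \<in> C" for m
  proof -
    have "\<bar>\<sigma> m $ i $ j\<bar> \<le> 1" for i j by (simp add: \<sigma>_def abs_sgn_eq)
    then show ?thesis unfolding C_def using norm_matrix_le[of "\<sigma> m"] by simp
  qed
  ultimately have "range (\<lambda>m. (P m, \<rho> m, \<sigma> m)) \<subseteq> C \<times> (C \<times> C)" by auto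
  moreover have "bounded (C \<times> (C \<times> C))" unfolding C_def by (intro bounded_Times bounded_cball)
  ultimately have "bounded (range (\<lambda>m. (P m, \<rho> m, \<sigma> m)))" by (rule bounded_subset[rotated])
  then obtain L r0 where r0: "strict_mono r0" "((\<lambda>m. (P m, \<rho> m, \<sigma> m)) \<circ> r0) \<longlonglongrightarrow> L"
    using bounded_imp_convergent_subsequence by blast
  obtain P' \<rho>' \<sigma>' where L: "L = (P', \<rho>', \<sigma>')" by (metis prod_cases3)
  have lims: "(\<lambda>m. P (r0 m)) \<longlonglongrightarrow> P'" "(\<lambda>m. \<rho> (r0 m)) \<longlonglongrightarrow> \<rho>'" "(\<lambda>m. \<sigma> (r0 m)) \<longlonglongrightarrow> \<sigma>'"
    using tendsto_fst[OF r0(2)] tendsto_fst[OF tendsto_snd[OF r0(2)]] tendsto_snd[OF tendsto_snd[OF r0(2)]]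
    by (simp_all add: L comp_def)
  define e where "e j = \<sigma>' $ j $ j" for j
  have sgn_lim: "(\<lambda>m. sgn (d (r0 m) j)) \<longlonglongrightarrow> e j" for j
    using tendsto_vec_nth[OF tendsto_vec_nth[OF lims(3)], of j j] by (simp add: \<sigma>_def e_def)
  have "\<forall>\<^sub>F m in sequentially. \<forall>j. sgn (d (r0 m) j) = e j \<and> (e j = 1 \<or> e j = - 1)"
  proof (rule eventually_all_finite)
    fix j
    have "(\<lambda>m. \<bar>sgn (d (r0 m) j)\<bar>) \<longlonglongrightarrow> \<bar>e j\<bar>" by (intro tendsto_rabs sgn_lim)
    then have "\<bar>e j\<bar> = 1" using d_nz LIMSEQ_unique[OF _ tendsto_const[of 1]] by (simp add: abs_sgn_eq)
    moreover have "\<forall>\<^sub>F m in sequentially. dist (sgn (d (r0 m) j)) (e j) < 1"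
      using tendstoD[OF sgn_lim[of j], of 1] by simp
    ultimately show "\<forall>\<^sub>F m in sequentially. sgn (d (r0 m) j) = e j \<and> (e j = 1 \<or> e j = - 1)"
      by (elim eventually_mono) (use d_nz in \<open>auto simp: sgn_real_def dist_real_def split: if_splits\<close>)
  qed
  then obtain N where N: "\<And>m j. N \<le> m \<Longrightarrow> sgn (d (r0 m) j) = e j" "\<And>j. e j = 1 \<or> e j = - 1"
    unfolding eventually_sequentially by blast
  \<comment> \<open>From N on the signs have their limit values.\<close>
  define r where "r m = r0 (m + N)" for m
  have r: "strict_mono r" using r0(1) by (auto simp: r_def strict_mono_def)
  have sgn_d: "sgn (d (r m) j) = e j" for m j using N(1) by (simp add: r_def)
  have P_lim: "(\<lambda>m. P (r m)) \<longlonglongrightarrow> P'" using LIMSEQ_ignore_initial_segment[OF lims(1)] by (simp add: r_def)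
  have \<rho>_lim: "(\<lambda>m. \<bar>d (r m) i\<bar> / (\<bar>d (r m) i\<bar> + \<bar>d (r m) j\<bar>)) \<longlonglongrightarrow> \<rho>' $ i $ j" for i j
    using LIMSEQ_ignore_initial_segment[OF tendsto_vec_nth[OF tendsto_vec_nth[OF lims(2), of i], of j], of N]
    by (simp add: r_def \<rho>_def)
  define \<delta> where "\<delta> m j = \<bar>d (r m) j\<bar>" for m j
  have \<delta>_pos: "\<delta> m j > 0" for m j using d_nz by (simp add: \<delta>_def)
  obtain l :: "'n \<Rightarrow> nat" and k where l: "range l = {..k}"
    "\<And>i j. l j < l i \<Longrightarrow> (\<lambda>m. \<delta> m i / \<delta> m j) \<longlonglongrightarrow> 0"
    "\<And>i j. l i = l j \<Longrightarrow> \<exists>a>0. (\<lambda>m. \<delta> m i / \<delta> m j) \<longlonglongrightarrow> a"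
    using levels_of_sizes[of \<delta> "\<lambda>i j. \<rho>' $ i $ j"] \<delta>_pos \<rho>_lim unfolding \<delta>_def by blast
  \<comment> \<open>The size of a level is that of one of its eigenvalues.\<close>
  define rep where "rep i = (SOME j. l j = i)" for i
  have rep: "l (rep (l j)) = l j" for j unfolding rep_def by (rule someI[of _ j]) simp
  define c where "c i m = \<delta> m (rep i)" for i m
  interpret separating_scales l e c
  proof
    show "e j \<noteq> 0" for j using N(2)[of j] by auto
    show "c i m > 0" for i m by (simp add: c_def \<delta>_pos)
    show "(\<lambda>m. c (l k) m / c (l j) m) \<longlonglongrightarrow> 0" if "l j < l k" for j k
      unfolding c_def using that by (intro l(2)) (simp add: rep)
  qed
  have "\<forall>j. \<exists>a>0. (\<lambda>m. \<delta> m j / c (l j) m) \<longlonglongrightarrow> a"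
    unfolding c_def using l(3) rep by metis
  then obtain a where a: "\<And>j. a j > 0" "\<And>j. (\<lambda>m. \<delta> m j / c (l j) m) \<longlonglongrightarrow> a j" by metis
  have P_inv: "invertible Q" if "orthogonal_matrix Q" for Q :: "real^'n^'n"
    using that unfolding orthogonal_matrix_def invertible_def by blast
  have "orthogonal_matrix P'"
  proof -
    have "(\<lambda>m. transpose (P (r m)) ** P (r m)) \<longlonglongrightarrow> transpose P' ** P'"
      unfolding transpose_def by (intro tendsto_intros P_lim)
    moreover have "transpose (P (r m)) ** P (r m) = mat 1" for m
      using P by (simp add: orthogonal_matrix)
    ultimately show ?thesis by (simp add: orthogonal_matrix LIMSEQ_const_iff)
  qed
  define T where "T m = P (r m) ** diagonal_rescaling (\<lambda>j. \<delta> m j / c (l j) m)" for m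
  define S where "S = P' ** diagonal_rescaling a"
  have "T \<longlonglongrightarrow> S"
  proof -
    have "(\<lambda>m. diagonal_rescaling (\<lambda>j. \<delta> m j / c (l j) m)) \<longlonglongrightarrow> diagonal_rescaling a"
    proof (rule vec_tendstoI, rule vec_tendstoI)
      fix i j
      have "(\<lambda>m. 1 / sqrt (\<delta> m j / c (l j) m)) \<longlonglongrightarrow> 1 / sqrt (a j)"
        using a(1)[of j] by (intro tendsto_intros a(2)) simp
      then show "(\<lambda>m. diagonal_rescaling (\<lambda>j. \<delta> m j / c (l j) m) $ i $ j) \<longlonglongrightarrow> diagonal_rescaling a $ i $ j"
        by (cases "i = j") (simp_all add: diagonal_rescaling_def)
    qed
    then show ?thesis unfolding T_def S_def by (intro tendsto_intros P_lim)
  qed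
  moreover have "invertible S"
    unfolding S_def by (intro invertible_mult P_inv diagonal_rescaling(2) \<open>orthogonal_matrix P'\<close> a)
  moreover have "invertible (T m)" for m
    unfolding T_def by (intro invertible_mult P_inv diagonal_rescaling(2) P divide_pos_pos \<delta>_pos c_pos)
  moreover have "B (r m) (T m *v x) (T m *v x) = diag_form (coeff m) x" for m x
  proof -
    have "B (r m) (T m *v x) (T m *v x) = diag_form (d (r m)) (diagonal_rescaling (\<lambda>j. \<delta> m j / c (l j) m) *v x)"
      by (simp add: T_def BP flip: matrix_vector_mul_assoc)
    also have "\<dots> = diag_form (\<lambda>j. d (r m) j / (\<delta> m j / c (l j) m)) x"
      by (intro diagonal_rescaling divide_pos_pos \<delta>_pos c_pos)
    also have "(\<lambda>j. d (r m) j / (\<delta> m j / c (l j) m)) = coeff m"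
    proof (rule ext)
      fix j
      have "d (r m) j = e j * \<delta> m j" using sgn_d[of m j] by (metis \<delta>_def sgn_mult_abs)
      then show "d (r m) j / (\<delta> m j / c (l j) m) = coeff m j"
        using \<delta>_pos[of m j] by (simp add: coeff_def)
    qed
    finally show ?thesis .
  qed
  ultimately have "strict_mono r \<and> invertible S \<and> T \<longlonglongrightarrow> S \<and> (\<forall>m. invertible (T m)) \<and>
    range l = {..k} \<and> (\<forall>j. e j = 1 \<or> e j = - 1) \<and> separating_scales l e c \<and>
    (\<forall>m x. B (r m) (T m *v x) (T m *v x) = diag_form (coeff m) x)"
    using r l(1) N(2) separating_scales_axioms by simp
  then show ?thesis
    by - (rule exI[of _ r], rule exI[of _ S], rule exI[of _ T], rule exI[of _ l],
        rule exI[of _ e], rule exI[of _ k], rule exI[of _ c])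
qed

section \<open>Invariant subspaces of the flag isometry group\<close>

lemma Isom_flag_of_coordinates:
  fixes f g :: "real^'n \<Rightarrow> real^'n"
  assumes fr: "adapted_frame k V \<gamma> S l e" and lin: "linear f" "linear g" and fg: "\<And>z. f (g z) = z"
    and lev: "\<And>i z. z \<in> level_space l i \<Longrightarrow> f z \<in> level_space l i"
    and form: "\<And>i z. z \<in> level_space l i \<Longrightarrow> level_form l e i (f z) = level_form l e i z"
  shows "\<exists>A\<in>Isom_flag k V \<gamma>. \<forall>z. A *v (S *v z) = S *v f z"
proof -
  note D = adapted_frameD[OF fr]
  obtain E where E: "\<And>z. E *v z = f z" using matrix_of_linear[OF lin(1)] by blast
  obtain G where G: "\<And>z. G *v z = g z" using matrix_of_linear[OF lin(2)] by blast
  have "E ** G = mat 1" by (simp add: matrix_eq E G fg flip: matrix_vector_mul_assoc)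
  then have inv: "invertible E" unfolding invertible_right_inverse by blast
  define A where "A = S ** E ** matrix_inv S"
  have "matrix_inv S ** A ** S = E"
    by (simp add: A_def matrix_inv_cancel(2)[OF D(1)] matrix_inv_left[OF D(1)] flip: matrix_mul_assoc)
  moreover have "flag_similarity l e 1 E" unfolding flag_similarity_def by (simp add: E lev form)
  moreover have "invertible A" unfolding A_def by (intro invertible_mult inv D(1) invertible_matrix_inv)
  ultimately have "A \<in> Isom_flag k V \<gamma>" using Isom_flag_iff_frame[OF fr] by simp
  moreover have "A *v (S *v z) = S *v f z" for z
    by (simp add: A_def matrix_inv_vector[OF D(1)] E flip: matrix_vector_mul_assoc)
  ultimately show ?thesis by blast
qed

lemma linear_vec_lambda:
  fixes f :: "'m::finite \<Rightarrow> real^'n \<Rightarrow> real"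
  assumes "\<And>a. linear (f a)"
  shows "linear (\<lambda>z. \<chi> a. f a z)"
  using assms by (simp add: linear_iff vec_eq_iff)

definition sign_change :: "'n \<Rightarrow> real^'n \<Rightarrow> real^'n" where
  "sign_change j z = (\<chi> a. if a = j then - z $ a else z $ a)"

definition shear :: "'n \<Rightarrow> 'n \<Rightarrow> real^'n \<Rightarrow> real^'n" where
  "shear j i z = (\<chi> a. if a = i then z $ a + z $ j else z $ a)"

text \<open>A reflection of the plane of the coordinates \<open>i\<close> and \<open>j\<close>, in which \<open>w = e i * e j\<close> is the
  relative sign of the form: Euclidean for \<open>w = 1\<close>, Lorentzian for \<open>w = - 1\<close>; here
  \<open>a\<^sup>2 + w b\<^sup>2 = 1\<close>.\<close>
definition plane_reflection :: "real \<Rightarrow> 'n \<Rightarrow> 'n \<Rightarrow> real^'n \<Rightarrow> real^'n" where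
  "plane_reflection w j i z = (let a = (if w = 1 then 3/5 else 5/3); b = (if w = 1 then 4/5 else 4/3) in
     \<chi> r. if r = j then a * z $ j + w * b * z $ i else if r = i then b * z $ j - a * z $ i else z $ r)"

lemma sign_change_Isom:
  assumes fr: "adapted_frame k V \<gamma> S l e"
  shows "\<exists>A\<in>Isom_flag k V \<gamma>. \<forall>z. A *v (S *v z) = S *v sign_change j z"
proof (rule Isom_flag_of_coordinates[OF fr, where g = "sign_change j"])
  show "linear (sign_change j)"
    unfolding sign_change_def[abs_def] by (rule linear_vec_lambda) (auto simp: linear_iff)
  then show "linear (sign_change j)" .
  show "sign_change j (sign_change j z) = z" for z by (simp add: sign_change_def vec_eq_iff)
  show "sign_change j z \<in> level_space l i" if "z \<in> level_space l i" for i z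
    using that by (auto simp: level_space_def sign_change_def)
  show "level_form l e i (sign_change j z) = level_form l e i z" for i z
    unfolding level_form_eq by (intro sum.cong) (auto simp: sign_change_def)
qed

lemma shear_Isom:
  fixes S :: "real^'n^'n"
  assumes fr: "adapted_frame k V \<gamma> S l e" and ji: "l j < l i"
  shows "\<exists>A\<in>Isom_flag k V \<gamma>. \<forall>z. A *v (S *v z) = S *v shear j i z"
proof (rule Isom_flag_of_coordinates[OF fr, where g = "\<lambda>z :: real^'n. \<chi> a. if a = i then z $ a - z $ j else z $ a"])
  show "linear (shear j i)"
    unfolding shear_def[abs_def] by (rule linear_vec_lambda) (auto simp: linear_iff algebra_simps)
  show "linear (\<lambda>z :: real^'n. \<chi> a. if a = i then z $ a - z $ j else z $ a)"
    by (rule linear_vec_lambda) (auto simp: linear_iff algebra_simps)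
  show "shear j i (\<chi> a. if a = i then z $ a - z $ j else z $ a) = z" for z
    using ji by (auto simp: shear_def vec_eq_iff)
  show "shear j i z \<in> level_space l r" if "z \<in> level_space l r" for r z
    using that ji by (auto simp: level_space_def shear_def)
  show "level_form l e r (shear j i z) = level_form l e r z" if "z \<in> level_space l r" for r z
    unfolding level_form_eq using that ji by (intro sum.cong) (auto simp: shear_def level_space_def)
qed

lemma plane_reflection_Isom:
  assumes fr: "adapted_frame k V \<gamma> S l e" and ji: "l j = l i" "j \<noteq> i"
  shows "\<exists>A\<in>Isom_flag k V \<gamma>. \<forall>z. A *v (S *v z) = S *v plane_reflection (e j * e i) j i z"
proof (rule Isom_flag_of_coordinates[OF fr, where g = "plane_reflection (e j * e i) j i"])
  define w where "w = e j * e i"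
  have ee: "e j = 1 \<or> e j = - 1" "e i = 1 \<or> e i = - 1" using adapted_frameD(4)[OF fr] by auto
  define a where "a = (if w = 1 then 3/5 else 5/3 :: real)"
  define b where "b = (if w = 1 then 4/5 else 4/3 :: real)"
  have ab: "a * a + w * b * b = 1" "w * w = 1" "e j * w = e i" "e i * w = e j"
    using ee by (auto simp: a_def b_def w_def)
  have pr: "plane_reflection w j i z = (\<chi> r. if r = j then a * z $ j + w * b * z $ i
      else if r = i then b * z $ j - a * z $ i else z $ r)" for z
    unfolding plane_reflection_def Let_def a_def b_def ..
  show "linear (plane_reflection (e j * e i) j i)"
    unfolding w_def[symmetric] pr[abs_def] by (rule linear_vec_lambda) (auto simp: linear_iff algebra_simps)
  then show "linear (plane_reflection (e j * e i) j i)" .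
  show "plane_reflection (e j * e i) j i (plane_reflection (e j * e i) j i z) = z" for z
  proof -
    have "a * (a * z $ j + w * b * z $ i) + w * b * (b * z $ j - a * z $ i) = (a * a + w * b * b) * z $ j"
      "b * (a * z $ j + w * b * z $ i) - a * (b * z $ j - a * z $ i) = (a * a + w * b * b) * z $ i"
      by (simp_all add: algebra_simps)
    then show ?thesis unfolding w_def[symmetric] pr using ji by (auto simp: vec_eq_iff ab)
  qed
  show "plane_reflection (e j * e i) j i z \<in> level_space l r" if "z \<in> level_space l r" for r z
    unfolding w_def[symmetric] pr using that ji by (auto simp: level_space_def)
  show "level_form l e r (plane_reflection (e j * e i) j i z) = level_form l e r z" for r z
  proof (cases "r = l j")
    case True
    define y where "y = plane_reflection w j i z"
    have y: "y $ j = a * z $ j + w * b * z $ i" "y $ i = b * z $ j - a * z $ i"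
      "\<And>q. q \<noteq> j \<Longrightarrow> q \<noteq> i \<Longrightarrow> y $ q = z $ q"
      using ji by (simp_all add: y_def pr)
    have "e j * (y $ j)\<^sup>2 + e i * (y $ i)\<^sup>2 =
      e j * ((a * z $ j + w * b * z $ i)\<^sup>2 + w * (b * z $ j - a * z $ i)\<^sup>2)"
      unfolding y using ab(3) by (simp add: distrib_left flip: mult.assoc)
    also have "(a * z $ j + w * b * z $ i)\<^sup>2 + w * (b * z $ j - a * z $ i)\<^sup>2 =
      (a * a + w * b * b) * (z $ j)\<^sup>2 + w * (a * a + w * b * b) * (z $ i)\<^sup>2"
      by (simp add: power2_eq_square algebra_simps)
    finally have two: "e j * (y $ j)\<^sup>2 + e i * (y $ i)\<^sup>2 = e j * (z $ j)\<^sup>2 + e i * (z $ i)\<^sup>2"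
      using ab(3) by (simp add: ab(1) distrib_left flip: mult.assoc)
    define L where "L = {q. l q = l j} - {j, i}"
    have split: "{q. l q = r} = insert j (insert i L)" "j \<notin> insert i L" "i \<notin> L"
      using ji True by (auto simp: L_def)
    have "(\<Sum>q\<in>L. e q * (y $ q)\<^sup>2) = (\<Sum>q\<in>L. e q * (z $ q)\<^sup>2)"
      by (intro sum.cong) (auto simp: L_def y(3))
    then have "level_form l e r y = level_form l e r z"
      unfolding level_form_eq split(1) using split(2,3) two by simp
    then show ?thesis by (simp add: y_def w_def)
  next
    case False
    then show ?thesis
      unfolding level_form_eq w_def[symmetric] pr using ji by (intro sum.cong) auto
  qed
qed

text \<open>Sign changes make an invariant subspace a coordinate subspace; reflections and shears move a
  coordinate vector to all others of the same or a higher level.\<close>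
lemma invariant_subspace_of_flag:
  assumes fr: "adapted_frame k V \<gamma> S l e" and sub: "subspace U"
    and invar: "\<And>A x. A \<in> Isom_flag k V \<gamma> \<Longrightarrow> x \<in> U \<Longrightarrow> A *v x \<in> U"
  shows "\<exists>i\<le>Suc k. U = V i"
proof -
  note D = adapted_frameD[OF fr]
  define J where "J = {j. S *v axis j 1 \<in> U}"
  have coord: "j \<in> J" if z: "S *v z \<in> U" "z $ j \<noteq> 0" for z j
  proof -
    obtain A where A: "A \<in> Isom_flag k V \<gamma>" "\<And>z. A *v (S *v z) = S *v sign_change j z"
      using sign_change_Isom[OF fr] by blast
    have "S *v z - S *v sign_change j z \<in> U"
      using z invar[OF A(1) z(1)] sub A(2) by (simp add: subspace_diff)
    moreover have "S *v z - S *v sign_change j z = (2 * z $ j) *\<^sub>R (S *v axis j 1)"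
      unfolding matrix_vector_mult_diff_distrib[symmetric] matrix_vector_mult_scaleR[symmetric]
      by (rule arg_cong[of _ _ "(*v) S"]) (simp add: vec_eq_iff sign_change_def axis_def)
    ultimately have "(1 / (2 * z $ j)) *\<^sub>R ((2 * z $ j) *\<^sub>R (S *v axis j 1)) \<in> U"
      using sub by (metis subspace_scale)
    then show ?thesis using z(2) by (simp add: J_def)
  qed
  have up: "i \<in> J" if j: "j \<in> J" and ji: "l j \<le> l i" for i j
  proof (cases "i = j")
    case False
    show ?thesis
    proof (cases "l j = l i")
      case True
      obtain A where A: "A \<in> Isom_flag k V \<gamma>" "\<And>z. A *v (S *v z) = S *v plane_reflection (e j * e i) j i z"
        using plane_reflection_Isom[OF fr True] False by blast
      have "plane_reflection (e j * e i) j i (axis j 1) $ i \<noteq> 0"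
        using False by (simp add: plane_reflection_def Let_def axis_def)
      moreover have "S *v plane_reflection (e j * e i) j i (axis j 1) \<in> U"
        using invar[OF A(1)] j A(2) by (fastforce simp: J_def)
      ultimately show ?thesis by (rule coord[rotated])
    next
      case neq: False
      then obtain A where A: "A \<in> Isom_flag k V \<gamma>" "\<And>z. A *v (S *v z) = S *v shear j i z"
        using shear_Isom[OF fr, of j i] ji by force
      have "shear j i (axis j 1) $ i \<noteq> 0" using False by (simp add: shear_def axis_def)
      moreover have "S *v shear j i (axis j 1) \<in> U"
        using invar[OF A(1)] j A(2) by (fastforce simp: J_def)
      ultimately show ?thesis by (rule coord[rotated])
    qed
  qed (use j in simp)
  define i where "i = Min (insert (Suc k) (l ` J))"
  have i: "i \<le> Suc k" by (simp add: i_def)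
  have J: "j \<in> J \<longleftrightarrow> i \<le> l j" for j
  proof
    assume "i \<le> l j"
    then have "i \<noteq> Suc k" using D(3)[of j] by auto
    moreover have "i \<in> insert (Suc k) (l ` J)" unfolding i_def by (rule Min_in) auto
    ultimately obtain j' where "j' \<in> J" "l j' = i" by auto
    then show "j \<in> J" using up \<open>i \<le> l j\<close> by blast
  qed (auto simp: i_def)
  have "U = (*v) S ` level_space l i"
  proof
    show "U \<subseteq> (*v) S ` level_space l i"
    proof
      fix x assume x: "x \<in> U"
      define z where "z = matrix_inv S *v x"
      have Sz: "S *v z = x" by (simp add: z_def matrix_inv_vector D(1))
      then have "z \<in> level_space l i" using coord[of z] x J by (force simp: level_space_def)
      then show "x \<in> (*v) S ` level_space l i" using Sz by blast
    qed
    show "(*v) S ` level_space l i \<subseteq> U"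
    proof (rule image_subsetI)
      fix z assume z: "z \<in> level_space l i"
      have "z = (\<Sum>j\<in>UNIV. z $ j *\<^sub>R axis j 1)"
        by (simp add: vec_eq_iff axis_def if_distrib cong: if_cong)
      then have "S *v z = (\<Sum>j\<in>UNIV. z $ j *\<^sub>R (S *v axis j 1))"
        by (metis (no_types, lifting) linear_sum matrix_vector_mult_scaleR matrix_vector_mul_linear sum.cong)
      moreover have "z $ j *\<^sub>R (S *v axis j 1) \<in> U" for j
      proof (cases "i \<le> l j")
        case True
        then show ?thesis using J sub by (auto simp: J_def intro: subspace_scale)
      next
        case False
        then show ?thesis using z sub by (simp add: level_space_def subspace_0)
      qed
      ultimately show "S *v z \<in> U" using sub by (simp add: subspace_sum)
    qed
  qed
  then show ?thesis using D(5)[OF i] i by blast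
qed

section \<open>The flag and its forms are determined by their isometries\<close>

lemma partial_flag_strict:
  assumes pf: "partial_flag k V" and "i < i'" "i' \<le> Suc k" shows "V i' \<subset> V i"
proof -
  have "V i' \<subseteq> V (Suc i)" using partial_flag_antimono[OF pf, of "Suc i" i'] assms by simp
  moreover have "V (Suc i) \<subset> V i" using pf assms by (simp add: partial_flag_def)
  ultimately show ?thesis by blast
qed

text \<open>The index of a member of the flag is the number of members that strictly contain it.\<close>
lemma partial_flag_unique:
  assumes pf: "partial_flag k V" "partial_flag k' V'" and eq: "V ` {..Suc k} = V' ` {..Suc k'}"
  shows "k = k'" "\<And>i. i \<le> Suc k \<Longrightarrow> V i = V' i"
proof -
  have rank: "card {W \<in> V ` {..Suc k}. V i \<subset> W} = i"
    if pf: "partial_flag k V" and i: "i \<le> Suc k" for k i and V :: "nat \<Rightarrow> (real^'n) set"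
  proof -
    have inj: "inj_on V {..Suc k}"
      by (rule linorder_inj_onI') (use partial_flag_strict[OF pf] in fastforce)
    have iff: "V i \<subset> V i' \<longleftrightarrow> i' < i" if "i' \<le> Suc k" for i'
      using partial_flag_strict[OF pf, of i' i] partial_flag_antimono[OF pf, of i i'] i that
      by (cases "i' < i") auto
    have "{W \<in> V ` {..Suc k}. V i \<subset> W} = V ` {i' \<in> {..Suc k}. V i \<subset> V i'}" by blast
    also have "{i' \<in> {..Suc k}. V i \<subset> V i'} = {i' \<in> {..Suc k}. i' < i}"
      by (rule Collect_cong) (use iff in blast)
    also have "\<dots> = {..<i}" using i by auto
    finally have "{W \<in> V ` {..Suc k}. V i \<subset> W} = V ` {..<i}" .
    moreover have "inj_on V {..<i}" using i by (intro inj_on_subset[OF inj]) auto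
    ultimately show ?thesis by (simp add: card_image)
  qed
  have strict: "card (V ` {..Suc k}) = Suc (Suc k)"
    if pf: "partial_flag k V" for k and V :: "nat \<Rightarrow> (real^'n) set"
    by (subst card_image) (auto intro!: linorder_inj_onI' dest: partial_flag_strict[OF pf])
  show "k = k'" using strict[OF pf(1)] strict[OF pf(2)] eq by simp
  show "V i = V' i" if i: "i \<le> Suc k" for i
  proof -
    have "V i \<in> V' ` {..Suc k'}" using i eq by blast
    then obtain j where "j \<le> Suc k'" "V i = V' j" by auto
    then show ?thesis using rank[OF pf(1) i] rank[OF pf(2), of j] eq by simp
  qed
qed

lemma P_Isom_subset_scaled:
  assumes "P_Isom k V \<gamma> \<subseteq> P_Isom k' V' \<gamma>'" "A \<in> Isom_flag k V \<gamma>"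
  shows "\<exists>c. c \<noteq> 0 \<and> c *\<^sub>R A \<in> Isom_flag k' V' \<gamma>'"
proof -
  have "pgl_class A \<in> P_Isom k' V' \<gamma>'" using assms by (auto simp: P_Isom_def)
  then obtain A' where A': "A' \<in> Isom_flag k' V' \<gamma>'" "pgl_class A = pgl_class A'"
    by (auto simp: P_Isom_def)
  moreover have "invertible A" "invertible A'" using assms A' by (auto simp: Isom_flag_def)
  ultimately show ?thesis using pgl_class_eq_iff[of A A'] by auto
qed

text \<open>The members of the second flag are invariant under its group, hence under the first one, whose
  invariant subspaces are the members of its flag.\<close>
lemma P_Isom_subset_flag:
  assumes pf: "partial_flag k V" and ff: "flag_of_forms k V \<gamma>" and pf': "partial_flag k' V'"
    and sub: "P_Isom k V \<gamma> \<subseteq> P_Isom k' V' \<gamma>'"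
  shows "V' ` {..Suc k'} \<subseteq> V ` {..Suc k}"
proof (rule image_subsetI)
  fix i assume i: "i \<in> {..Suc k'}"
  obtain S l e where fr: "adapted_frame k V \<gamma> S l e" using adapted_frame_exists[OF pf ff] by blast
  have subV': "subspace (V' i)" using partial_flag_subspace[OF pf'] i by simp
  have "A *v x \<in> V' i" if A: "A \<in> Isom_flag k V \<gamma>" and x: "x \<in> V' i" for A x
  proof -
    obtain c where c: "c \<noteq> 0" "c *\<^sub>R A \<in> Isom_flag k' V' \<gamma>'"
      using P_Isom_subset_scaled[OF sub A] by blast
    then have "(*v) (c *\<^sub>R A) ` V' i = V' i" using i by (simp add: Isom_flag_def)
    then have "c *\<^sub>R (A *v x) \<in> V' i"
      using x by (metis imageI scaleR_matrix_vector_assoc)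
    then have "(1 / c) *\<^sub>R (c *\<^sub>R (A *v x)) \<in> V' i" by (rule subspace_scale[OF subV'])
    then show ?thesis using c by simp
  qed
  from invariant_subspace_of_flag[OF fr subV' this] show "V' i \<in> V ` {..Suc k}" by auto
qed

text \<open>Involutive isometries of \<open>\<gamma>\<close> preserve \<open>\<gamma>'\<close> exactly, since their scaling factor squares to 1.
  Sign changes then make the frame orthogonal for \<open>\<gamma>'\<close>, and plane reflections make the values of
  \<open>\<gamma>'\<close> on it proportional to those of \<open>\<gamma>\<close>.\<close>
lemma P_Isom_determines_flag:
  assumes pf: "partial_flag k V" and ff: "flag_of_forms k V \<gamma>"
    and pf': "partial_flag k' V'" and ff': "flag_of_forms k' V' \<gamma>'"
    and eq: "P_Isom k V \<gamma> = P_Isom k' V' \<gamma>'"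
  shows "k = k'" and "\<And>i. i \<le> Suc k \<Longrightarrow> V i = V' i"
    and "\<And>i. i \<le> k \<Longrightarrow> \<exists>c. c \<noteq> 0 \<and> (\<forall>x\<in>V i. pullback_form V' \<gamma>' i x = c * pullback_form V \<gamma> i x)"
proof -
  have "V ` {..Suc k} = V' ` {..Suc k'}"
    using P_Isom_subset_flag[OF pf ff pf', of \<gamma>'] P_Isom_subset_flag[OF pf' ff' pf, of \<gamma>] eq by blast
  from partial_flag_unique[OF pf pf' this]
  show k: "k = k'" and V: "\<And>i. i \<le> Suc k \<Longrightarrow> V i = V' i" .
  fix i assume i: "i \<le> k"
  obtain S l e where fr: "adapted_frame k V \<gamma> S l e" using adapted_frame_exists[OF pf ff] by blast
  note D = adapted_frameD[OF fr]
  have i': "i \<le> k'" and V'_eq: "V' i = V i" "V' (Suc i) = V (Suc i)" using i k V[of i] V[of "Suc i"] by simp_all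
  define Q where "Q = pullback_form V' \<gamma>' i"
  obtain B where bil: "bilinear B" and sym: "\<And>x y. B x y = B y x"
    and Q: "\<And>x. x \<in> V i \<Longrightarrow> Q x = B x x"
    and rad: "\<And>x w. x \<in> V i \<Longrightarrow> w \<in> V (Suc i) \<Longrightarrow> B x w = 0"
    and nd: "\<And>x. x \<in> V i \<Longrightarrow> (\<And>y. y \<in> V i \<Longrightarrow> B x y = 0) \<Longrightarrow> x \<in> V (Suc i)"
    using flag_form_bilinear[OF pf' ff' i', unfolded V'_eq] unfolding Q_def by blast
  have subV: "subspace (V i)" using partial_flag_subspace[OF pf] i by simp
  have involution: "Q (A *v x) = Q x"
    if A: "A \<in> Isom_flag k V \<gamma>" "A *v (A *v x) = x" and x: "x \<in> V i" for A x
  proof -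
    obtain c where c: "c \<noteq> 0" "c *\<^sub>R A \<in> Isom_flag k' V' \<gamma>'"
      using P_Isom_subset_scaled[of k V \<gamma> k' V' \<gamma>' A] eq A by auto
    have AV: "A *v y \<in> V i" if "y \<in> V i" for y
    proof -
      have "(*v) A ` V i = V i" using A i by (simp add: Isom_flag_def)
      then show ?thesis using that by blast
    qed
    have scale: "c\<^sup>2 * Q (A *v y) = Q y" if "y \<in> V i" for y
    proof -
      have "Q ((c *\<^sub>R A) *v y) = Q y" using c(2) that i' by (simp add: Isom_flag_def Q_def V'_eq)
      moreover have "Q (c *\<^sub>R (A *v y)) = c\<^sup>2 * Q (A *v y)"
        using AV[OF that] subV by (simp add: Q subspace_scale bilinear_simps[OF bil] power2_eq_square)
      ultimately show ?thesis by (simp add: scaleR_matrix_vector_assoc)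
    qed
    \<comment> \<open>Applying the involution twice scales Q by the fourth power of c.\<close>
    have "c\<^sup>2 * c\<^sup>2 * Q x = Q x"
      using scale[OF x] scale[OF AV[OF x]] A(2) by (metis mult.assoc mult.commute)
    then have "Q x = 0 \<or> c\<^sup>2 * c\<^sup>2 = 1" by auto
    then show ?thesis
    proof
      assume "Q x = 0"
      then show ?thesis using scale[OF x] c(1) by simp
    next
      assume "c\<^sup>2 * c\<^sup>2 = 1"
      then have "c\<^sup>2 = 1"
        by (metis abs_of_nonneg abs_square_eq_1 power2_eq_square zero_le_power2)
      then show ?thesis using scale[OF x] by simp
    qed
  qed
  define b where "b j = S *v axis j 1" for j
  have bV: "b j \<in> V i" if "i \<le> l j" for j
    using D(7)[of i "b j"] i that by (simp add: b_def matrix_inv_vector D(1) axis_in_level_space)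
  have orth: "B (b j) (b j') = 0" if j: "l j = i" "l j' = i" "j \<noteq> j'" for j j'
  proof -
    obtain A where A: "A \<in> Isom_flag k V \<gamma>" "\<And>z. A *v (S *v z) = S *v sign_change j z"
      using sign_change_Isom[OF fr] by blast
    have Ab: "A *v b j = - b j" "A *v b j' = b j'"
      using j unfolding b_def A(2) by (simp_all add: sign_change_def axis_def vec_eq_iff matrix_entry_expand
          if_distrib sum_negf flip: minus_mult_right cong: if_cong)
    have "Q (A *v (b j + b j')) = Q (b j + b j')"
      using j subV bV by (intro involution A) (simp_all add: matrix_vector_right_distrib matrix_vector_mult_diff_distrib Ab subspace_add)
    then have "Q (- b j + b j') = Q (b j + b j')" by (simp add: matrix_vector_right_distrib Ab)
    then show ?thesis
      using j subV bV by (simp add: Q subspace_add subspace_neg subspace_diff bilinear_simps[OF bil] sym[of "b j'" "b j"])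
  qed
  have value_eq: "e j' * Q (b j') = e j * Q (b j)" if j: "l j = i" "l j' = i" for j j'
  proof (cases "j = j'")
    case False
    define w where "w = e j * e j'"
    have ee: "e j = 1 \<or> e j = - 1" "e j' = 1 \<or> e j' = - 1" using D(4) by auto
    define a where "a = (if w = 1 then 3/5 else 5/3 :: real)"
    define d where "d = (if w = 1 then 4/5 else 4/3 :: real)"
    have ad: "a\<^sup>2 = 1 - w * d\<^sup>2" "d \<noteq> 0" "w * e j = e j'" "w * w = 1"
      using ee by (auto simp: a_def d_def w_def power2_eq_square)
    obtain A where A: "A \<in> Isom_flag k V \<gamma>" "\<And>z. A *v (S *v z) = S *v plane_reflection w j j' z"
      using plane_reflection_Isom[OF fr, of j j'] j False by (auto simp: w_def)
    have image1: "plane_reflection w j j' (axis j 1) = a *\<^sub>R axis j 1 + d *\<^sub>R axis j' 1"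
      using False by (auto simp: plane_reflection_def Let_def a_def d_def vec_eq_iff axis_def)
    have Ab: "A *v b j = a *\<^sub>R b j + d *\<^sub>R b j'"
      unfolding b_def A(2) image1 by (simp add: matrix_vector_right_distrib matrix_vector_mult_scaleR)
    have image2: "plane_reflection w j j' (a *\<^sub>R axis j 1 + d *\<^sub>R axis j' 1) = axis j 1"
      using False ee by (auto simp: plane_reflection_def Let_def a_def d_def vec_eq_iff axis_def w_def)
    have "A *v (A *v b j) = b j" unfolding b_def A(2) image1 image2 ..
    then have "Q (A *v b j) = Q (b j)" using j by (intro involution A bV) auto
    then have "a\<^sup>2 * Q (b j) + d\<^sup>2 * Q (b j') = Q (b j)"
      using j bV subV orth[OF j False] sym[of "b j'" "b j"] unfolding Ab
      by (simp add: Q subspace_add subspace_scale bilinear_simps[OF bil] power2_eq_square)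
    then have "d\<^sup>2 * Q (b j') = d\<^sup>2 * (w * Q (b j))" by (simp add: ad(1) algebra_simps)
    then have "Q (b j') = w * Q (b j)" using ad(2) by simp
    then show ?thesis using ee by (auto simp: w_def)
  qed simp
  obtain j0 where j0: "l j0 = i" using D(2) i by (metis atMost_iff imageE)
  define c where "c = e j0 * Q (b j0)"
  have Qb: "Q (b j) = c * e j" if "l j = i" for j
    using value_eq[OF j0 that] D(4)[of j] by (auto simp: c_def)
  have proportional: "Q x = c * pullback_form V \<gamma> i x" if x: "x \<in> V i" for x
  proof -
    define z where "z = matrix_inv S *v x"
    have z: "z \<in> level_space l i" using D(7)[of i x] i x by (simp add: z_def)
    have Sz: "S *v z = x" by (simp add: z_def matrix_inv_vector D(1))
    define y where "y = (\<Sum>j | l j = i. z $ j *\<^sub>R b j)"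
    have y: "y = S *v (\<chi> j. if l j = i then z $ j else 0)"
    proof -
      have "y = S *v (\<Sum>j | l j = i. z $ j *\<^sub>R axis j 1)"
        unfolding y_def b_def matrix_vector_mult_scaleR[symmetric]
        by (simp add: linear_sum[OF matrix_vector_mul_linear])
      also have "(\<Sum>j | l j = i. z $ j *\<^sub>R axis j 1) = (\<chi> j. if l j = i then z $ j else 0)"
        by (simp add: vec_eq_iff axis_def if_distrib sum.delta' cong: if_cong)
      finally show ?thesis .
    qed
    have "matrix_inv S *v (x - y) = z - (\<chi> j. if l j = i then z $ j else 0)"
      unfolding y Sz[symmetric] by (simp add: matrix_vector_mult_diff_distrib[symmetric] matrix_inv_vector D(1)
          del: matrix_vector_mult_diff_distrib)
    moreover have "z - (\<chi> j. if l j = i then z $ j else 0) \<in> level_space l (Suc i)"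
      using z by (auto simp: level_space_def less_Suc_eq)
    ultimately have xy: "x - y \<in> V (Suc i)" using D(7)[of "Suc i" "x - y"] i by simp
    have yV: "y \<in> V i" unfolding y_def using bV by (intro subspace_sum subV subspace_scale) auto
    have "Q x = Q y"
    proof -
      have "B x x - B y y = B x (x - y) + B y (x - y)" by (simp add: bilinear_simps[OF bil] sym[of y x])
      then show ?thesis using rad[OF x xy] rad[OF yV xy] Q x yV by simp
    qed
    also have "\<dots> = (\<Sum>j | l j = i. \<Sum>j' | l j' = i. z $ j * (z $ j' * B (b j) (b j')))"
      unfolding Q[OF yV] unfolding y_def bilinear_sum[OF bil]
      by (simp add: bilinear_simps[OF bil] sum.cartesian_product mult_ac)
    also have "\<dots> = (\<Sum>j | l j = i. \<Sum>j' | l j' = i. if j' = j then z $ j * (z $ j * Q (b j)) else 0)"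
      by (intro sum.cong refl) (auto simp: orth Q bV)
    also have "\<dots> = (\<Sum>j | l j = i. c * (e j * (z $ j)\<^sup>2))"
      by (intro sum.cong refl) (simp add: Qb power2_eq_square mult_ac)
    also have "\<dots> = c * pullback_form V \<gamma> i x"
      using D(8)[OF i x] by (simp add: level_form_eq z_def sum_distrib_left)
    finally show ?thesis .
  qed
  have "c \<noteq> 0"
  proof
    assume "c = 0"
    then have Q0: "Q x = 0" if "x \<in> V i" for x using proportional[OF that] by simp
    have "B x y = 0" if "x \<in> V i" "y \<in> V i" for x y
      using Q0[of "x + y"] Q0[of x] Q0[of y] that subV
      by (simp add: Q subspace_add bilinear_simps[OF bil] sym[of y x])
    then have "V i \<subseteq> V (Suc i)" using nd by blast
    then show False using pf i by (auto simp: partial_flag_def)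
  qed
  then show "\<exists>c. c \<noteq> 0 \<and> (\<forall>x\<in>V i. pullback_form V' \<gamma>' i x = c * pullback_form V \<gamma> i x)"
    using proportional unfolding Q_def by blast
qed

section \<open>Forms on the whole space\<close>

lemma PO_conjugate:
  fixes G :: "real^'n^'n"
  assumes G: "invertible G"
  shows "(\<lambda>h. pgl_class G \<otimes>\<^bsub>PGL\<^esub> h \<otimes>\<^bsub>PGL\<^esub> inv\<^bsub>PGL\<^esub> (pgl_class G)) ` PO Q =
    PO (\<lambda>x. Q (matrix_inv G *v x))"
proof -
  have conj: "pgl_class G \<otimes>\<^bsub>PGL\<^esub> pgl_class A \<otimes>\<^bsub>PGL\<^esub> inv\<^bsub>PGL\<^esub> (pgl_class G) =
    pgl_class (G ** A ** matrix_inv G)" if "invertible A" for A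
    using that G by (simp add: pgl_class_inv pgl_class_mult invertible_mult invertible_matrix_inv)
  show ?thesis
  proof (rule subset_antisym; rule subsetI)
    fix h assume "h \<in> (\<lambda>h. pgl_class G \<otimes>\<^bsub>PGL\<^esub> h \<otimes>\<^bsub>PGL\<^esub> inv\<^bsub>PGL\<^esub> (pgl_class G)) ` PO Q"
    then obtain A where A: "invertible A" "\<And>x. Q (A *v x) = Q x" "h = pgl_class (G ** A ** matrix_inv G)"
      using conj by (auto simp: PO_def)
    have "Q (matrix_inv G *v ((G ** A ** matrix_inv G) *v x)) = Q (matrix_inv G *v x)" for x
      by (simp add: matrix_inv_vector[OF G] A(2) flip: matrix_vector_mul_assoc)
    moreover have "invertible (G ** A ** matrix_inv G)"
      using A G by (simp add: invertible_mult invertible_matrix_inv)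
    ultimately show "h \<in> PO (\<lambda>x. Q (matrix_inv G *v x))" unfolding PO_def A(3) by blast
  next
    fix h assume "h \<in> PO (\<lambda>x. Q (matrix_inv G *v x))"
    then obtain M where M: "invertible M" "\<And>x. Q (matrix_inv G *v (M *v x)) = Q (matrix_inv G *v x)"
      "h = pgl_class M" by (auto simp: PO_def)
    define A where "A = matrix_inv G ** M ** G"
    have A: "invertible A" unfolding A_def by (intro invertible_mult invertible_matrix_inv G M)
    have "Q (A *v x) = Q x" for x
      using M(2)[of "G *v x"] by (simp add: A_def matrix_inv_vector[OF G] flip: matrix_vector_mul_assoc)
    then have "pgl_class A \<in> PO Q" using A unfolding PO_def by blast
    moreover have "G ** A ** matrix_inv G = M"
      by (simp add: A_def matrix_inv_cancel(1)[OF G] matrix_inv_right[OF G] flip: matrix_mul_assoc)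
    then have "h = pgl_class G \<otimes>\<^bsub>PGL\<^esub> pgl_class A \<otimes>\<^bsub>PGL\<^esub> inv\<^bsub>PGL\<^esub> (pgl_class G)"
      using conj[OF A] M(3) by simp
    ultimately show "h \<in> (\<lambda>h. pgl_class G \<otimes>\<^bsub>PGL\<^esub> h \<otimes>\<^bsub>PGL\<^esub> inv\<^bsub>PGL\<^esub> (pgl_class G)) ` PO Q"
      by blast
  qed
qed

lemma X_space_translate:
  fixes G :: "real^'n^'n"
  assumes G: "invertible G"
  shows "pgl_act (pgl_class G) ` X_space Q = X_space (\<lambda>x. Q (matrix_inv G *v x))"
proof (rule subset_antisym; rule subsetI)
  fix z assume "z \<in> pgl_act (pgl_class G) ` X_space Q"
  then obtain x where x: "x \<noteq> 0" "Q x < 0" "z = rp_class (G *v x)"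
    using pgl_class_act[OF G] by (auto simp: X_space_def)
  then show "z \<in> X_space (\<lambda>x. Q (matrix_inv G *v x))"
    unfolding X_space_def by (intro CollectI exI[of _ "G *v x"])
      (simp add: matrix_inv_vector[OF G] invertible_vector_nonzero[OF G])
next
  fix z assume "z \<in> X_space (\<lambda>x. Q (matrix_inv G *v x))"
  then obtain x where x: "x \<noteq> 0" "Q (matrix_inv G *v x) < 0" "z = rp_class x" by (auto simp: X_space_def)
  have "matrix_inv G *v x \<noteq> 0"
    using x by (simp add: invertible_vector_nonzero[OF invertible_matrix_inv[OF G]])
  then have "rp_class (matrix_inv G *v x) \<in> X_space Q"
    and "z = pgl_act (pgl_class G) (rp_class (matrix_inv G *v x))"
    using x by (auto simp: X_space_def pgl_class_act G matrix_inv_vector[OF G])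
  then show "z \<in> pgl_act (pgl_class G) ` X_space Q" by blast
qed

text \<open>A form on the whole space is a flag of forms of length one.\<close>
definition trivial_flag :: "nat \<Rightarrow> (real^'n) set" where
  "trivial_flag i = (if i = 0 then UNIV else {0})"

definition trivial_flag_form :: "(real^'n \<Rightarrow> real) \<Rightarrow> nat \<Rightarrow> (real^'n) set \<Rightarrow> real" where
  "trivial_flag_form Q i C = Q (the_elem C)"

lemma trivial_flag:
  fixes Q :: "real^'n \<Rightarrow> real"
  shows "partial_flag 0 (trivial_flag :: nat \<Rightarrow> (real^'n) set)"
    "pullback_form trivial_flag (trivial_flag_form Q) 0 = Q"
    "quadratic_form_on UNIV Q \<Longrightarrow> nondegenerate_mod UNIV {0} Q \<Longrightarrow>
      flag_of_forms 0 trivial_flag (trivial_flag_form Q)"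
    "X_flag trivial_flag (trivial_flag_form Q) = X_space Q"
    "P_Isom 0 trivial_flag (trivial_flag_form Q) = PO Q"
    "flag_signature trivial_flag (trivial_flag_form Q) 0 = signature_mod UNIV {0} Q"
proof -
  have "axis undefined 1 \<noteq> (0 :: real^'n)" by (simp add: axis_eq_0_iff)
  then have "{0} \<subset> (UNIV :: (real^'n) set)" by blast
  then show "partial_flag 0 (trivial_flag :: nat \<Rightarrow> (real^'n) set)"
    by (simp add: partial_flag_def trivial_flag_def subspace_0)
  show pull: "pullback_form trivial_flag (trivial_flag_form Q) 0 = Q"
    by (rule ext) (simp add: pullback_form_def trivial_flag_form_def trivial_flag_def)
  show "flag_of_forms 0 trivial_flag (trivial_flag_form Q)"
    if "quadratic_form_on UNIV Q" "nondegenerate_mod UNIV {0} Q"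
    using that pull by (simp add: flag_of_forms_def trivial_flag_def)
  show "X_flag trivial_flag (trivial_flag_form Q) = X_space Q"
    by (simp add: X_flag_def pull)
  have "surj ((*v) A)" if "invertible A" for A :: "real^'n^'n"
    using matrix_inv_vector(1)[OF that] by (metis surjI)
  then have "Isom_flag 0 trivial_flag (trivial_flag_form Q) = {A. invertible A \<and> (\<forall>x. Q (A *v x) = Q x)}"
    unfolding Isom_flag_def by (auto simp: trivial_flag_def pull le_Suc_eq)
  then show "P_Isom 0 trivial_flag (trivial_flag_form Q) = PO Q"
    by (simp add: P_Isom_def PO_def)
  show "flag_signature trivial_flag (trivial_flag_form Q) 0 = signature_mod UNIV {0} Q"
    by (simp add: flag_signature_def pull) (simp add: trivial_flag_def)
qed

lemma signature_of_diagonalization: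
  fixes S :: "real^'n^'n"
  assumes inv: "invertible S" and e: "\<And>j. e j = 1 \<or> e j = - 1"
    and Q: "\<And>x. Q (S *v x) = diag_form e x"
  shows "signature_mod UNIV {0} Q = (card {j. e j = - 1}, card {j. e j = 1})"
proof -
  have lev: "level_space (\<lambda>_ :: 'n. 0 :: nat) i = (if i = 0 then UNIV else {0})" for i
    by (auto simp: level_space_def vec_eq_iff)
  have "surj ((*v) S)" using matrix_inv_vector(1)[OF inv] by (metis surjI)
  then have "adapted_frame 0 trivial_flag (trivial_flag_form Q) S (\<lambda>_. 0) e"
    unfolding adapted_frame_def using inv e
    by (auto simp: trivial_flag(2) Q level_form_def lev trivial_flag_def)
  from flag_signature_of_frame[OF this, of 0] show ?thesis by (simp add: trivial_flag(6))
qed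

lemma diagonalization_exists:
  fixes Q :: "real^'n \<Rightarrow> real"
  assumes "quadratic_form_on UNIV Q" "nondegenerate_mod UNIV {0} Q"
  shows "\<exists>(S :: real^'n^'n) e. invertible S \<and> (\<forall>j. e j = 1 \<or> e j = - 1) \<and> (\<forall>x. Q (S *v x) = diag_form e x)"
proof -
  obtain S l e where fr: "adapted_frame 0 trivial_flag (trivial_flag_form Q) S l e"
    using adapted_frame_exists[OF trivial_flag(1) trivial_flag(3)[OF assms]] by blast
  note D = adapted_frameD[OF fr]
  have "l j = 0" for j using D(3)[of j] by simp
  then have "Q (S *v x) = diag_form e x" for x
    using D(6)[of 0 x] by (simp add: trivial_flag(2) level_space_0) (simp add: level_form_def)
  then show ?thesis using D(1,4) by blast
qed

lemma diagonal_form_quadratic: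
  fixes S :: "real^'n^'n"
  assumes inv: "invertible S" and d: "\<And>j. d j \<noteq> 0" and Q: "\<And>x. Q (S *v x) = diag_form d x"
  shows "quadratic_form_on UNIV Q" "nondegenerate_mod UNIV {0} Q"
proof -
  have Q': "Q x = diag_form d (matrix_inv S *v x)" for x
    using Q[of "matrix_inv S *v x"] by (simp add: matrix_inv_vector inv)
  show "quadratic_form_on UNIV Q"
    unfolding quadratic_form_on_def Q' diag_form_bilinear using bilinear_diag_bilinear by blast
  show "nondegenerate_mod UNIV {0} Q"
    unfolding nondegenerate_mod_def
  proof (intro ballI impI)
    fix x assume 0: "\<forall>y\<in>UNIV. Q (x + y) - Q x - Q y = 0"
    have "(matrix_inv S *v x) $ j = 0" for j
    proof -
      from bspec[OF 0 UNIV_I, of "S *v axis j 1"]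
      have "diag_bilinear d (matrix_inv S *v x) (axis j 1) = 0"
        unfolding Q' by (simp add: matrix_vector_right_distrib diag_form_add matrix_inv_vector inv)
      then show ?thesis using d by (simp add: diag_bilinear_axis)
    qed
    then have "matrix_inv S *v x = 0" by (simp add: vec_eq_iff)
    then show "x \<in> {0}" by (simp add: invertible_vector_nonzero invertible_matrix_inv inv)
  qed
qed

definition form_translate :: "(real^'n \<Rightarrow> real) \<Rightarrow> real^'n^'n \<Rightarrow> real^'n \<Rightarrow> real" where
  "form_translate Q G x = Q (matrix_inv G *v x)"

text \<open>A reformulation in terms of the translated forms, whose geometries are automatically
  subgeometries.\<close>
lemma is_limit_of_iff:
  fixes \<beta> :: "real^'n \<Rightarrow> real"
  assumes "quadratic_form_on UNIV \<beta>" "nondegenerate_mod UNIV {0} \<beta>"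
  shows "(Z, L) is_limit_of (X_space \<beta>, PO \<beta>) \<longleftrightarrow>
    (\<exists>G. (\<forall>m. invertible (G m)) \<and> subgeometry Z L \<and>
      converges_geometrically (\<lambda>m. PO (form_translate \<beta> (G m))) L \<and>
      (\<exists>z\<in>Z. \<forall>\<^sub>F m in sequentially. z \<in> X_space (form_translate \<beta> (G m))))"
    (is "?L \<longleftrightarrow> ?R")
proof -
  obtain S :: "real^'n^'n" and e where S: "invertible S" "\<And>j. e j = 1 \<or> e j = - 1" "\<And>x. \<beta> (S *v x) = diag_form e x"
    using diagonalization_exists[OF assms] by blast
  have geometry: "subgeometry (X_space Q) (PO Q)"
    if "quadratic_form_on UNIV Q" "nondegenerate_mod UNIV {0} Q" for Q :: "real^'n \<Rightarrow> real"
    using subgeometry_flag[OF trivial_flag(1) trivial_flag(3)[OF that]] by (simp add: trivial_flag(4,5))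
  have translate_geometry: "subgeometry (X_space (form_translate \<beta> G)) (PO (form_translate \<beta> G))"
    if G: "invertible G" for G
  proof -
    have "form_translate \<beta> G ((G ** S) *v x) = diag_form e x" for x
      by (simp add: form_translate_def matrix_inv_vector[OF G] S(3) flip: matrix_vector_mul_assoc)
    moreover have "e j \<noteq> 0" for j using S(2)[of j] by auto
    ultimately show ?thesis
      using diagonal_form_quadratic[of "G ** S" e "form_translate \<beta> G"] G S(1)
      by (intro geometry) (simp_all add: invertible_mult)
  qed
  show ?thesis
  proof
    assume ?L
    then obtain g where conv: "subgeometries_converge (\<lambda>m. pgl_act (g m) ` X_space \<beta>)
        (\<lambda>m. (\<lambda>h. g m \<otimes>\<^bsub>PGL\<^esub> h \<otimes>\<^bsub>PGL\<^esub> inv\<^bsub>PGL\<^esub> (g m)) ` PO \<beta>) Z L"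
      by (auto simp: is_limit_of_def)
    have "\<exists>A. invertible A \<and> g m = pgl_class A" for m by (metis pgl_class_cases)
    then obtain G where G: "\<And>m. invertible (G m)" "\<And>m. g m = pgl_class (G m)" by metis
    show ?R
      using conv G(1) unfolding subgeometries_converge_def G(2) X_space_translate[OF G(1)] PO_conjugate[OF G(1)]
      by (auto simp: form_translate_def[abs_def])
  next
    assume ?R
    then obtain G where G: "\<And>m. invertible (G m)" and R: "subgeometry Z L"
      "converges_geometrically (\<lambda>m. PO (form_translate \<beta> (G m))) L"
      "\<exists>z\<in>Z. \<forall>\<^sub>F m in sequentially. z \<in> X_space (form_translate \<beta> (G m))" by blast
    have "subgeometries_converge (\<lambda>m. pgl_act (pgl_class (G m)) ` X_space \<beta>)
        (\<lambda>m. (\<lambda>h. pgl_class (G m) \<otimes>\<^bsub>PGL\<^esub> h \<otimes>\<^bsub>PGL\<^esub> inv\<^bsub>PGL\<^esub> (pgl_class (G m))) ` PO \<beta>) Z L"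
      unfolding subgeometries_converge_def X_space_translate[OF G] PO_conjugate[OF G]
      using R translate_geometry[OF G] by (simp add: form_translate_def[abs_def])
    then show ?L
      using geometry[OF assms] unfolding is_limit_of_def
      by (auto intro!: exI[of _ "\<lambda>m. pgl_class (G m)"])
  qed
qed

lemma negative_coordinate_in_X_flag:
  assumes fr: "adapted_frame k V \<gamma> S l e" and j: "l j = 0" "e j = - 1"
  shows "rp_class (S *v axis j 1) \<in> X_flag V \<gamma>"
proof -
  note D = adapted_frameD[OF fr]
  have "level_form l e 0 (axis j 1) = (\<Sum>i | l i = 0. if i = j then e j else 0)"
    unfolding level_form_eq by (intro sum.cong) (auto simp: axis_def)
  then have "level_form l e 0 (axis j 1) = - 1" using j by (simp add: sum.delta)
  then have "pullback_form V \<gamma> 0 (S *v axis j 1) < 0" using D(6)[of 0 "axis j 1"] by (simp add: level_space_0)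
  moreover have "S *v axis j 1 \<noteq> 0" by (simp add: invertible_vector_nonzero[OF D(1)] axis_eq_0_iff)
  ultimately show ?thesis unfolding X_flag_def X_space_def by blast
qed

lemma negative_coordinate_exists:
  assumes fr: "adapted_frame k V \<gamma> S l e" and "V 0 = UNIV" and "X_flag V \<gamma> \<noteq> {}"
  shows "\<exists>j. l j = 0 \<and> e j = - 1"
proof (rule ccontr)
  note D = adapted_frameD[OF fr]
  assume none: "\<nexists>j. l j = 0 \<and> e j = - 1"
  have "level_form l e 0 z \<ge> 0" for z
    unfolding level_form_eq
  proof (intro sum_nonneg)
    fix j assume "j \<in> {j. l j = 0}"
    then have "e j = 1" using none D(4)[of j] by blast
    then show "0 \<le> e j * (z $ j)\<^sup>2" by simp
  qed
  then have "pullback_form V \<gamma> 0 x \<ge> 0" for x using D(8)[of 0 x] assms(2) by simp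
  then have "\<not> pullback_form V \<gamma> 0 x < 0" for x by (simp add: not_less)
  then show False using assms(3) by (auto simp: X_flag_def X_space_def)
qed

section \<open>Limits are flag geometries\<close>

text \<open>The orbit contains an open set, so the top form does not vanish identically on it; its sign is
  constant along the orbit and not positive at \<open>x\<close>, hence negative. The flag group is transitive on all negative points, so
  the orbit contains all of them.\<close>
lemma open_orbit_eq_X_flag:
  assumes pf: "partial_flag k V" and ff: "flag_of_forms k V \<gamma>"
    and geo: "subgeometry Z (P_Isom k V \<gamma>)"
    and x: "x \<noteq> 0" "rp_class x \<in> Z" "pullback_form V \<gamma> 0 x \<le> 0"
  shows "Z = X_flag V \<gamma>"
proof -
  define Q where "Q = pullback_form V \<gamma> 0"
  have V0: "V 0 = UNIV" using pf by (simp add: partial_flag_def)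
  obtain B where bil: "bilinear B" and sym: "\<And>x y. B x y = B y x" and Q: "\<And>x. Q x = B x x"
    and nd: "\<And>x. (\<And>y. B x y = 0) \<Longrightarrow> x \<in> V 1"
    using flag_form_bilinear[OF pf ff, of 0] by (auto simp: V0 Q_def)
  have scale: "Q (c *\<^sub>R x) = c\<^sup>2 * Q x" for c x
    by (simp add: Q bilinear_simps[OF bil] power2_eq_square)
  have orbit: "\<exists>c>0. Q y = c * Q x" if y: "y \<noteq> 0" "rp_class y \<in> Z" for y
  proof -
    obtain h where h: "h \<in> P_Isom k V \<gamma>" "pgl_act h (rp_class x) = rp_class y"
      using geo x(2) y(2) unfolding subgeometry_def by blast
    then obtain A where A: "A \<in> Isom_flag k V \<gamma>" "h = pgl_class A" by (auto simp: P_Isom_def)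
    have inv: "invertible A" and QA: "Q (A *v x) = Q x" using A by (auto simp: Isom_flag_def Q_def V0)
    have "rp_class (A *v x) = rp_class y" using h(2) A(2) inv x(1) by (simp add: pgl_class_act)
    then obtain c where "c \<noteq> 0" "y = c *\<^sub>R (A *v x)"
      using rp_class_eq_iff[of "A *v x" y] x(1) y(1) by (auto simp: invertible_vector_nonzero[OF inv])
    then show ?thesis using QA by (intro exI[of _ "c\<^sup>2"]) (simp add: scale)
  qed
  have "Q x \<noteq> 0"
  proof
    assume "Q x = 0"
    then have zero: "Q y = 0" if "y \<noteq> 0" "rp_class y \<in> Z" for y using orbit[OF that] by auto
    have "open {y. y \<noteq> 0 \<and> rp_class y \<in> Z}"
      using geo by (simp add: subgeometry_def open_rp_def)
    then obtain \<epsilon> where \<epsilon>: "\<epsilon> > 0" "ball x \<epsilon> \<subseteq> {y. y \<noteq> 0 \<and> rp_class y \<in> Z}"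
      using x unfolding open_contains_ball by blast
    \<comment> \<open>Q vanishes at x and nearby at x + t u and x - t u, so it vanishes at u by the parallelogram law.\<close>
    have Q0: "Q u = 0" for u
    proof -
      define t where "t = \<epsilon> / (2 * (norm u + 1))"
      have t: "t > 0" using \<epsilon> by (simp add: t_def add_nonneg_pos)
      have "t * norm u < \<epsilon>"
      proof -
        have "t * norm u = \<epsilon> / 2 * (norm u / (norm u + 1))" by (simp add: t_def)
        also have "\<dots> \<le> \<epsilon> / 2 * 1"
          using \<epsilon>(1) by (intro mult_left_mono) (simp_all add: divide_le_eq_1 add_nonneg_pos)
        finally show ?thesis using \<epsilon>(1) by simp
      qed
      then have "x + t *\<^sub>R u \<in> ball x \<epsilon>" "x - t *\<^sub>R u \<in> ball x \<epsilon>" using t by (simp_all add: dist_norm)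
      then have "Q (x + t *\<^sub>R u) = 0" "Q (x - t *\<^sub>R u) = 0" using \<epsilon>(2) zero by blast+
      moreover have "Q (x + t *\<^sub>R u) + Q (x - t *\<^sub>R u) = 2 * Q x + 2 * t\<^sup>2 * Q u"
        by (simp add: Q bilinear_simps[OF bil] power2_eq_square algebra_simps)
      ultimately show ?thesis using \<open>Q x = 0\<close> t by simp
    qed
    have "B u y = 0" for u y
      using Q0[of "u + y"] Q0[of u] Q0[of y] by (simp add: Q bilinear_simps[OF bil] sym[of y u])
    then have "V 0 \<subseteq> V 1" using nd by blast
    moreover have "V 1 \<subset> V 0" using partial_flag_strict[OF pf, of 0 1] by simp
    ultimately show False by blast
  qed
  then have neg: "Q x < 0" using x(3) by (simp add: Q_def)
  show ?thesis
  proof (rule subset_antisym; rule subsetI)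
    fix z assume z: "z \<in> Z"
    obtain y where y: "y \<noteq> 0" "z = rp_class y" by (rule rp_class_cases)
    then obtain c where "c > 0" "Q y = c * Q x" using orbit[of y] z by blast
    then have "Q y < 0" using neg by (simp add: mult_pos_neg)
    then show "z \<in> X_flag V \<gamma>" using y by (auto simp: X_flag_def X_space_def Q_def)
  next
    fix z assume z: "z \<in> X_flag V \<gamma>"
    have "rp_class x \<in> X_flag V \<gamma>" using x neg by (auto simp: X_flag_def X_space_def Q_def)
    then obtain h where "h \<in> P_Isom k V \<gamma>" "pgl_act h (rp_class x) = z"
      using subgeometry_flag[OF pf ff] z unfolding subgeometry_def by blast
    then show "z \<in> Z" using geo x(2) unfolding subgeometry_def by blast
  qed
qed

text \<open>The normal form of a subsequence supplies the flag; the group of the limit can be computed along the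
  subsequence. The first matrix of the normal form also diagonalizes \<open>\<beta>\<close> itself with the signs of the
  frame, which relates them to the signature.\<close>
lemma limit_is_flag_geometry:
  fixes \<beta> :: "real^'n \<Rightarrow> real"
  assumes quad: "quadratic_form_on UNIV \<beta>" and nondeg: "nondegenerate_mod UNIV {0} \<beta>"
    and limit: "(Z, L) is_limit_of (X_space \<beta>, PO \<beta>)"
  shows "\<exists>k V \<gamma> S l e. partial_flag k V \<and> flag_of_forms k V \<gamma> \<and> adapted_frame k V \<gamma> S l e \<and>
    Z = X_flag V \<gamma> \<and> L = P_Isom k V \<gamma> \<and>
    signature_mod UNIV {0} \<beta> = (card {j. e j = - 1}, card {j. e j = 1})"
proof -
  obtain G z where G: "\<And>m. invertible (G m)" and geo: "subgeometry Z L"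
    and conv: "converges_geometrically (\<lambda>m. PO (form_translate \<beta> (G m))) L"
    and z: "z \<in> Z" "\<forall>\<^sub>F m in sequentially. z \<in> X_space (form_translate \<beta> (G m))"
    using limit unfolding is_limit_of_iff[OF quad nondeg] by blast
  obtain B0 where bil: "bilinear B0" and sym: "\<And>x y. B0 x y = B0 y x" and B0: "\<And>x. \<beta> x = B0 x x"
    and nd: "\<And>x. (\<And>y. B0 x y = 0) \<Longrightarrow> x = 0"
    using flag_form_bilinear[OF trivial_flag(1) trivial_flag(3)[OF quad nondeg], of 0]
    by (auto simp: trivial_flag(2)) (auto simp: trivial_flag_def)
  define B where "B m x y = B0 (matrix_inv (G m) *v x) (matrix_inv (G m) *v y)" for m x y
  have "\<exists>r (S :: real^'n^'n) T l e k c. strict_mono r \<and> invertible S \<and> T \<longlonglongrightarrow> S \<and> (\<forall>m. invertible (T m)) \<and>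
    range l = {..k} \<and> (\<forall>j. e j = 1 \<or> e j = - 1) \<and> separating_scales l e c \<and>
    (\<forall>m x. B (r m) (T m *v x) (T m *v x) = diag_form (separating_scales.coeff l e c m) x)"
  proof (rule forms_normal_form[of B])
    show "bilinear (B m)" for m
      unfolding bilinear_def B_def
      by (auto intro!: linearI simp: matrix_vector_right_distrib matrix_vector_mult_scaleR bilinear_simps[OF bil])
    show "B m x y = B m y x" for m x y unfolding B_def by (rule sym)
    show "x = 0" if "\<And>y. B m x y = 0" for m x
    proof -
      have "B0 (matrix_inv (G m) *v x) y = 0" for y
        using that[of "G m *v y"] by (simp add: B_def matrix_inv_vector[OF G])
      then have "matrix_inv (G m) *v x = 0" by (rule nd)
      then show ?thesis by (simp add: invertible_vector_nonzero[OF invertible_matrix_inv[OF G]])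
    qed
  qed
  then obtain r and S :: "real^'n^'n" and T l e k c where r: "strict_mono r" and S: "invertible S"
    and T: "T \<longlonglongrightarrow> S" "\<And>m. invertible (T m)" and l: "range l = {..k}"
    and e: "\<And>j. e j = 1 \<or> e j = - 1" and scales: "separating_scales l e c"
    and BT: "\<And>m x. B (r m) (T m *v x) (T m *v x) = diag_form (separating_scales.coeff l e c m) x"
    by blast
  interpret separating_scales l e c by (rule scales)
  have form: "form_translate \<beta> (G (r m)) (T m *v x) = diag_form (coeff m) x" for m x
    using BT[of m x] by (simp add: form_translate_def B0 B_def)
  obtain V \<gamma> where pf: "partial_flag k V" and ff: "flag_of_forms k V \<gamma>"
    and fr: "adapted_frame k V \<gamma> S l e"
    using adapted_flag_exists[where e = e, OF S l e] by blast
  have ne: "PO (form_translate \<beta> (G m)) \<noteq> {}" for m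
  proof -
    have "pgl_class (mat 1) \<in> PO (form_translate \<beta> (G m))"
      unfolding PO_def by (rule imageI) (simp add: invertible_mat_1)
    then show ?thesis by blast
  qed
  have "converges_geometrically (\<lambda>m. PO (form_translate \<beta> (G (r m)))) L"
    by (rule converges_geometrically_subseq[OF conv r ne])
  moreover have "converges_geometrically (\<lambda>m. PO (form_translate \<beta> (G (r m)))) (P_Isom k V \<gamma>)"
    using PO_converges[OF fr T form] .
  ultimately have L: "L = P_Isom k V \<gamma>" by (rule converges_geometrically_unique)
  have V0: "V 0 = UNIV" using pf by (simp add: partial_flag_def)
  obtain x where x: "x \<noteq> 0" "z = rp_class x" by (rule rp_class_cases)
  have "pullback_form V \<gamma> 0 x \<le> 0"
  proof (rule tendsto_upperbound[OF rescaled_forms_converge[OF fr V0 T form]])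
    have "\<forall>\<^sub>F m in sequentially. z \<in> X_space (form_translate \<beta> (G (r m)))"
      using z(2) r by (rule eventually_subseq[rotated])
    then show "\<forall>\<^sub>F m in sequentially. form_translate \<beta> (G (r m)) x / c 0 m \<le> 0"
    proof eventually_elim
      case (elim m)
      have "form_translate \<beta> (G (r m)) (a *\<^sub>R y) = a\<^sup>2 * form_translate \<beta> (G (r m)) y" for a y
        by (simp add: form_translate_def B0 matrix_vector_mult_scaleR bilinear_simps[OF bil] power2_eq_square)
      then have "form_translate \<beta> (G (r m)) x < 0" using X_space_iff[of _ x] x elim by blast
      then show ?case using c_pos[of 0 m] by (simp add: divide_le_0_iff)
    qed
  qed simp
  then have Z: "Z = X_flag V \<gamma>"
    using open_orbit_eq_X_flag[OF pf ff, of Z x] geo z(1) x L by simp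
  define D :: "real^'n^'n" where "D = diagonal_rescaling (\<lambda>j. c (l j) 0)"
  have "\<beta> ((matrix_inv (G (r 0)) ** T 0 ** D) *v x) = diag_form e x" for x
  proof -
    have "\<beta> ((matrix_inv (G (r 0)) ** T 0 ** D) *v x) = diag_form (coeff 0) (D *v x)"
      using form[of 0 "D *v x"] by (simp add: form_translate_def matrix_vector_mul_assoc matrix_mul_assoc)
    also have "\<dots> = diag_form (\<lambda>j. coeff 0 j / c (l j) 0) x"
      unfolding D_def by (intro diagonal_rescaling c_pos)
    also have "(\<lambda>j. coeff 0 j / c (l j) 0) = e"
      using c_pos[of _ 0] by (auto simp: coeff_def less_imp_neq[symmetric])
    finally show ?thesis .
  qed
  moreover have "invertible (matrix_inv (G (r 0)) ** T 0 ** D)"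
    unfolding D_def by (intro invertible_mult invertible_matrix_inv G T diagonal_rescaling(2) c_pos)
  ultimately have "signature_mod UNIV {0} \<beta> = (card {j. e j = - 1}, card {j. e j = 1})"
    using e signature_of_diagonalization by blast
  then show ?thesis using pf ff fr Z L by blast
qed

lemma card_by_levels:
  fixes l :: "'n::finite \<Rightarrow> nat"
  assumes "\<And>j. l j \<le> k"
  shows "(\<Sum>i\<le>k. card {j. l j = i \<and> P j}) = card {j. P j}"
proof -
  have "card {j. P j} = (\<Sum>i\<in>{..k}. card {j \<in> {j. P j}. l j = i})"
    using assms by (subst card_eq_sum, subst sum.group[of _ "{..k}" l, symmetric]) auto
  then show ?thesis by (simp add: conj_commute)
qed

lemma signature_mod_scaled:
  assumes "c \<noteq> 0" "\<And>x. x \<in> V \<Longrightarrow> Q x = c * Q' x"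
  shows "signature_mod V W Q = (if c > 0 then signature_mod V W Q' else prod.swap (signature_mod V W Q'))"
proof -
  have cond: "subspace U \<and> W \<subseteq> U \<and> U \<subseteq> V \<and> (\<forall>x\<in>U - W. R (Q x)) \<longleftrightarrow>
    subspace U \<and> W \<subseteq> U \<and> U \<subseteq> V \<and> (\<forall>x\<in>U - W. R (c * Q' x))" for U and R :: "real \<Rightarrow> bool"
    using assms(2) by (metis Diff_iff subsetD)
  show ?thesis
    unfolding signature_mod_def cond[of _ "\<lambda>t. t < 0"] cond[of _ "\<lambda>t. t > 0"]
    using assms(1) by (cases "c > 0") (simp_all add: mult_less_0_iff zero_less_mult_iff)
qed

text \<open>The limit comes with some flag of forms whose sign counts are right; the given flag of forms has the
  same group, so its forms differ from those only by factors, and negative factors swap the indices.\<close>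
lemma limit_signature:
  fixes \<beta> :: "real^'n \<Rightarrow> real"
  assumes quad: "quadratic_form_on UNIV \<beta>" and nondeg: "nondegenerate_mod UNIV {0} \<beta>"
    and pf: "partial_flag k V" and ff: "flag_of_forms k V \<gamma>"
    and limit: "(X_flag V \<gamma>, P_Isom k V \<gamma>) is_limit_of (X_space \<beta>, PO \<beta>)"
  shows "fst (flag_signature V \<gamma> 0) \<noteq> 0"
    and "partitions_signature k (flag_signature V \<gamma>) (signature_mod UNIV {0} \<beta>)"
proof -
  obtain k' V' \<gamma>' S l e where pf': "partial_flag k' V'" and ff': "flag_of_forms k' V' \<gamma>'"
    and fr: "adapted_frame k' V' \<gamma>' S l e" and X: "X_flag V \<gamma> = X_flag V' \<gamma>'"
    and P: "P_Isom k' V' \<gamma>' = P_Isom k V \<gamma>"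
    and sig: "signature_mod UNIV {0} \<beta> = (card {j. e j = - 1}, card {j. e j = 1})"
    using limit_is_flag_geometry[OF quad nondeg limit] by metis
  note uniq = P_Isom_determines_flag[OF pf' ff' pf ff P]
  have k: "k' = k" by (rule uniq(1))
  obtain c where c: "\<And>i. i \<le> k \<Longrightarrow> c i \<noteq> 0"
    "\<And>i x. i \<le> k \<Longrightarrow> x \<in> V' i \<Longrightarrow> pullback_form V \<gamma> i x = c i * pullback_form V' \<gamma>' i x"
    using uniq(3) unfolding k by metis
  have sig_eq: "flag_signature V \<gamma> i = (if c i > 0 then flag_signature V' \<gamma>' i
    else prod.swap (flag_signature V' \<gamma>' i))" if "i \<le> k" for i
    using signature_mod_scaled[of "c i" "V' i" "pullback_form V \<gamma> i" "pullback_form V' \<gamma>' i" "V' (Suc i)",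
        OF c(1)[OF that] c(2)[OF that]]
      uniq(2)[of i] uniq(2)[of "Suc i"] that unfolding flag_signature_def k by simp
  note sig' = flag_signature_of_frame[OF fr]
  have V0: "V 0 = UNIV" "V' 0 = UNIV" using pf pf' by (simp_all add: partial_flag_def)
  have "X_flag V \<gamma> \<noteq> {}" using limit unfolding is_limit_of_iff[OF quad nondeg] by blast
  then obtain x where x: "x \<noteq> 0" "pullback_form V \<gamma> 0 x < 0"
    by (auto simp: X_flag_def X_space_def)
  then have x': "rp_class x \<in> X_space (pullback_form V' \<gamma>' 0)"
    using X by (auto simp: X_flag_def X_space_def)
  have "pullback_form V' \<gamma>' 0 x < 0"
  proof (rule X_space_iff[THEN iffD1, OF _ x(1) x'])
    obtain B where "bilinear B" "\<And>x. pullback_form V' \<gamma>' 0 x = B x x"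
      using flag_form_bilinear[OF pf' ff', of 0] V0 by auto
    then show "pullback_form V' \<gamma>' 0 (a *\<^sub>R y) = a\<^sup>2 * pullback_form V' \<gamma>' 0 y" for a y
      by (simp add: bilinear_simps power2_eq_square)
  qed
  then have c0: "c 0 > 0" using c(2)[of 0 x] V0 x(2) by (simp add: mult_less_0_iff)
  obtain j where j: "l j = 0" "e j = - 1"
    using negative_coordinate_exists[OF fr V0(2)] \<open>X_flag V \<gamma> \<noteq> {}\<close> X by auto
  then have "card {j. l j = 0 \<and> e j = - 1} \<noteq> 0" by (simp add: card_eq_0_iff) blast
  then show "fst (flag_signature V \<gamma> 0) \<noteq> 0" using c0 sig_eq[of 0] sig'[of 0] by simp
  define I where "I = {i \<in> {1..k}. c i < 0}"
  have fst_eq: "(if i \<in> I then snd (flag_signature V \<gamma> i) else fst (flag_signature V \<gamma> i)) =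
      card {j. l j = i \<and> e j = - 1}"
    and snd_eq: "(if i \<in> I then fst (flag_signature V \<gamma> i) else snd (flag_signature V \<gamma> i)) =
      card {j. l j = i \<and> e j = 1}" if i: "i \<le> k" for i
    using sig_eq[OF i] sig'[of i] c0 c(1)[OF i] i k by (cases "i = 0"; force simp: I_def)+
  have lk: "l j \<le> k" for j using adapted_frameD(3)[OF fr] k by simp
  have "(\<Sum>i\<le>k. if i \<in> I then snd (flag_signature V \<gamma> i) else fst (flag_signature V \<gamma> i)) =
      (\<Sum>i\<le>k. card {j. l j = i \<and> e j = - 1})"
    using fst_eq by (intro sum.cong) auto
  moreover have "(\<Sum>i\<le>k. if i \<in> I then fst (flag_signature V \<gamma> i) else snd (flag_signature V \<gamma> i)) =
      (\<Sum>i\<le>k. card {j. l j = i \<and> e j = 1})"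
    using snd_eq by (intro sum.cong) auto
  ultimately show "partitions_signature k (flag_signature V \<gamma>) (signature_mod UNIV {0} \<beta>)"
    unfolding partitions_signature_def sig by (intro exI[of _ I]) (auto simp: card_by_levels lk I_def)
qed

section \<open>Flag geometries are limits\<close>

lemma equinumerous_sign_patterns:
  fixes e e' :: "'n::finite \<Rightarrow> real"
  assumes e: "\<And>j. e j = 1 \<or> e j = - 1" and e': "\<And>j. e' j = 1 \<or> e' j = - 1"
    and card: "card {j. e j = - 1} = card {j. e' j = - 1}" "card {j. e j = 1} = card {j. e' j = 1}"
  shows "\<exists>\<pi>. bij \<pi> \<and> (\<forall>j. e' (\<pi> j) = e j)"
proof -
  obtain f where f: "bij_betw f {j. e j = - 1} {j. e' j = - 1}"
    using finite_same_card_bij[OF _ _ card(1)] by auto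
  obtain g where g: "bij_betw g {j. e j = 1} {j. e' j = 1}"
    using finite_same_card_bij[OF _ _ card(2)] by auto
  define \<pi> where "\<pi> j = (if e j = 1 then g j else f j)" for j
  have sign: "e' (\<pi> j) = e j" for j
    using e[of j] bij_betwE[OF f] bij_betwE[OF g] by (auto simp: \<pi>_def)
  have "inj \<pi>"
  proof (rule injI)
    fix i j assume eq: "\<pi> i = \<pi> j"
    then have "e i = e j" using sign by metis
    then show "i = j"
      using eq e[of i] e[of j] bij_betw_imp_inj_on[OF f] bij_betw_imp_inj_on[OF g]
      by (auto simp: \<pi>_def inj_on_def split: if_splits)
  qed
  then have "bij \<pi>" by (simp add: bij_def finite_UNIV_inj_surj)
  then show ?thesis using sign by blast
qed

lemma flag_forms_signs_irrelevant:
  assumes fr: "adapted_frame k V \<gamma> S l e" and I: "0 \<notin> I"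
  defines "\<gamma>' \<equiv> \<lambda>i C. if i \<in> I then - \<gamma> i C else \<gamma> i C"
  shows "adapted_frame k V \<gamma>' S l (\<lambda>j. if l j \<in> I then - e j else e j)"
    and "P_Isom k V \<gamma>' = P_Isom k V \<gamma>"
proof -
  have pull: "pullback_form V \<gamma>' i x = (if i \<in> I then - pullback_form V \<gamma> i x else pullback_form V \<gamma> i x)" for i x
    by (simp add: pullback_form_def \<gamma>'_def)
  have level: "level_form l (\<lambda>j. if l j \<in> I then - e j else e j) i x =
      (if i \<in> I then - level_form l e i x else level_form l e i x)" for i x
    by (simp add: level_form_eq sum_negf)
  show "adapted_frame k V \<gamma>' S l (\<lambda>j. if l j \<in> I then - e j else e j)"
    using fr by (auto simp: adapted_frame_def pull level)
  show "P_Isom k V \<gamma>' = P_Isom k V \<gamma>"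
    by (simp add: P_Isom_def Isom_flag_def pull cong: conj_cong)
qed

text \<open>Translates of \<open>\<beta>\<close> are chosen that are diagonal in the frame of the flag, with size
  \<open>(m + 1)\<^sup>-\<^sup>i\<close> on level \<open>i\<close>. They exist because the signs of the frame, reversed on the levels in \<open>I\<close>, are
  those of a diagonalization of \<open>\<beta>\<close> up to a permutation; reversing a form does not change its
  isometries.\<close>
lemma flag_geometry_is_limit:
  fixes \<beta> :: "real^'n \<Rightarrow> real"
  assumes quad: "quadratic_form_on UNIV \<beta>" and nondeg: "nondegenerate_mod UNIV {0} \<beta>"
    and pf: "partial_flag k V" and ff: "flag_of_forms k V \<gamma>"
    and p0: "fst (flag_signature V \<gamma> 0) \<noteq> 0"
    and part: "partitions_signature k (flag_signature V \<gamma>) (signature_mod UNIV {0} \<beta>)"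
  shows "(X_flag V \<gamma>, P_Isom k V \<gamma>) is_limit_of (X_space \<beta>, PO \<beta>)"
proof -
  obtain S l e where fr: "adapted_frame k V \<gamma> S l e" using adapted_frame_exists[OF pf ff] by blast
  note D = adapted_frameD[OF fr]
  note sig = flag_signature_of_frame[OF fr]
  obtain I where I: "I \<subseteq> {1..k}"
    "(\<Sum>i\<le>k. if i \<in> I then snd (flag_signature V \<gamma> i) else fst (flag_signature V \<gamma> i)) =
      fst (signature_mod UNIV {0} \<beta>)"
    "(\<Sum>i\<le>k. if i \<in> I then fst (flag_signature V \<gamma> i) else snd (flag_signature V \<gamma> i)) =
      snd (signature_mod UNIV {0} \<beta>)"
    using part unfolding partitions_signature_def by blast
  have I0: "0 \<notin> I" using I(1) by auto
  define e' where "e' j = (if l j \<in> I then - e j else e j)" for j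
  have e': "e' j = 1 \<or> e' j = - 1" for j using D(4)[of j] by (auto simp: e'_def)
  define \<gamma>' where "\<gamma>' = (\<lambda>i C. if i \<in> I then - \<gamma> i C else \<gamma> i C)"
  have fr': "adapted_frame k V \<gamma>' S l e'" and P': "P_Isom k V \<gamma>' = P_Isom k V \<gamma>"
    using flag_forms_signs_irrelevant[OF fr I0] unfolding \<gamma>'_def e'_def by blast+
  have "(\<Sum>i\<le>k. card {j. l j = i \<and> e' j = - 1}) = fst (signature_mod UNIV {0} \<beta>)"
    unfolding I(2)[symmetric] using sig by (intro sum.cong) (auto simp: e'_def intro!: arg_cong[of _ _ card])
  moreover have "(\<Sum>i\<le>k. card {j. l j = i \<and> e' j = 1}) = snd (signature_mod UNIV {0} \<beta>)"
    unfolding I(3)[symmetric] using sig by (intro sum.cong) (auto simp: e'_def intro!: arg_cong[of _ _ card])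
  ultimately have card': "card {j. e' j = - 1} = fst (signature_mod UNIV {0} \<beta>)"
    "card {j. e' j = 1} = snd (signature_mod UNIV {0} \<beta>)"
    by (simp_all add: card_by_levels D(3))
  obtain S0 :: "real^'n^'n" and e0 where S0: "invertible S0" "\<And>j. e0 j = 1 \<or> e0 j = - 1"
    "\<And>x. \<beta> (S0 *v x) = diag_form e0 x"
    using diagonalization_exists[OF quad nondeg] by blast
  have "signature_mod UNIV {0} \<beta> = (card {j. e0 j = - 1}, card {j. e0 j = 1})"
    by (rule signature_of_diagonalization[OF S0])
  then have "card {j. e0 j = - 1} = card {j. e' j = - 1}" "card {j. e0 j = 1} = card {j. e' j = 1}"
    unfolding card' by simp_all
  then obtain \<pi> where \<pi>: "bij \<pi>" "\<And>j. e' (\<pi> j) = e0 j"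
    using equinumerous_sign_patterns[where e = e0 and e' = e', OF S0(2) e'] by blast
  define c where "c i m = (1 / real (Suc m)) ^ i" for i m
  interpret separating_scales l e' c
  proof
    show "e' j \<noteq> 0" for j using e'[of j] by auto
    show "c i m > 0" for i m by (simp add: c_def)
    show "(\<lambda>m. c (l k) m / c (l j) m) \<longlonglongrightarrow> 0" if "l j < l k" for j k
    proof -
      have "c (l k) m / c (l j) m = (1 / real (Suc m)) ^ (l k - l j)" for m
        using that unfolding c_def by (subst power_diff) auto
      moreover have "(\<lambda>m. (1 / real (Suc m)) ^ (l k - l j)) \<longlonglongrightarrow> 0 ^ (l k - l j)"
        by (intro tendsto_power lim_1_over_n[THEN LIMSEQ_Suc])
      ultimately show ?thesis using that by (simp add: power_0_left)
    qed
  qed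
  \<comment> \<open>A permutation that matches the signs of the two diagonalizations, combined with the scaling of levels.\<close>
  define R :: "nat \<Rightarrow> real^'n^'n" where
    "R m = (\<chi> i j. if j = \<pi> i then sqrt (c (l j) m) else 0)" for m
  have R: "(R m *v x) $ i = sqrt (c (l (\<pi> i)) m) * x $ (\<pi> i)" for m x i
    by (simp add: R_def matrix_entry_expand if_distrib if_distribR cong: if_cong)
  have R_form: "diag_form e0 (R m *v x) = diag_form (coeff m) x" for m x
  proof -
    have "diag_form e0 (R m *v x) = (\<Sum>i\<in>UNIV. coeff m (\<pi> i) * (x $ \<pi> i)\<^sup>2)"
      unfolding diag_form_def
    proof (rule sum.cong)
      fix i
      show "e0 i * ((R m *v x) $ i)\<^sup>2 = coeff m (\<pi> i) * (x $ \<pi> i)\<^sup>2"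
        using c_pos[of "l (\<pi> i)" m] by (simp add: R coeff_def \<pi>(2) power_mult_distrib)
    qed simp
    also have "\<dots> = diag_form (coeff m) x"
      unfolding diag_form_def by (rule sum.reindex_bij_betw[OF \<pi>(1)])
    finally show ?thesis .
  qed
  have R_inv: "invertible (R m)" for m
  proof -
    have "x = 0" if x: "R m *v x = 0" for x
    proof (simp only: vec_eq_iff, rule allI)
      fix j
      obtain i where "j = \<pi> i" using \<pi>(1) by (metis bij_pointE)
      then show "x $ j = 0 $ j" using R[of m x i] x c_pos[of "l j" m] by simp
    qed
    then show ?thesis by (rule invertible_if_trivial_kernel)
  qed
  define G where "G m = matrix_inv (S0 ** R m ** matrix_inv S)" for m
  have inv: "invertible (S0 ** R m ** matrix_inv S)" for m
    by (intro invertible_mult S0 R_inv invertible_matrix_inv D)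
  have G: "invertible (G m)" for m unfolding G_def by (intro invertible_matrix_inv inv)
  have form: "form_translate \<beta> (G m) (S *v x) = diag_form (coeff m) x" for m x
    by (simp add: form_translate_def G_def matrix_inv_matrix_inv[OF inv] matrix_inv_vector[OF D(1)]
        S0(3) R_form flip: matrix_vector_mul_assoc)
  have "converges_geometrically (\<lambda>m. PO (form_translate \<beta> (G m))) (P_Isom k V \<gamma>)"
    unfolding P'[symmetric] by (rule PO_converges[OF fr' tendsto_const D(1) form])
  moreover have "\<exists>z\<in>X_flag V \<gamma>. \<forall>\<^sub>F m in sequentially. z \<in> X_space (form_translate \<beta> (G m))"
  proof -
    have "{j. l j = 0 \<and> e j = - 1} \<noteq> {}" using p0 sig[of 0] by auto
    then obtain j where j: "l j = 0" "e j = - 1" by blast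
    have "form_translate \<beta> (G m) (S *v axis j 1) < 0" for m
    proof -
      have "diag_form (coeff m) (axis j 1) = coeff m j"
        unfolding diag_form_bilinear diag_bilinear_axis by (simp add: axis_def)
      also have "\<dots> < 0" using j I0 c_pos[of 0 m] by (simp add: coeff_def e'_def)
      finally show ?thesis unfolding form .
    qed
    moreover have "S *v axis j 1 \<noteq> 0" by (simp add: invertible_vector_nonzero[OF D(1)] axis_eq_0_iff)
    ultimately have "rp_class (S *v axis j 1) \<in> X_space (form_translate \<beta> (G m))" for m
      unfolding X_space_def by blast
    then show ?thesis using negative_coordinate_in_X_flag[of k V \<gamma> S l e j, OF fr j] by (intro bexI) auto
  qed
  ultimately show ?thesis
    unfolding is_limit_of_iff[OF quad nondeg] using G subgeometry_flag[OF pf ff] by blast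
qed

theorem theorem1p2:
  fixes \<beta> :: "real^'n \<Rightarrow> real" and p q :: nat
  assumes "p \<ge> 1" and "q \<ge> 0" and "CARD('n) = p + q"
    and "quadratic_form_on UNIV \<beta>"
    and "nondegenerate_mod UNIV {0} \<beta>"
    and "signature_mod UNIV {0} \<beta> = (p, q)"
  shows "(\<forall>Z L. (Z, L) is_limit_of (X_space \<beta>, PO \<beta>) \<longrightarrow>
           (\<exists>k V \<gamma>. partial_flag k V \<and> flag_of_forms k V \<gamma> \<and>
              Z = X_flag V \<gamma> \<and> L = P_Isom k V \<gamma>)) \<and>
         (\<forall>k V \<gamma>. partial_flag k V \<and> flag_of_forms k V \<gamma> \<longrightarrow>
           ((X_flag V \<gamma>, P_Isom k V \<gamma>) is_limit_of (X_space \<beta>, PO \<beta>) \<longleftrightarrow>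
              fst (flag_signature V \<gamma> 0) \<noteq> 0 \<and>
              partitions_signature k (flag_signature V \<gamma>) (p, q)))"
proof (intro conjI allI impI)
  fix Z L assume "(Z, L) is_limit_of (X_space \<beta>, PO \<beta>)"
  then show "\<exists>k V \<gamma>. partial_flag k V \<and> flag_of_forms k V \<gamma> \<and> Z = X_flag V \<gamma> \<and> L = P_Isom k V \<gamma>"
    using limit_is_flag_geometry[OF assms(4,5)] by blast
next
  fix k and V :: "nat \<Rightarrow> (real^'n) set" and \<gamma>
  assume "partial_flag k V \<and> flag_of_forms k V \<gamma>"
  then show "(X_flag V \<gamma>, P_Isom k V \<gamma>) is_limit_of (X_space \<beta>, PO \<beta>) \<longleftrightarrow>
      fst (flag_signature V \<gamma> 0) \<noteq> 0 \<and> partitions_signature k (flag_signature V \<gamma>) (p, q)"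
    using limit_signature[OF assms(4,5)] flag_geometry_is_limit[OF assms(4,5)] unfolding assms(6) by blast
qed

end
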